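(* Let $(M_1,g_1)$ and $(M_2,g_2)$ be pseudo-Riemannian manifolds of dimensions $n_1,n_2\ge 2$, let $f\colon M_1\to(0,\infty)$ be smooth, and let $M=M_1\times_f M_2$ be the warped product manifold with metric $g=g_1\oplus f^2g_2$, of dimension $n=n_1+n_2$ and scalar curvature $\tau$. Then $M$ is concircularly flat if and only if the following three conditions hold: (1) $M_1$ is of constant curvature $\kappa_1=\kappa=\frac{\tau}{n(n-1)}$; (2) $\frac1f H^f(Y_1,Z_1)+\frac{\tau}{n(n-1)}g_1(Y_1,Z_1)=0$ for all vector fields $Y_1,Z_1$ on $M_1$; (3) $M_2$ is of constant curvature $\kappa_2=\|\mathrm{grad} f\|_1^2+\frac{\tau f^2}{n(n-1)}=\kappa f^2+\|\mathrm{grad} f\|_1^2$.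
   Context: The warped product metric is $g=\pi_1^*(g_1)+(f\circ\pi_1)^2\pi_2^*(g_2)$ on $M_1\times M_2$, with $\pi_i$ the natural projections. The curvature convention is $\mathcal R(X,Y)Z=\nabla_Y\nabla_XZ-\nabla_X\nabla_YZ+\nabla_{[X,Y]}Z$, so constant curvature $\kappa$ means $\mathcal R(X,Y)Z=\kappa[g(X,Z)Y-g(Y,Z)X]$. The concircular curvature tensor of an $n$-dimensional pseudo-Riemannian manifold with scalar curvature $\tau$ is $\mathcal C(X,Y)Z=\mathcal R(X,Y)Z-\frac{\tau}{n(n-1)}[g(X,Z)Y-g(Y,Z)X]$; the manifold is concircularly flat if $\mathcal C=0$ everywhere. $\mathrm{grad} f$ is the gradient of $f$ on $(M_1,g_1)$, $\|\mathrm{grad} f\|_1^2=g_1(\mathrm{grad} f,\mathrm{grad} f)$, and $H^f(Y_1,Z_1)=g_1(\nabla^1_{Y_1}\mathrm{grad} f,Z_1)$ is the Hessian of $f$ on $(M_1,g_1)$, where $\nabla^1$ is the Levi-Civita connection of $g_1$. Functions on $M_1$ or $M_2$ are regarded as functions on $M$ by pull-back.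
   Formalization: M_1 is assumed connected; otherwise the claim fails: M_1 = open hemisphere (f = cos r) together with a half-plane (f = x), M_2 = unit S^2 is concircularly flat, but M_1 is not of constant curvature. *)

theory Defs
  imports "HOL-Analysis.Analysis"
begin

section \<open>Smooth maps between Euclidean spaces\<close>

text \<open>On an open set \<open>S\<close>, \<open>Ck_on k S f\<close> says that \<open>f\<close> is \<open>k\<close> times continuously
  differentiable: all iterated directional derivatives of order at most \<open>k\<close> exist and are continuous.\<close>

fun Ck_on :: "nat \<Rightarrow> 'e::euclidean_space set \<Rightarrow> ('e \<Rightarrow> 'v::real_normed_vector) \<Rightarrow> bool" where
  "Ck_on 0 S f \<longleftrightarrow> continuous_on S f"
| "Ck_on (Suc k) S f \<longleftrightarrow>
     (\<forall>x\<in>S. f differentiable (at x)) \<and> (\<forall>v. Ck_on k S (\<lambda>x. frechet_derivative f (at x) v))"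

definition smooth_on :: "'e::euclidean_space set \<Rightarrow> ('e \<Rightarrow> 'v::real_normed_vector) \<Rightarrow> bool" where
  "smooth_on S f \<longleftrightarrow> (\<forall>k. Ck_on k S f)"


section \<open>Manifolds, tangent vectors and vector fields\<close>

text \<open>The points of a manifold form a whole (Hausdorff, second countable) type, and a smooth
  structure is given by an atlas, not necessarily maximal. A chart is a pair of its domain and its
  coordinate map; the dimension is that of the model space.\<close>

type_synonym ('a, 'e) atlas = "('a set \<times> ('a \<Rightarrow> 'e)) set"

definition smooth_atlas ::
  "('a::{t2_space,second_countable_topology}, 'e::euclidean_space) atlas \<Rightarrow> bool" where
  "smooth_atlas A \<longleftrightarrow>
     (\<Union>(U, \<phi>)\<in>A. U) = UNIV \<and>
     (\<forall>(U, \<phi>)\<in>A. open U \<and> open (\<phi> ` U) \<and> homeomorphism U (\<phi> ` U) \<phi> (inv_into U \<phi>)) \<and>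
     (\<forall>(U, \<phi>)\<in>A. \<forall>(V, \<psi>)\<in>A. smooth_on (\<phi> ` (U \<inter> V)) (\<psi> \<circ> inv_into U \<phi>))"

definition smooth_fun :: "('a, 'e::euclidean_space) atlas \<Rightarrow> ('a \<Rightarrow> real) \<Rightarrow> bool" where
  "smooth_fun A h \<longleftrightarrow> (\<forall>(U, \<phi>)\<in>A. smooth_on (\<phi> ` U) (h \<circ> inv_into U \<phi>))"

definition prod_atlas :: "('a, 'e) atlas \<Rightarrow> ('b, 'f) atlas \<Rightarrow> ('a \<times> 'b, 'e \<times> 'f) atlas" where
  "prod_atlas A B = {(U \<times> V, map_prod \<phi> \<psi>) | U \<phi> V \<psi>. (U, \<phi>) \<in> A \<and> (V, \<psi>) \<in> B}"

text \<open>A tangent vector at \<open>p\<close> is a linear combination of the coordinate derivations at \<open>p\<close>, i.e.\ the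
  directional derivative at \<open>p\<close> along some \<open>u\<close> in some chart. To make equality of
  tangent vectors plain equality, they are set to 0 on functions that are not smooth.\<close>

type_synonym 'a tvector = "('a \<Rightarrow> real) \<Rightarrow> real"
type_synonym 'a vfield = "'a \<Rightarrow> 'a tvector"

definition tangent_space :: "('a, 'e::euclidean_space) atlas \<Rightarrow> 'a \<Rightarrow> 'a tvector set" where
  "tangent_space A p =
     {(\<lambda>h. if smooth_fun A h then frechet_derivative (h \<circ> inv_into U \<phi>) (at (\<phi> p)) u else 0)
       | U \<phi> u. (U, \<phi>) \<in> A \<and> p \<in> U}"

definition push_forward :: "('a \<Rightarrow> 'b) \<Rightarrow> 'a tvector \<Rightarrow> 'b tvector" where
  "push_forward F v = (\<lambda>h. v (h \<circ> F))"

definition vector_fields :: "('a, 'e::euclidean_space) atlas \<Rightarrow> 'a vfield set" where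
  "vector_fields A =
     {X. (\<forall>p. X p \<in> tangent_space A p) \<and> (\<forall>h. smooth_fun A h \<longrightarrow> smooth_fun A (\<lambda>p. X p h))}"

definition lie_bracket :: "('a, 'e::euclidean_space) atlas \<Rightarrow> 'a vfield \<Rightarrow> 'a vfield \<Rightarrow> 'a vfield" where
  "lie_bracket A X Y = (\<lambda>p h. if smooth_fun A h then X p (\<lambda>q. Y q h) - Y p (\<lambda>q. X q h) else 0)"


section \<open>Metrics and the Levi-Civita connection\<close>

type_synonym 'a metric_tensor = "'a \<Rightarrow> 'a tvector \<Rightarrow> 'a tvector \<Rightarrow> real"

definition pseudo_riemannian_metric ::
  "('a, 'e::euclidean_space) atlas \<Rightarrow> 'a metric_tensor \<Rightarrow> bool" where
  "pseudo_riemannian_metric A g \<longleftrightarrow>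
     (\<forall>p. \<forall>u\<in>tangent_space A p. \<forall>v\<in>tangent_space A p. \<forall>w\<in>tangent_space A p.
        g p (\<lambda>h. u h + v h) w = g p u w + g p v w) \<and>
     (\<forall>p c. \<forall>u\<in>tangent_space A p. \<forall>w\<in>tangent_space A p. g p (\<lambda>h. c * u h) w = c * g p u w) \<and>
     (\<forall>p. \<forall>u\<in>tangent_space A p. \<forall>w\<in>tangent_space A p. g p u w = g p w u) \<and>
     (\<forall>p. \<forall>u\<in>tangent_space A p. (\<forall>w\<in>tangent_space A p. g p u w = 0) \<longrightarrow> u = (\<lambda>h. 0)) \<and>
     (\<forall>X\<in>vector_fields A. \<forall>Y\<in>vector_fields A. smooth_fun A (\<lambda>p. g p (X p) (Y p)))"

definition pseudo_riemannian_manifold ::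
  "('a::{t2_space,second_countable_topology}, 'e::euclidean_space) atlas \<Rightarrow> 'a metric_tensor \<Rightarrow> bool" where
  "pseudo_riemannian_manifold A g \<longleftrightarrow> smooth_atlas A \<and> pseudo_riemannian_metric A g"

definition warped_metric ::
  "'a metric_tensor \<Rightarrow> ('a \<Rightarrow> real) \<Rightarrow> 'b metric_tensor \<Rightarrow> ('a \<times> 'b) metric_tensor" where
  "warped_metric g1 f g2 = (\<lambda>x v w.
     g1 (fst x) (push_forward fst v) (push_forward fst w) +
     (f (fst x))\<^sup>2 * g2 (snd x) (push_forward snd v) (push_forward snd w))"

type_synonym 'a connection = "'a vfield \<Rightarrow> 'a vfield \<Rightarrow> 'a vfield"

definition affine_connection ::
  "('a, 'e::euclidean_space) atlas \<Rightarrow> 'a connection \<Rightarrow> bool" where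
  "affine_connection A D \<longleftrightarrow>
     (\<forall>X\<in>vector_fields A. \<forall>Y\<in>vector_fields A. D X Y \<in> vector_fields A) \<and>
     (\<forall>X\<in>vector_fields A. \<forall>Y\<in>vector_fields A. \<forall>Z\<in>vector_fields A. \<forall>p h.
        D (\<lambda>q k. X q k + Y q k) Z p h = D X Z p h + D Y Z p h) \<and>
     (\<forall>X\<in>vector_fields A. \<forall>Y\<in>vector_fields A. \<forall>a. smooth_fun A a \<longrightarrow> (\<forall>p h.
        D (\<lambda>q k. a q * X q k) Y p h = a p * D X Y p h)) \<and>
     (\<forall>X\<in>vector_fields A. \<forall>Y\<in>vector_fields A. \<forall>Z\<in>vector_fields A. \<forall>p h.
        D X (\<lambda>q k. Y q k + Z q k) p h = D X Y p h + D X Z p h) \<and>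
     (\<forall>X\<in>vector_fields A. \<forall>Y\<in>vector_fields A. \<forall>a. smooth_fun A a \<longrightarrow> (\<forall>p h.
        D X (\<lambda>q k. a q * Y q k) p h = X p a * Y p h + a p * D X Y p h))"

definition levi_civita ::
  "('a, 'e::euclidean_space) atlas \<Rightarrow> 'a metric_tensor \<Rightarrow> 'a connection \<Rightarrow> bool" where
  "levi_civita A g D \<longleftrightarrow>
     affine_connection A D \<and>
     (\<forall>X\<in>vector_fields A. \<forall>Y\<in>vector_fields A. \<forall>p h.
        D X Y p h - D Y X p h = lie_bracket A X Y p h) \<and>
     (\<forall>X\<in>vector_fields A. \<forall>Y\<in>vector_fields A. \<forall>Z\<in>vector_fields A. \<forall>p.
        X p (\<lambda>q. g q (Y q) (Z q)) = g p (D X Y p) (Z p) + g p (Y p) (D X Z p))"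

definition gradient ::
  "('a, 'e::euclidean_space) atlas \<Rightarrow> 'a metric_tensor \<Rightarrow> ('a \<Rightarrow> real) \<Rightarrow> 'a vfield" where
  "gradient A g h = (\<lambda>p. THE v. v \<in> tangent_space A p \<and> (\<forall>w\<in>tangent_space A p. g p v w = w h))"

definition hessian ::
  "('a, 'e::euclidean_space) atlas \<Rightarrow> 'a metric_tensor \<Rightarrow> 'a connection \<Rightarrow> ('a \<Rightarrow> real) \<Rightarrow>
   'a vfield \<Rightarrow> 'a vfield \<Rightarrow> 'a \<Rightarrow> real" where
  "hessian A g D h Y Z = (\<lambda>p. g p (D Y (gradient A g h) p) (Z p))"


section \<open>Curvature\<close>

text \<open>The sign convention is \<open>R(X,Y)Z = D\<^sub>Y D\<^sub>X Z - D\<^sub>X D\<^sub>Y Z + D\<^bsub>[X,Y]\<^esub> Z\<close>.\<close>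

definition curvature_op ::
  "('a, 'e::euclidean_space) atlas \<Rightarrow> 'a connection \<Rightarrow> 'a vfield \<Rightarrow> 'a vfield \<Rightarrow> 'a vfield \<Rightarrow> 'a vfield" where
  "curvature_op A D X Y Z =
     (\<lambda>p h. D Y (D X Z) p h - D X (D Y Z) p h + D (lie_bracket A X Y) Z p h)"

definition constant_curvature ::
  "('a, 'e::euclidean_space) atlas \<Rightarrow> 'a metric_tensor \<Rightarrow> 'a connection \<Rightarrow> real \<Rightarrow> bool" where
  "constant_curvature A g D \<kappa> \<longleftrightarrow>
     (\<forall>X\<in>vector_fields A. \<forall>Y\<in>vector_fields A. \<forall>Z\<in>vector_fields A. \<forall>p h.
        curvature_op A D X Y Z p h = \<kappa> * (g p (X p) (Z p) * Y p h - g p (Y p) (Z p) * X p h))"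

definition orthonormal_frame_at ::
  "('a, 'e::euclidean_space) atlas \<Rightarrow> 'a metric_tensor \<Rightarrow> 'a \<Rightarrow> (nat \<Rightarrow> 'a vfield) \<Rightarrow> bool" where
  "orthonormal_frame_at A g p E \<longleftrightarrow>
     (\<forall>i<DIM('e). E i \<in> vector_fields A \<and> \<bar>g p (E i p) (E i p)\<bar> = 1) \<and>
     (\<forall>i<DIM('e). \<forall>j<DIM('e). i \<noteq> j \<longrightarrow> g p (E i p) (E j p) = 0)"

text \<open>In the above sign convention, the Ricci tensor \<open>Ric(X,Y)\<close> is the trace of \<open>V \<mapsto> R(X,V)Y\<close>, and
  the scalar curvature is the metric trace of \<open>Ric\<close>; a space of constant curvature \<open>\<kappa>\<close> has scalar
  curvature \<open>n(n-1)\<kappa>\<close>. Traces are computed in frames that are orthonormal at the given point, and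
  \<open>g p (E i p) (E i p)\<close> is the sign \<open>\<epsilon>\<^sub>i\<close> of the \<open>i\<close>-th frame vector.\<close>

definition ricci_in_frame ::
  "('a, 'e::euclidean_space) atlas \<Rightarrow> 'a metric_tensor \<Rightarrow> 'a connection \<Rightarrow> (nat \<Rightarrow> 'a vfield) \<Rightarrow>
   'a vfield \<Rightarrow> 'a vfield \<Rightarrow> 'a \<Rightarrow> real" where
  "ricci_in_frame A g D E X Y p =
     (\<Sum>j<DIM('e). g p (E j p) (E j p) * g p (curvature_op A D X (E j) Y p) (E j p))"

definition scalar_curvature ::
  "('a, 'e::euclidean_space) atlas \<Rightarrow> 'a metric_tensor \<Rightarrow> 'a connection \<Rightarrow> 'a \<Rightarrow> real" where
  "scalar_curvature A g D p =
     (THE t. \<forall>E. orthonormal_frame_at A g p E \<longrightarrow>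
        t = (\<Sum>i<DIM('e). g p (E i p) (E i p) * ricci_in_frame A g D E (E i) (E i) p))"

definition concircular_curvature ::
  "('a, 'e::euclidean_space) atlas \<Rightarrow> 'a metric_tensor \<Rightarrow> 'a connection \<Rightarrow>
   'a vfield \<Rightarrow> 'a vfield \<Rightarrow> 'a vfield \<Rightarrow> 'a vfield" where
  "concircular_curvature A g D X Y Z = (\<lambda>p h.
     curvature_op A D X Y Z p h -
     scalar_curvature A g D p / (real DIM('e) * (real DIM('e) - 1)) *
       (g p (X p) (Z p) * Y p h - g p (Y p) (Z p) * X p h))"

definition concircularly_flat ::
  "('a, 'e::euclidean_space) atlas \<Rightarrow> 'a metric_tensor \<Rightarrow> 'a connection \<Rightarrow> bool" where
  "concircularly_flat A g D \<longleftrightarrow>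
     (\<forall>X\<in>vector_fields A. \<forall>Y\<in>vector_fields A. \<forall>Z\<in>vector_fields A. \<forall>p h.
        concircular_curvature A g D X Y Z p h = 0)"

end

theory Submission
  imports Defs
begin

text \<open>Write \<open>k = \<tau> / (n (n - 1))\<close>. Concircular flatness says \<open>R(X,Y)Z = k (g(X,Z) Y - g(Y,Z) X)\<close> at
  every point, and both directions only use this pointwise identity: the scalar curvature is never
  computed. Both sides are linear over smooth functions, so it suffices to test lifts of vector fields
  from the two factors, for which the Koszul formula gives the warped connection and its
  curvature. The mixed components amount to \<open>H\<^sup>f = - k f g\<^sub>1\<close>, which shows that \<open>k\<close> depends on
  the point of \<open>M\<^sub>1\<close> only; the component along \<open>M\<^sub>2\<close> gives constant curvature
  \<open>\<kappa>\<^sub>2 = k f\<^sup>2 + \<bar>grad f\<bar>\<^sup>2\<close>, which cannot depend on the point of \<open>M\<^sub>1\<close>. Differentiating it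
  and inserting the Hessian leaves \<open>f\<^sup>2 dk = 0\<close>, so \<open>k\<close> is constant on the connected \<open>M\<^sub>1\<close>.\<close>

section \<open>Calculus of smooth maps\<close>

text \<open>Connections, brackets and curvature take globally defined fields, and tangent vectors
  act on globally smooth functions, whereas coordinates exist on one chart only. Every local
  computation therefore passes through cutoffs, which is why the proof begins with a bump function;
  even the smoothness of lifts to the product is obtained this way.

  Curvature constants are compared without orthonormal frames, which would be awkward for an
  indefinite metric: nondegeneracy and two independent tangent vectors suffice, and this is where
  the dimension of M2 enters.

  The function \<open>k\<close> is given as a bare function of the point. Its value is frozen at one
  point before linearity over smooth functions is used; its smoothness, needed to differentiate it,
  is recovered afterwards by solving the formula for the curvature of M2 for
  \<open>k\<close>.\<close>

lemma Ck_on_cong: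
  assumes "open S" "\<And>x. x \<in> S \<Longrightarrow> f x = g x" "Ck_on k S f"
  shows "Ck_on k S g"
  using assms(2,3)
proof (induction k arbitrary: f g)
  case 0
  then show ?case by (simp cong: continuous_on_cong)
next
  case (Suc k)
  have g': "(g has_derivative frechet_derivative f (at x)) (at x)" if "x \<in> S" for x
  proof -
    have "(f has_derivative frechet_derivative f (at x)) (at x)"
      using Suc.prems that frechet_derivative_works by auto
    then show ?thesis
      using has_derivative_transform_within_open[OF _ \<open>open S\<close> that] Suc.prems(1) by metis
  qed
  then have "frechet_derivative f (at x) v = frechet_derivative g (at x) v" if "x \<in> S" for x v
    using frechet_derivative_at that by metis
  then have "Ck_on k S (\<lambda>x. frechet_derivative g (at x) v)" for v
    using Suc.IH[of "\<lambda>x. frechet_derivative f (at x) v" "\<lambda>x. frechet_derivative g (at x) v"] Suc.prems(2) by simp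
  with g' show ?case
    by (auto simp: differentiable_def)
qed

text \<open>Lets an explicit derivative stand in for \<open>frechet_derivative\<close>, which is a
  choice term; all closure rules below go through it.\<close>

lemma Ck_on_Suc_intro:
  assumes "open S" "\<And>x. x \<in> S \<Longrightarrow> (f has_derivative f' x) (at x)" "\<And>v. Ck_on k S (\<lambda>x. f' x v)"
  shows "Ck_on (Suc k) S f"
proof -
  have "f' x v = frechet_derivative f (at x) v" if "x \<in> S" for x v
    using frechet_derivative_at[OF assms(2)[OF that]] by simp
  then have "Ck_on k S (\<lambda>x. frechet_derivative f (at x) v)" for v
    using Ck_on_cong[OF assms(1) _ assms(3)[of v]] by simp
  with assms(2) show ?thesis
    by (auto simp: differentiable_def)
qed

lemma Ck_on_Suc_derivative:
  assumes "Ck_on (Suc k) S f" "x \<in> S"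
  shows "(f has_derivative frechet_derivative f (at x)) (at x)"
  using assms frechet_derivative_works by auto

lemma Ck_on_SucD: "Ck_on (Suc k) S f \<Longrightarrow> Ck_on k S f"
proof (induction k arbitrary: f)
  case 0
  then show ?case
    by (auto intro!: continuous_at_imp_continuous_on differentiable_imp_continuous_within)
next
  case (Suc k)
  then show ?case by auto
qed

lemma Ck_on_subset: "Ck_on k S f \<Longrightarrow> T \<subseteq> S \<Longrightarrow> Ck_on k T f"
  by (induction k arbitrary: f) (auto intro: continuous_on_subset)

lemma Ck_on_locally:
  assumes "\<And>x. x \<in> S \<Longrightarrow> \<exists>T. open T \<and> x \<in> T \<and> Ck_on k T f"
  shows "Ck_on k S f"
  using assms
proof (induction k arbitrary: f)
  case 0
  have "isCont f x" if "x \<in> S" for x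
    using 0[OF that] continuous_on_eq_continuous_at by auto
  then show ?case by (simp add: continuous_at_imp_continuous_on)
next
  case (Suc k)
  have "f differentiable (at x)" if "x \<in> S" for x
    using Suc.prems[OF that] by auto
  moreover have "Ck_on k S (\<lambda>x. frechet_derivative f (at x) v)" for v
  proof (rule Suc.IH)
    fix x assume "x \<in> S"
    with Suc.prems obtain T where "open T" "x \<in> T" "Ck_on (Suc k) T f" by blast
    then show "\<exists>T. open T \<and> x \<in> T \<and> Ck_on k T (\<lambda>x. frechet_derivative f (at x) v)" by auto
  qed
  ultimately show ?case by simp
qed

lemma Ck_on_const: "open S \<Longrightarrow> Ck_on k S (\<lambda>x::'e::euclidean_space. c :: 'v::real_normed_vector)"
proof (induction k arbitrary: c)
  case (Suc k)
  then show ?case by (intro Ck_on_Suc_intro[where f'="\<lambda>_ _. 0"]) auto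
qed simp

lemma Ck_on_bounded_linear:
  fixes L :: "'e::euclidean_space \<Rightarrow> 'v::real_normed_vector"
  assumes "bounded_linear L" "open S"
  shows "Ck_on k S L"
proof (cases k)
  case 0
  then show ?thesis using assms by (simp add: linear_continuous_on)
next
  case (Suc m)
  then show ?thesis
    unfolding Suc using assms
    by (intro Ck_on_Suc_intro[where f'="\<lambda>_. L"] bounded_linear_imp_has_derivative Ck_on_const)
qed

lemma Ck_on_linear_compose:
  fixes f :: "'e::euclidean_space \<Rightarrow> 'v::real_normed_vector"
    and L :: "'v \<Rightarrow> 'w::real_normed_vector"
  assumes "bounded_linear L" "open S" "Ck_on k S f"
  shows "Ck_on k S (\<lambda>x. L (f x))"
  using assms(3)
proof (induction k arbitrary: f)
  case 0
  then show ?case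
    using bounded_linear.continuous_on[OF assms(1)] by simp
next
  case (Suc k)
  show ?case
    using Suc assms
    by (intro Ck_on_Suc_intro[where f'="\<lambda>x v. L (frechet_derivative f (at x) v)"])
       (auto intro!: bounded_linear.has_derivative[OF assms(1)] Ck_on_Suc_derivative[OF Suc.prems])
qed

lemma Ck_on_add:
  fixes f g :: "'e::euclidean_space \<Rightarrow> 'v::real_normed_vector"
  assumes "open S" "Ck_on k S f" "Ck_on k S g"
  shows "Ck_on k S (\<lambda>x. f x + g x)"
  using assms(2,3)
proof (induction k arbitrary: f g)
  case 0
  then show ?case by (simp add: continuous_on_add)
next
  case (Suc k)
  then show ?case
    by (intro Ck_on_Suc_intro[OF assms(1), where
          f'="\<lambda>x v. frechet_derivative f (at x) v + frechet_derivative g (at x) v"])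
       (auto intro!: has_derivative_add Ck_on_Suc_derivative[OF Suc.prems(1)] Ck_on_Suc_derivative[OF Suc.prems(2)])
qed

lemma Ck_on_sum:
  fixes f :: "'i \<Rightarrow> 'e::euclidean_space \<Rightarrow> 'v::real_normed_vector"
  assumes "open S" "\<And>i. i \<in> I \<Longrightarrow> Ck_on k S (f i)"
  shows "Ck_on k S (\<lambda>x. \<Sum>i\<in>I. f i x)"
  using assms(2)
  by (induction I rule: infinite_finite_induct) (auto intro: Ck_on_const Ck_on_add assms(1))

text \<open>One induction for multiplication, scaling and the inner product. Both factors are
  generalised because the product rule replaces either of them by a derivative.\<close>

lemma (in bounded_bilinear) Ck_on_prod:
  fixes f :: "'e::euclidean_space \<Rightarrow> 'a" and g :: "'e \<Rightarrow> 'b"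
  assumes "open S" "Ck_on k S f" "Ck_on k S g"
  shows "Ck_on k S (\<lambda>x. prod (f x) (g x))"
  using assms(2,3)
proof (induction k arbitrary: f g)
  case 0
  then show ?case by (simp add: continuous_on)
next
  case (Suc k)
  have "Ck_on k S (\<lambda>x. prod (f x) (frechet_derivative g (at x) v) + prod (frechet_derivative f (at x) v) (g x))" for v
    using Suc Ck_on_SucD[OF Suc.prems(1)] Ck_on_SucD[OF Suc.prems(2)] 
    by (intro Ck_on_add assms(1)) auto
  then show ?case
    by (intro Ck_on_Suc_intro[OF assms(1), where
          f'="\<lambda>x v. prod (f x) (frechet_derivative g (at x) v) + prod (frechet_derivative f (at x) v) (g x)"])
       (auto intro!: FDERIV Ck_on_Suc_derivative[OF Suc.prems(1)] Ck_on_Suc_derivative[OF Suc.prems(2)])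
qed

lemmas Ck_on_mult = bounded_bilinear.Ck_on_prod[OF bounded_bilinear_mult]
lemmas Ck_on_scaleR = bounded_bilinear.Ck_on_prod[OF bounded_bilinear_scaleR]

text \<open>\<open>Ck_on\<close> speaks of derivatives along fixed directions, but the chain rule
  differentiates \<open>g\<close> along a direction that moves with \<open>x\<close>. Expanding that
  direction in the basis of the middle space leaves fixed directions with differentiable
  coefficients.\<close>

lemma Ck_on_compose:
  fixes f :: "'e::euclidean_space \<Rightarrow> 'w::euclidean_space" and g :: "'w \<Rightarrow> 'v::real_normed_vector"
  assumes "open S" "open T" "f ` S \<subseteq> T" "Ck_on k S f" "Ck_on k T g"
  shows "Ck_on k S (\<lambda>x. g (f x))"
  using assms(4,5)
proof (induction k arbitrary: g)
  case 0
  then show ?case 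
    using continuous_on_compose2[of T g S f] assms(3) by simp
next
  case (Suc k)
  let ?d = "\<lambda>x v. \<Sum>i\<in>Basis. (frechet_derivative f (at x) v \<bullet> i) *\<^sub>R frechet_derivative g (at (f x)) i"
  have "Ck_on k S (\<lambda>x. ?d x v)" for v
  proof (intro Ck_on_sum Ck_on_scaleR assms(1))
    fix i :: 'w assume "i \<in> Basis"
    show "Ck_on k S (\<lambda>x. frechet_derivative f (at x) v \<bullet> i)"
      using Suc.prems(1) by (intro Ck_on_linear_compose[OF bounded_linear_inner_left assms(1)]) auto
    show "Ck_on k S (\<lambda>x. frechet_derivative g (at (f x)) i)"
      using Suc.IH[of "\<lambda>y. frechet_derivative g (at y) i"] Suc.prems Ck_on_SucD by auto
  qed
  moreover have "((\<lambda>x. g (f x)) has_derivative (\<lambda>v. ?d x v)) (at x)" if "x \<in> S" for x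
  proof -
    have df: "(f has_derivative frechet_derivative f (at x)) (at x)"
      using Suc.prems(1) that by (rule Ck_on_Suc_derivative)
    have dg: "(g has_derivative frechet_derivative g (at (f x))) (at (f x))"
      using Suc.prems(2) that assms(3) by (intro Ck_on_Suc_derivative) auto
    interpret g': bounded_linear "frechet_derivative g (at (f x))"
      using dg has_derivative_bounded_linear by blast
    have "frechet_derivative g (at (f x)) (frechet_derivative f (at x) v) = ?d x v" for v
      by (subst euclidean_representation[symmetric, of "frechet_derivative f (at x) v"])
         (simp only: g'.sum g'.scaleR)
    with has_derivative_compose[OF df dg] show ?thesis by simp
  qed
  ultimately show ?case by (intro Ck_on_Suc_intro[OF assms(1)])
qed

section \<open>Closure properties of smooth maps\<close>

lemma smooth_on_cong:
  "open S \<Longrightarrow> (\<And>x. x \<in> S \<Longrightarrow> f x = g x) \<Longrightarrow> smooth_on S f \<Longrightarrow> smooth_on S g"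
  unfolding smooth_on_def using Ck_on_cong[of S f g] by simp

lemma smooth_on_subset: "smooth_on S f \<Longrightarrow> T \<subseteq> S \<Longrightarrow> smooth_on T f"
  unfolding smooth_on_def using Ck_on_subset[of _ S f T] by simp

lemma smooth_on_locally:
  "(\<And>x. x \<in> S \<Longrightarrow> \<exists>T. open T \<and> x \<in> T \<and> smooth_on T f) \<Longrightarrow> smooth_on S f"
  unfolding smooth_on_def by (intro allI Ck_on_locally) meson

lemma smooth_on_const: "open S \<Longrightarrow> smooth_on S (\<lambda>x. c)"
  by (simp add: smooth_on_def Ck_on_const)

lemma smooth_on_bounded_linear: "bounded_linear L \<Longrightarrow> open S \<Longrightarrow> smooth_on S L"
  by (simp add: smooth_on_def Ck_on_bounded_linear)

lemma smooth_on_linear_compose: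
  "bounded_linear L \<Longrightarrow> open S \<Longrightarrow> smooth_on S f \<Longrightarrow> smooth_on S (\<lambda>x. L (f x))"
  by (simp add: smooth_on_def Ck_on_linear_compose)

lemma smooth_on_add:
  "open S \<Longrightarrow> smooth_on S f \<Longrightarrow> smooth_on S g \<Longrightarrow> smooth_on S (\<lambda>x. f x + g x)"
  by (simp add: smooth_on_def Ck_on_add)

lemma smooth_on_mult:
  "open S \<Longrightarrow> smooth_on S f \<Longrightarrow> smooth_on S g \<Longrightarrow> smooth_on S (\<lambda>x. f x * g x :: real)"
  by (simp add: smooth_on_def Ck_on_mult)

lemma smooth_on_compose:
  "open S \<Longrightarrow> open T \<Longrightarrow> f ` S \<subseteq> T \<Longrightarrow> smooth_on S f \<Longrightarrow> smooth_on T g \<Longrightarrow> smooth_on S (\<lambda>x. g (f x))"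
  unfolding smooth_on_def using Ck_on_compose[of S T f _ g] by simp

lemma smooth_on_Pair:
  fixes f :: "'e::euclidean_space \<Rightarrow> 'v::real_normed_vector" and g :: "'e \<Rightarrow> 'w::real_normed_vector"
  assumes "open S" "smooth_on S f" "smooth_on S g"
  shows "smooth_on S (\<lambda>x. (f x, g x))"
proof -
  have "bounded_linear (\<lambda>x::'v. (x, 0::'w))" "bounded_linear (\<lambda>y::'w. (0::'v, y))"
    by (auto intro!: bounded_linear_Pair bounded_linear_ident bounded_linear_zero)
  then have "smooth_on S (\<lambda>x. (f x, 0) + (0, g x))"
    using assms by (intro smooth_on_add smooth_on_linear_compose[where L="\<lambda>x. (x, 0)"] smooth_on_linear_compose[where L="\<lambda>y. (0, y)"])
  then show ?thesis by simp
qed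

lemma smooth_on_derivative: "smooth_on S f \<Longrightarrow> smooth_on S (\<lambda>x. frechet_derivative f (at x) v)"
  unfolding smooth_on_def using Ck_on.simps(2)[of _ S f] by blast

lemma smooth_on_has_derivative:
  "smooth_on S f \<Longrightarrow> x \<in> S \<Longrightarrow> (f has_derivative frechet_derivative f (at x)) (at x)"
  unfolding smooth_on_def using Ck_on_Suc_derivative[of 0 S f] by blast

lemma smooth_on_imp_continuous_on: "smooth_on S f \<Longrightarrow> continuous_on S f"
  unfolding smooth_on_def using Ck_on.simps(1)[of S f] by blast

text \<open>The derivative is again a product of \<open>inverse\<close> with itself and a constant,
  so the induction feeds on its own hypothesis and needs no formula for higher derivatives.\<close>

lemma smooth_on_inverse: "smooth_on (- {0::real}) inverse"
proof -
  have "Ck_on k (- {0::real}) inverse" for k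
  proof (induction k)
    case 0
    then show ?case by (auto intro!: continuous_on_inverse continuous_on_id)
  next
    case (Suc k)
    have o: "open (- {0::real})" by auto
    have "Ck_on k (- {0::real}) (\<lambda>x. inverse x * (inverse x * (- v)))" for v
      by (intro Ck_on_mult Suc Ck_on_const o)
    moreover have "(inverse has_derivative (\<lambda>v. inverse x * (inverse x * (- v)))) (at x)" if "x \<in> - {0}" for x :: real
      using has_derivative_inverse'[of x UNIV] that by (simp add: mult_ac)
    ultimately show ?case
      by (intro Ck_on_Suc_intro[OF o])
  qed
  then show ?thesis by (simp add: smooth_on_def)
qed

text \<open>The family \<open>t\<^sup>-\<^sup>m exp (- 1/t)\<close>, extended by 0, is closed under differentiation up to linear
  combinations.\<close>

definition flat_exp :: "nat \<Rightarrow> real \<Rightarrow> real" where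
  "flat_exp m t = (if t > 0 then inverse t ^ m * exp (- inverse t) else 0)"

lemma flat_exp_tendsto_0: "((\<lambda>t. inverse t ^ m * exp (- inverse t)) \<longlongrightarrow> (0::real)) (at_right 0)"
proof -
  have "((\<lambda>u. u ^ m / exp u) \<longlongrightarrow> (0::real)) at_top"
    by (rule tendsto_power_div_exp_0)
  then have "((\<lambda>t. inverse t ^ m / exp (inverse t)) \<longlongrightarrow> (0::real)) (at_right 0)"
    by (rule filterlim_compose[OF _ filterlim_inverse_at_top_right])
  then show ?thesis by (simp add: exp_minus divide_inverse)
qed

lemma flat_exp_has_derivative:
  "(flat_exp m has_field_derivative (flat_exp (m + 2) t - real m * flat_exp (m + 1) t)) (at t)"
proof -
  consider "t > 0" | "t < 0" | "t = 0" by linarith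
  then show ?thesis
  proof cases
    case 1
    have e: "((\<lambda>t. inverse t ^ m * exp (- inverse t)) has_field_derivative
        (flat_exp (m + 2) t - real m * flat_exp (m + 1) t)) (at t)"
      using 1
      by (auto intro!: derivative_eq_intros simp: flat_exp_def power_add power2_eq_square field_simps)
        \<comment> \<open>The derivative of the power carries the exponent \<open>m - 1\<close>,
          which is truncated at \<open>m = 0\<close>.\<close>
        (cases m; simp add: field_simps)
    show ?thesis
      by (rule has_field_derivative_transform_within_open[OF e, of "{0<..}"])
        (use 1 in \<open>auto simp: flat_exp_def\<close>)
  next
    case 2
    have e: "((\<lambda>t. 0) has_field_derivative (flat_exp (m + 2) t - real m * flat_exp (m + 1) t)) (at t)"
      using 2 by (simp add: flat_exp_def)
    show ?thesis
      by (rule has_field_derivative_transform_within_open[OF e, of "{..<0}"])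
        (use 2 in \<open>auto simp: flat_exp_def\<close>)
  next
    case 3
    \<comment> \<open>At 0 the difference quotient of \<open>flat_exp m\<close> is
      \<open>flat_exp (Suc m)\<close> itself, so differentiability there is a limit of the next
      member of the family.\<close>
    have "((\<lambda>h. flat_exp (Suc m) h) \<longlongrightarrow> 0) (at_right 0)"
      using flat_exp_tendsto_0[of "Suc m"]
      by (rule Lim_transform_eventually) (auto simp: eventually_at_right_field flat_exp_def intro!: exI[of _ 1])
    moreover have "((\<lambda>h. flat_exp (Suc m) h) \<longlongrightarrow> 0) (at_left 0)"
      by (rule Lim_transform_eventually[OF tendsto_const]) (auto simp: eventually_at_left_field flat_exp_def intro!: exI[of _ "-1"])
    ultimately have "((\<lambda>h. flat_exp (Suc m) h) \<longlongrightarrow> 0) (at 0)"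
      by (simp add: filterlim_split_at)
    then have "((\<lambda>h. (flat_exp m (0 + h) - flat_exp m 0) / h) \<longlongrightarrow> 0) (at 0)"
      by (rule Lim_transform_eventually) (auto simp: eventually_at_filter flat_exp_def divide_inverse mult_ac)
    then show ?thesis
      using 3 by (simp add: DERIV_def flat_exp_def)
  qed
qed

lemma smooth_on_flat_exp: "smooth_on UNIV (flat_exp m)"
proof -
  have "Ck_on k UNIV (flat_exp m)" for k
  proof (induction k arbitrary: m)
    case 0
    have "isCont (flat_exp m) t" for t
      using flat_exp_has_derivative DERIV_isCont by blast
    then show ?case by (simp add: continuous_at_imp_continuous_on)
  next
    case (Suc k)
    have o: "open (UNIV :: real set)" by simp
    have "Ck_on k UNIV (\<lambda>t. v * flat_exp (m + 2) t + (- real m * v) * flat_exp (m + 1) t)" for v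
      by (intro Ck_on_add Ck_on_mult Suc Ck_on_const o)
    moreover have "(flat_exp m has_derivative
        (\<lambda>v. v * flat_exp (m + 2) t + (- real m * v) * flat_exp (m + 1) t)) (at t)" for t
      using flat_exp_has_derivative[of m t, unfolded has_field_derivative_def]
      by (rule has_derivative_eq_rhs) (auto simp: algebra_simps)
    ultimately show ?case
      by (intro Ck_on_Suc_intro[OF o])
  qed
  then show ?thesis by (simp add: smooth_on_def)
qed

text \<open>The profile is \<open>flat_exp 0\<close> applied to \<open>r\<close> squared minus the
  squared distance, normalised at the centre. It has no plateau: later arguments use only the value
  at the centre and the vanishing outside the ball.\<close>

lemma euclidean_bump:
  fixes c :: "'e::euclidean_space"
  assumes "r > 0"
  obtains \<beta> :: "'e \<Rightarrow> real" where "smooth_on UNIV \<beta>" "\<beta> c = 1" "\<And>x. x \<notin> cball c r \<Longrightarrow> \<beta> x = 0"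
proof
  let ?q = "\<lambda>x::'e. r\<^sup>2 + - 1 * ((x + - c) \<bullet> (x + - c))"
  let ?\<beta> = "\<lambda>x::'e. flat_exp 0 (?q x) * inverse (flat_exp 0 (r\<^sup>2))"
  have l: "smooth_on UNIV (\<lambda>x::'e. x + - c)"
    by (intro smooth_on_add smooth_on_const smooth_on_bounded_linear bounded_linear_ident open_UNIV)
  have "smooth_on UNIV ?q"
    using bounded_bilinear.Ck_on_prod[OF bounded_bilinear_inner open_UNIV] l
    by (intro smooth_on_add smooth_on_mult smooth_on_const open_UNIV) (auto simp only: smooth_on_def)
  then show "smooth_on UNIV ?\<beta>"
    using smooth_on_compose[OF open_UNIV open_UNIV _ _ smooth_on_flat_exp]
    by (intro smooth_on_mult smooth_on_const open_UNIV) auto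
  show "?\<beta> c = 1" using assms by (simp add: flat_exp_def)
  fix x assume "x \<notin> cball c r"
  then have "r < norm (x - c)" by (simp add: dist_norm norm_minus_commute)
  then have "r\<^sup>2 < (norm (x - c))\<^sup>2" using assms by (intro power_strict_mono) auto
  then show "?\<beta> x = 0" by (simp add: flat_exp_def dot_square_norm)
qed

section \<open>Tangent vectors and vector fields\<close>

text \<open>The elements of \<open>tangent_space\<close>, named as functions of the coordinate
  vector so that linearity and injectivity in it can be stated.\<close>

definition coord_vec ::
  "('a, 'e::euclidean_space) atlas \<Rightarrow> 'a set \<Rightarrow> ('a \<Rightarrow> 'e) \<Rightarrow> 'a \<Rightarrow> 'e \<Rightarrow> 'a tvector" where
  "coord_vec A U \<phi> p u =
     (\<lambda>h. if smooth_fun A h then frechet_derivative (h \<circ> inv_into U \<phi>) (at (\<phi> p)) u else 0)"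

text \<open>Constants in place of the lambda terms of \<open>affine_connection\<close> give the
  linearity laws left-hand sides on which the simplifier can rewrite.\<close>

definition vadd :: "'a vfield \<Rightarrow> 'a vfield \<Rightarrow> 'a vfield" where
  "vadd X Y = (\<lambda>p h. X p h + Y p h)"

definition vscale :: "('a \<Rightarrow> real) \<Rightarrow> 'a vfield \<Rightarrow> 'a vfield" where
  "vscale a X = (\<lambda>p h. a p * X p h)"

lemma vadd_apply [simp]: "vadd X Y p h = X p h + Y p h"
  by (simp add: vadd_def)

lemma vscale_apply [simp]: "vscale a X p h = a p * X p h"
  by (simp add: vscale_def)

lemma vfield_eqI: "(\<And>p h. X p h = Y p h) \<Longrightarrow> X = (Y :: 'a vfield)"
  by (intro ext)

section \<open>Charts, smooth functions and cutoffs on a manifold\<close>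

locale smooth_manifold =
  fixes A :: "('a::{t2_space,second_countable_topology}, 'e::euclidean_space) atlas"
  assumes atlas: "smooth_atlas A"
begin

lemma obtain_chart:
  obtains U \<phi> where "(U, \<phi>) \<in> A" "p \<in> U"
proof -
  have "p \<in> (\<Union>(U, \<phi>)\<in>A. U)" using atlas by (simp add: smooth_atlas_def)
  then show ?thesis using that by auto
qed

lemma chart_homeomorphism:
  assumes "(U, \<phi>) \<in> A"
  shows "open U" "open (\<phi> ` U)" "homeomorphism U (\<phi> ` U) \<phi> (inv_into U \<phi>)"
  using atlas assms unfolding smooth_atlas_def by fast+

lemma chart_inverse [simp]:
  assumes "(U, \<phi>) \<in> A" "p \<in> U"
  shows "inv_into U \<phi> (\<phi> p) = p"
  using chart_homeomorphism(3)[OF assms(1)] assms(2) by (simp add: homeomorphism_apply1)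

lemma chart_inj: "(U, \<phi>) \<in> A \<Longrightarrow> inj_on \<phi> U"
  using chart_inverse by (metis inj_onI)

lemma chart_continuous: "(U, \<phi>) \<in> A \<Longrightarrow> continuous_on U \<phi>"
  using chart_homeomorphism(3) homeomorphism_cont1 by blast

lemma chart_open_image:
  assumes "(U, \<phi>) \<in> A" "open W" "W \<subseteq> U"
  shows "open (\<phi> ` W)"
proof -
  have "openin (top_of_set U) W" using assms by (simp add: open_subset)
  then have "openin (top_of_set (\<phi> ` U)) (\<phi> ` W)"
    by (rule homeomorphism_imp_open_map[OF chart_homeomorphism(3)[OF assms(1)]])
  then show ?thesis using chart_homeomorphism(2)[OF assms(1)] openin_open_eq by blast
qed

lemma chart_transition:
  assumes "(U, \<phi>) \<in> A" "(V, \<psi>) \<in> A"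
  shows "smooth_on (\<phi> ` (U \<inter> V)) (\<psi> \<circ> inv_into U \<phi>)"
  using atlas assms unfolding smooth_atlas_def by fast

lemma smooth_funD:
  "smooth_fun A h \<Longrightarrow> (U, \<phi>) \<in> A \<Longrightarrow> smooth_on (\<phi> ` U) (h \<circ> inv_into U \<phi>)"
  unfolding smooth_fun_def by fast

text \<open>The definition tests every chart of the atlas. Smooth transition maps reduce this to one
  local representation around each point.\<close>

lemma smooth_funI:
  assumes "\<And>p. \<exists>U \<phi> W k. (U, \<phi>) \<in> A \<and> open W \<and> p \<in> W \<and> W \<subseteq> U \<and> smooth_on (\<phi> ` W) k \<and> (\<forall>q\<in>W. h q = k (\<phi> q))"
  shows "smooth_fun A h"
proof -
  have "smooth_on (\<psi> ` V) (h \<circ> inv_into V \<psi>)" if V: "(V, \<psi>) \<in> A" for V \<psi>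
  proof (rule smooth_on_locally)
    fix y assume "y \<in> \<psi> ` V"
    then obtain p where p: "p \<in> V" "y = \<psi> p" by blast
    obtain U \<phi> W k where U: "(U, \<phi>) \<in> A" and W: "open W" "p \<in> W" "W \<subseteq> U"
      and k: "smooth_on (\<phi> ` W) k" "\<And>q. q \<in> W \<Longrightarrow> h q = k (\<phi> q)"
      using assms[of p] by blast
    let ?S = "\<psi> ` (V \<inter> W)"
    have o: "open ?S" "open (\<phi> ` W)"
      using V U W chart_homeomorphism(1) by (auto intro!: chart_open_image)
    have "smooth_on ?S (\<phi> \<circ> inv_into V \<psi>)"
      using chart_transition[OF V U] W by (rule_tac smooth_on_subset) auto
    moreover have "(\<phi> \<circ> inv_into V \<psi>) ` ?S \<subseteq> \<phi> ` W"
      using V by auto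
    ultimately have "smooth_on ?S (\<lambda>x. k ((\<phi> \<circ> inv_into V \<psi>) x))"
      using smooth_on_compose[OF o] k(1) by blast
    then have "smooth_on ?S (h \<circ> inv_into V \<psi>)"
      by (rule smooth_on_cong[OF o(1), rotated]) (use V k(2) in auto)
    then show "\<exists>T. open T \<and> y \<in> T \<and> smooth_on T (h \<circ> inv_into V \<psi>)"
      using o(1) p W by blast
  qed
  then show ?thesis unfolding smooth_fun_def by blast
qed

lemma smooth_fun_chartI:
  assumes "\<And>U \<phi>. (U, \<phi>) \<in> A \<Longrightarrow> smooth_on (\<phi> ` U) (\<lambda>x. h (inv_into U \<phi> x))"
  shows "smooth_fun A h"
  using assms unfolding smooth_fun_def comp_def by blast

lemma smooth_fun_chartD:
  assumes "smooth_fun A h" "(U, \<phi>) \<in> A"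
  shows "smooth_on (\<phi> ` U) (\<lambda>x. h (inv_into U \<phi> x))"
  using assms unfolding smooth_fun_def comp_def by blast

lemma smooth_fun_const: "smooth_fun A (\<lambda>p. c)"
  by (rule smooth_fun_chartI, rule smooth_on_const, rule chart_homeomorphism)

lemma smooth_fun_add:
  assumes "smooth_fun A h" "smooth_fun A k" shows "smooth_fun A (\<lambda>p. h p + k p)"
  using assms chart_homeomorphism(2)
  by (auto intro!: smooth_fun_chartI smooth_on_add dest: smooth_fun_chartD)

lemma smooth_fun_mult:
  assumes "smooth_fun A h" "smooth_fun A k" shows "smooth_fun A (\<lambda>p. h p * k p)"
  using assms chart_homeomorphism(2)
  by (auto intro!: smooth_fun_chartI smooth_on_mult dest: smooth_fun_chartD)

lemma smooth_fun_minus: "smooth_fun A h \<Longrightarrow> smooth_fun A (\<lambda>p. - h p)"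
  using smooth_fun_mult[OF smooth_fun_const[of "-1"]] by simp

lemma smooth_fun_diff:
  assumes "smooth_fun A h" "smooth_fun A k" shows "smooth_fun A (\<lambda>p. h p - k p)"
  using smooth_fun_add[OF assms(1) smooth_fun_minus[OF assms(2)]] by simp

lemma smooth_fun_power: "smooth_fun A h \<Longrightarrow> smooth_fun A (\<lambda>p. h p ^ n)"
  by (induction n) (simp_all add: smooth_fun_const smooth_fun_mult)

lemma smooth_fun_sum:
  assumes "\<And>i. i \<in> I \<Longrightarrow> smooth_fun A (h i)" shows "smooth_fun A (\<lambda>p. \<Sum>i\<in>I. h i p)"
  using assms
  by (induction I rule: infinite_finite_induct) (simp_all add: smooth_fun_const smooth_fun_add)

lemma smooth_fun_continuous:
  assumes "smooth_fun A h" shows "continuous_on UNIV h"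
proof -
  have "isCont h p" for p
  proof -
    obtain U \<phi> where U: "(U, \<phi>) \<in> A" "p \<in> U" by (rule obtain_chart)
    have "continuous_on U (\<lambda>q. (h \<circ> inv_into U \<phi>) (\<phi> q))"
      by (rule continuous_on_compose2[OF smooth_on_imp_continuous_on[OF smooth_funD[OF assms U(1)]] 
            chart_continuous[OF U(1)]]) simp
    then have "continuous_on U h"
      by (rule continuous_on_eq) (use U in simp)
    then show ?thesis
      using U chart_homeomorphism(1) continuous_on_eq_continuous_at by blast
  qed
  then show ?thesis by (simp add: continuous_at_imp_continuous_on)
qed

lemma smooth_fun_inverse_local:
  assumes h: "smooth_fun A h" and U: "(U, \<phi>) \<in> A" and W: "open W" "W \<subseteq> U" "\<And>q. q \<in> W \<Longrightarrow> h q \<noteq> 0"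
  shows "smooth_on (\<phi> ` W) (\<lambda>x. inverse (h (inv_into U \<phi> x)))"
proof (rule smooth_on_compose[OF _ _ _ _ smooth_on_inverse])
  show "open (\<phi> ` W)" by (rule chart_open_image[OF U W(1,2)])
  show "smooth_on (\<phi> ` W) (\<lambda>x. h (inv_into U \<phi> x))"
    by (rule smooth_on_subset[OF smooth_fun_chartD[OF h U]]) (use W in blast)
  show "(\<lambda>x. h (inv_into U \<phi> x)) ` \<phi> ` W \<subseteq> - {0}"
    using W chart_inverse[OF U] by auto
qed auto

lemma smooth_fun_inverse:
  assumes "smooth_fun A h" "\<And>p. h p \<noteq> 0"
  shows "smooth_fun A (\<lambda>p. inverse (h p))"
  using smooth_fun_inverse_local[OF assms(1)] chart_homeomorphism(1) assms(2)
  by (auto intro!: smooth_fun_chartI)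

lemma smooth_fun_divide:
  assumes "smooth_fun A h" "smooth_fun A k" "\<And>p. k p \<noteq> 0"
  shows "smooth_fun A (\<lambda>p. h p / k p)"
  using smooth_fun_mult[OF assms(1) smooth_fun_inverse[OF assms(2,3)]] by (simp add: divide_inverse)

text \<open>Near \<open>p\<close> one may divide by \<open>b\<close>. This serves functions that are
  known to be smooth only after multiplication by a cutoff, such as the derivatives along a
  lift.\<close>

lemma smooth_fun_localI:
  assumes "\<And>p. \<exists>b. smooth_fun A b \<and> b p \<noteq> 0 \<and> smooth_fun A (\<lambda>q. b q * h q)"
  shows "smooth_fun A h"
proof (rule smooth_funI)
  fix p
  obtain b where b: "smooth_fun A b" "b p \<noteq> 0" "smooth_fun A (\<lambda>q. b q * h q)"
    using assms by blast
  obtain U \<phi> where U: "(U, \<phi>) \<in> A" "p \<in> U" by (rule obtain_chart)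
  define W where "W = U \<inter> {q. b q \<noteq> 0}"
  have W: "open W" "p \<in> W" "W \<subseteq> U"
    using U b chart_homeomorphism(1) smooth_fun_continuous[OF b(1)]
    by (auto simp: W_def intro!: open_Int open_Collect_neq)
  have "smooth_on (\<phi> ` W) (\<lambda>x. b (inv_into U \<phi> x) * h (inv_into U \<phi> x))"
    by (rule smooth_on_subset[OF smooth_fun_chartD[OF b(3) U(1)]]) (use W in blast)
  then have "smooth_on (\<phi> ` W) (\<lambda>x. b (inv_into U \<phi> x) * h (inv_into U \<phi> x) * inverse (b (inv_into U \<phi> x)))"
    by (rule smooth_on_mult[OF chart_open_image[OF U(1) W(1,3)] _
          smooth_fun_inverse_local[OF b(1) U(1) W(1,3)]]) (simp add: W_def)
  moreover have "h q = b (inv_into U \<phi> (\<phi> q)) * h (inv_into U \<phi> (\<phi> q)) * inverse (b (inv_into U \<phi> (\<phi> q)))" if "q \<in> W" for q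
    using that U(1) by (simp add: W_def)
  ultimately show "\<exists>U \<phi> W k. (U, \<phi>) \<in> A \<and> open W \<and> p \<in> W \<and> W \<subseteq> U \<and> smooth_on (\<phi> ` W) k \<and> (\<forall>q\<in>W. h q = k (\<phi> q))"
    using U W by blast
qed

text \<open>The closed set inside \<open>U\<close> is essential: vanishing merely outside
  \<open>U\<close> would not make an extension by zero smooth across the boundary of
  \<open>U\<close>.\<close>

definition cutoff :: "'a set \<Rightarrow> ('a \<Rightarrow> real) \<Rightarrow> bool" where
  "cutoff U b \<longleftrightarrow> smooth_fun A b \<and> (\<exists>C. closed C \<and> C \<subseteq> U \<and> (\<forall>p. p \<notin> C \<longrightarrow> b p = 0))"

lemma cutoff_smooth: "cutoff U b \<Longrightarrow> smooth_fun A b"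
  by (simp add: cutoff_def)

lemma cutoff_outside: "cutoff U b \<Longrightarrow> p \<notin> U \<Longrightarrow> b p = 0"
  by (auto simp: cutoff_def)

text \<open>\<open>U\<close> and the complement of \<open>C\<close> are open and cover the manifold;
  the function is \<open>k\<close> in the chart on the first and zero on the second.\<close>

lemma smooth_fun_extend_by_zero:
  assumes U: "(U, \<phi>) \<in> A" and C: "closed C" "C \<subseteq> U" "\<And>p. p \<notin> C \<Longrightarrow> h p = 0"
    and k: "smooth_on (\<phi> ` U) k" "\<And>p. p \<in> U \<Longrightarrow> h p = k (\<phi> p)"
  shows "smooth_fun A h"
proof (rule smooth_funI)
  fix p
  show "\<exists>U \<phi> W k. (U, \<phi>) \<in> A \<and> open W \<and> p \<in> W \<and> W \<subseteq> U \<and> smooth_on (\<phi> ` W) k \<and> (\<forall>q\<in>W. h q = k (\<phi> q))"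
  proof (cases "p \<in> U")
    case True
    then show ?thesis using U k chart_homeomorphism(1) by blast
  next
    case False
    obtain V \<psi> where V: "(V, \<psi>) \<in> A" "p \<in> V" by (rule obtain_chart)
    have o: "open (V \<inter> - C)" using V C chart_homeomorphism(1) by auto
    then have "smooth_on (\<psi> ` (V \<inter> - C)) (\<lambda>x. 0)"
      by (intro smooth_on_const chart_open_image[OF V(1)]) auto
    then show ?thesis using V o C False
      by (intro exI[of _ V] exI[of _ \<psi>] exI[of _ "V \<inter> - C"] exI[of _ "\<lambda>x. 0"]) auto
  qed
qed

lemma obtain_cutoff:
  assumes U: "(U, \<phi>) \<in> A" and "p \<in> U"
  obtains b where "cutoff U b" "b p = 1"
proof -
  obtain r where r: "r > 0" "cball (\<phi> p) r \<subseteq> \<phi> ` U"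
    using chart_homeomorphism(2)[OF U] assms open_contains_cball by blast
  obtain \<beta> where \<beta>: "smooth_on UNIV \<beta>" "\<beta> (\<phi> p) = 1" "\<And>x. x \<notin> cball (\<phi> p) r \<Longrightarrow> \<beta> x = (0::real)"
    using euclidean_bump[OF r(1)] by blast
  define C where "C = inv_into U \<phi> ` cball (\<phi> p) r"
  define b where "b = (\<lambda>q. if q \<in> U then \<beta> (\<phi> q) else 0)"
  \<comment> \<open>The preimage of the ball is compact, hence closed in the whole Hausdorff space
    and not only relatively to \<open>U\<close>.\<close>
  have "continuous_on (cball (\<phi> p) r) (inv_into U \<phi>)"
    using homeomorphism_cont2[OF chart_homeomorphism(3)[OF U]] r continuous_on_subset by blast
  then have "compact C"
    unfolding C_def by (rule compact_continuous_image) auto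
  then have C: "closed C" by (rule compact_imp_closed)
  have CU: "C \<subseteq> U"
    using r inv_into_into[of _ \<phi> U] by (auto simp: C_def)
  have out: "b q = 0" if "q \<notin> C" for q
  proof (cases "q \<in> U")
    case True
    then have "\<phi> q \<notin> cball (\<phi> p) r"
      using that chart_inverse[OF U True] unfolding C_def by (metis imageI)
    then show ?thesis using \<beta>(3) by (simp add: b_def)
  qed (simp add: b_def)
  have "smooth_fun A b"
    by (rule smooth_fun_extend_by_zero[OF U C CU out smooth_on_subset[OF \<beta>(1)]]) (auto simp: b_def)
  then have "cutoff U b" using C CU out by (auto simp: cutoff_def)
  moreover have "b p = 1" using assms \<beta> by (simp add: b_def)
  ultimately show ?thesis by (rule that)
qed

lemma smooth_fun_cutoff_mult:
  assumes U: "(U, \<phi>) \<in> A" and b: "cutoff U b"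
    and k: "smooth_on (\<phi> ` U) k" "\<And>p. p \<in> U \<Longrightarrow> h p = k (\<phi> p)"
  shows "smooth_fun A (\<lambda>p. b p * h p)"
proof -
  obtain C where C: "closed C" "C \<subseteq> U" "\<And>p. p \<notin> C \<Longrightarrow> b p = 0"
    using b by (auto simp: cutoff_def)
  have "smooth_on (\<phi> ` U) (\<lambda>x. b (inv_into U \<phi> x) * k x)"
    by (intro smooth_on_mult smooth_fun_chartD[OF cutoff_smooth[OF b] U] k chart_homeomorphism(2)[OF U])
  then show ?thesis
    by (rule smooth_fun_extend_by_zero[OF U C(1,2), rotated]) (use C k U in auto)
qed

section \<open>Tangent vectors in coordinates and as derivations\<close>

lemma tangent_space_eq:
  "tangent_space A p = {coord_vec A U \<phi> p u | U \<phi> u. (U, \<phi>) \<in> A \<and> p \<in> U}"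
  by (simp add: tangent_space_def coord_vec_def)

lemma chart_has_derivative:
  assumes "smooth_fun A h" "(U, \<phi>) \<in> A" "p \<in> U"
  shows "((h \<circ> inv_into U \<phi>) has_derivative (\<lambda>u. coord_vec A U \<phi> p u h)) (at (\<phi> p))"
  using smooth_on_has_derivative[OF smooth_funD[OF assms(1,2)], of "\<phi> p"] assms
  by (simp add: coord_vec_def)

lemma coord_vec_eqI:
  assumes "smooth_fun A h" "(U, \<phi>) \<in> A" "p \<in> U"
    and "(k has_derivative k') (at (\<phi> p))" and "open T" "\<phi> p \<in> T" "\<And>x. x \<in> T \<Longrightarrow> x \<in> \<phi> ` U \<Longrightarrow> k x = h (inv_into U \<phi> x)"
  shows "coord_vec A U \<phi> p u h = k' u"
proof -
  have "((h \<circ> inv_into U \<phi>) has_derivative k') (at (\<phi> p))"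
    by (rule has_derivative_transform_within_open[OF assms(4), of "T \<inter> \<phi> ` U"])
      (use assms chart_homeomorphism(2) in auto)
  then have "k' = (\<lambda>u. coord_vec A U \<phi> p u h)"
    using has_derivative_unique chart_has_derivative[OF assms(1-3)] by blast
  then show ?thesis by simp
qed

lemma coord_vec_nonsmooth [simp]: "\<not> smooth_fun A h \<Longrightarrow> coord_vec A U \<phi> p u h = 0"
  by (simp add: coord_vec_def)

text \<open>The chart may vary from one tangent vector to the next. The chain rule, with the
  Jacobian of the transition map, brings all vectors at \<open>p\<close> into one chart, and only
  then is closure under addition visible.\<close>

lemma coord_vec_change_chart:
  assumes U: "(U, \<phi>) \<in> A" "p \<in> U" and V: "(V, \<psi>) \<in> A" "p \<in> V"
  shows "coord_vec A V \<psi> p u = coord_vec A U \<phi> p (frechet_derivative (\<phi> \<circ> inv_into V \<psi>) (at (\<psi> p)) u)"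
proof
  fix h
  show "coord_vec A V \<psi> p u h = coord_vec A U \<phi> p (frechet_derivative (\<phi> \<circ> inv_into V \<psi>) (at (\<psi> p)) u) h"
  proof (cases "smooth_fun A h")
    case True
    have o: "open (\<psi> ` (V \<inter> U))"
      using U V chart_homeomorphism(1) by (intro chart_open_image) auto
    have d: "((\<phi> \<circ> inv_into V \<psi>) has_derivative frechet_derivative (\<phi> \<circ> inv_into V \<psi>) (at (\<psi> p))) (at (\<psi> p))"
      by (rule smooth_on_has_derivative[OF chart_transition[OF V(1) U(1)]]) (use U V in auto)
    have "((h \<circ> inv_into U \<phi>) has_derivative (\<lambda>u. coord_vec A U \<phi> p u h))
        (at ((\<phi> \<circ> inv_into V \<psi>) (\<psi> p)))"
      using chart_has_derivative[OF True U] V by simp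
    from has_derivative_compose[OF d this]
    show ?thesis
      by (rule coord_vec_eqI[OF True V _ o]) (use U V in \<open>auto dest!: inj_onD[OF chart_inj[OF V(1)]]\<close>)
  qed simp
qed

lemma tangent_space_chart:
  assumes U: "(U, \<phi>) \<in> A" "p \<in> U"
  shows "tangent_space A p = range (coord_vec A U \<phi> p)"
proof
  show "tangent_space A p \<subseteq> range (coord_vec A U \<phi> p)"
    unfolding tangent_space_eq using coord_vec_change_chart[OF U] by auto
  show "range (coord_vec A U \<phi> p) \<subseteq> tangent_space A p"
    unfolding tangent_space_eq using U by auto
qed

lemma coord_vec_linear:
  assumes U: "(U, \<phi>) \<in> A" "p \<in> U"
  shows "coord_vec A U \<phi> p (u + v) h = coord_vec A U \<phi> p u h + coord_vec A U \<phi> p v h"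
    and "coord_vec A U \<phi> p (c *\<^sub>R u) h = c * coord_vec A U \<phi> p u h"
    and "coord_vec A U \<phi> p (\<Sum>i\<in>I. f i) h = (\<Sum>i\<in>I. coord_vec A U \<phi> p (f i) h)"
proof -
  have "linear (\<lambda>u. coord_vec A U \<phi> p u h)"
  proof (cases "smooth_fun A h")
    case True
    then show ?thesis
      using has_derivative_linear[OF chart_has_derivative[OF True U]] by simp
  next
    case False
    then show ?thesis by (simp add: module_hom_zero)
  qed
  then interpret l: linear "\<lambda>u. coord_vec A U \<phi> p u h" .
  show "coord_vec A U \<phi> p (u + v) h = coord_vec A U \<phi> p u h + coord_vec A U \<phi> p v h"
    by (rule l.add)
  show "coord_vec A U \<phi> p (c *\<^sub>R u) h = c * coord_vec A U \<phi> p u h"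
    using l.scale by simp
  show "coord_vec A U \<phi> p (\<Sum>i\<in>I. f i) h = (\<Sum>i\<in>I. coord_vec A U \<phi> p (f i) h)"
    by (rule l.sum)
qed

lemma tangent_add:
  assumes "v \<in> tangent_space A p" "w \<in> tangent_space A p"
  shows "(\<lambda>h. v h + w h) \<in> tangent_space A p"
proof -
  obtain U \<phi> where U: "(U, \<phi>) \<in> A" "p \<in> U" by (rule obtain_chart)
  obtain u u' where "v = coord_vec A U \<phi> p u" "w = coord_vec A U \<phi> p u'"
    using assms unfolding tangent_space_chart[OF U] by blast
  then have "(\<lambda>h. v h + w h) = coord_vec A U \<phi> p (u + u')"
    using coord_vec_linear[OF U] by auto
  then show ?thesis unfolding tangent_space_chart[OF U] by blast
qed

lemma tangent_scale:
  assumes "v \<in> tangent_space A p"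
  shows "(\<lambda>h. c * v h) \<in> tangent_space A p"
proof -
  obtain U \<phi> where U: "(U, \<phi>) \<in> A" "p \<in> U" by (rule obtain_chart)
  obtain u where "v = coord_vec A U \<phi> p u"
    using assms unfolding tangent_space_chart[OF U] by blast
  then have "(\<lambda>h. c * v h) = coord_vec A U \<phi> p (c *\<^sub>R u)"
    using coord_vec_linear[OF U] by auto
  then show ?thesis unfolding tangent_space_chart[OF U] by blast
qed

lemma tangent_zero: "(\<lambda>h. 0) \<in> tangent_space A p"
proof -
  obtain U \<phi> where "(U, \<phi>) \<in> A" "p \<in> U" by (rule obtain_chart)
  then have "coord_vec A U \<phi> p 0 \<in> tangent_space A p"
    using tangent_space_chart by blast
  from tangent_scale[OF this, of 0] show ?thesis by simp
qed

lemma tangent_diff: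
  assumes "v \<in> tangent_space A p" "w \<in> tangent_space A p"
  shows "(\<lambda>h. v h - w h) \<in> tangent_space A p"
  using tangent_add[OF assms(1) tangent_scale[OF assms(2), of "-1"]] by simp

lemma tangent_nonsmooth:
  "v \<in> tangent_space A p \<Longrightarrow> \<not> smooth_fun A h \<Longrightarrow> v h = 0"
  unfolding tangent_space_eq by auto

lemma tangent_derivation:
  assumes "v \<in> tangent_space A p" "smooth_fun A h" "smooth_fun A k"
  shows "v (\<lambda>q. h q + k q) = v h + v k"
    and "v (\<lambda>q. h q * k q) = h p * v k + k p * v h"
proof -
  obtain U \<phi> where U: "(U, \<phi>) \<in> A" "p \<in> U" by (rule obtain_chart)
  obtain u where v: "v = coord_vec A U \<phi> p u"
    using assms unfolding tangent_space_chart[OF U] by blast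
  note dh = chart_has_derivative[OF assms(2) U] and dk = chart_has_derivative[OF assms(3) U]
  show "v (\<lambda>q. h q + k q) = v h + v k"
    unfolding v
    by (rule coord_vec_eqI[OF smooth_fun_add[OF assms(2,3)] U has_derivative_add[OF dh dk] open_UNIV]) auto
  have "v (\<lambda>q. h q * k q) = (h \<circ> inv_into U \<phi>) (\<phi> p) * v k + v h * (k \<circ> inv_into U \<phi>) (\<phi> p)"
    unfolding v
    by (rule coord_vec_eqI[OF smooth_fun_mult[OF assms(2,3)] U has_derivative_mult[OF dh dk] open_UNIV]) auto
  then show "v (\<lambda>q. h q * k q) = h p * v k + k p * v h"
    using U by simp
qed

lemma tangent_const:
  assumes "v \<in> tangent_space A p" shows "v (\<lambda>q. c) = 0"
proof -
  obtain U \<phi> where U: "(U, \<phi>) \<in> A" "p \<in> U" by (rule obtain_chart)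
  obtain u where v: "v = coord_vec A U \<phi> p u"
    using assms unfolding tangent_space_chart[OF U] by blast
  show ?thesis unfolding v
    by (rule coord_vec_eqI[OF smooth_fun_const U has_derivative_const open_UNIV]) auto
qed

lemma tangent_cmult:
  assumes "v \<in> tangent_space A p" "smooth_fun A h" shows "v (\<lambda>q. c * h q) = c * v h"
  using tangent_derivation(2)[OF assms(1) smooth_fun_const assms(2)] tangent_const[OF assms(1)] by simp

lemma tangent_minus:
  assumes "v \<in> tangent_space A p" "smooth_fun A h" shows "v (\<lambda>q. - h q) = - v h"
  using tangent_cmult[OF assms, of "-1"] by simp

lemma tangent_inverse:
  assumes "v \<in> tangent_space A p" "smooth_fun A h" "\<And>q. h q \<noteq> 0"
  shows "v (\<lambda>q. inverse (h q)) = - v h / (h p)\<^sup>2"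
proof -
  have "v (\<lambda>q. h q * inverse (h q)) = 0"
    using tangent_const[OF assms(1), of 1] assms(3) by simp
  then have "h p * v (\<lambda>q. inverse (h q)) + inverse (h p) * v h = 0"
    using tangent_derivation(2)[OF assms(1,2) smooth_fun_inverse[OF assms(2,3)]] by simp
  then show ?thesis
    using assms(3)[of p] by (simp add: field_simps power2_eq_square)
qed

lemma smooth_fun_cutoff_coordinate:
  assumes U: "(U, \<phi>) \<in> A" and b: "cutoff U b"
  shows "smooth_fun A (\<lambda>p. b p * (\<phi> p \<bullet> i))"
  by (rule smooth_fun_cutoff_mult[OF U b smooth_on_bounded_linear[OF bounded_linear_inner_left]])
    (use chart_homeomorphism(2)[OF U] in auto)

text \<open>A cutoff is needed because coordinate functions are only local: by the product rule this is
  \<open>b\<^sup>2\<close> times the \<open>i\<close>-th coordinate of \<open>X\<close>, and it is smooth globally.\<close>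

definition coordinate_component :: "('a \<Rightarrow> real) \<Rightarrow> ('a \<Rightarrow> 'e) \<Rightarrow> 'e \<Rightarrow> 'a vfield \<Rightarrow> 'a \<Rightarrow> real" where
  "coordinate_component b \<phi> i X p = b p * X p (\<lambda>q. b q * (\<phi> q \<bullet> i)) - b p * (\<phi> p \<bullet> i) * X p b"

lemma coordinate_component:
  assumes U: "(U, \<phi>) \<in> A" "p \<in> U" and b: "cutoff U b" and X: "X p = coord_vec A U \<phi> p u"
  shows "coordinate_component b \<phi> i X p = (b p)\<^sup>2 * (u \<bullet> i)"
proof -
  have "X p (\<lambda>q. b q * (\<phi> q \<bullet> i)) = b p * (u \<bullet> i) + X p b * (\<phi> p \<bullet> i)"
  proof -
    have d: "((\<lambda>x. (b \<circ> inv_into U \<phi>) x * (x \<bullet> i)) has_derivative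
       (\<lambda>u. (b \<circ> inv_into U \<phi>) (\<phi> p) * (u \<bullet> i) + coord_vec A U \<phi> p u b * (\<phi> p \<bullet> i))) (at (\<phi> p))"
      by (rule has_derivative_mult[OF chart_has_derivative[OF cutoff_smooth[OF b] U]])
        (intro derivative_intros)
    have "coord_vec A U \<phi> p u (\<lambda>q. b q * (\<phi> q \<bullet> i)) =
        (b \<circ> inv_into U \<phi>) (\<phi> p) * (u \<bullet> i) + coord_vec A U \<phi> p u b * (\<phi> p \<bullet> i)"
      by (rule coord_vec_eqI[OF smooth_fun_cutoff_coordinate[OF U(1) b] U d open_UNIV]) (use U in auto)
    then show ?thesis using U X by simp
  qed
  then show ?thesis by (simp add: coordinate_component_def algebra_simps power2_eq_square)
qed

text \<open>Applying a vector to a cutoff and to the cut-off coordinate functions recovers its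
  coordinates, so globally smooth functions separate tangent vectors.\<close>

lemma coord_vec_inject:
  assumes U: "(U, \<phi>) \<in> A" "p \<in> U"
  shows "coord_vec A U \<phi> p u = coord_vec A U \<phi> p v \<longleftrightarrow> u = v"
proof
  assume eq: "coord_vec A U \<phi> p u = coord_vec A U \<phi> p v"
  obtain b where b: "cutoff U b" "b p = 1" by (rule obtain_cutoff[OF U])
  have "u \<bullet> i = v \<bullet> i" for i
    using coordinate_component[OF U b(1), of "\<lambda>_. coord_vec A U \<phi> p u" u i]
      coordinate_component[OF U b(1), of "\<lambda>_. coord_vec A U \<phi> p u" v i] eq b(2) by simp
  then show "u = v" using euclidean_eq_iff[of u v] by blast
qed simp

section \<open>Vector fields, frames and linearity over smooth functions\<close>

abbreviation \<V> :: "'a vfield set" where "\<V> \<equiv> vector_fields A"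

lemma vector_field_tangent: "X \<in> \<V> \<Longrightarrow> X p \<in> tangent_space A p"
  by (simp add: vector_fields_def)

lemma vector_field_smooth: "X \<in> \<V> \<Longrightarrow> smooth_fun A h \<Longrightarrow> smooth_fun A (\<lambda>p. X p h)"
  by (simp add: vector_fields_def)

lemma vector_fieldI:
  "(\<And>p. X p \<in> tangent_space A p) \<Longrightarrow> (\<And>h. smooth_fun A h \<Longrightarrow> smooth_fun A (\<lambda>p. X p h)) \<Longrightarrow> X \<in> \<V>"
  by (simp add: vector_fields_def)

lemma vadd_in:
  assumes "X \<in> \<V>" "Y \<in> \<V>" shows "vadd X Y \<in> \<V>"
proof (rule vector_fieldI)
  show "vadd X Y p \<in> tangent_space A p" for p
    using tangent_add[OF vector_field_tangent[OF assms(1)] vector_field_tangent[OF assms(2)]]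
    by (simp add: vadd_def)
  show "smooth_fun A (\<lambda>p. vadd X Y p h)" if "smooth_fun A h" for h
    using smooth_fun_add[OF vector_field_smooth[OF assms(1) that] vector_field_smooth[OF assms(2) that]]
    by simp
qed

lemma vscale_in:
  assumes "smooth_fun A a" "X \<in> \<V>" shows "vscale a X \<in> \<V>"
proof (rule vector_fieldI)
  show "vscale a X p \<in> tangent_space A p" for p
    using tangent_scale[OF vector_field_tangent[OF assms(2)]] by (simp add: vscale_def)
  show "smooth_fun A (\<lambda>p. vscale a X p h)" if "smooth_fun A h" for h
    using smooth_fun_mult[OF assms(1) vector_field_smooth[OF assms(2) that]] by simp
qed

lemma vzero_in: "(\<lambda>p h. 0) \<in> \<V>"
  by (rule vector_fieldI) (simp_all add: tangent_zero smooth_fun_const)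

lemma vsum_in: "(\<And>i. i \<in> I \<Longrightarrow> X i \<in> \<V>) \<Longrightarrow> (\<lambda>p h. \<Sum>i\<in>I. X i p h) \<in> \<V>"
proof (induction I rule: infinite_finite_induct)
  case (insert i I)
  then have "vadd (X i) (\<lambda>p h. \<Sum>i\<in>I. X i p h) \<in> \<V>" by (intro vadd_in) auto
  then show ?case using insert by (simp add: vadd_def)
qed (auto simp: vzero_in)

definition coord_field :: "'a set \<Rightarrow> ('a \<Rightarrow> 'e) \<Rightarrow> ('a \<Rightarrow> real) \<Rightarrow> 'e \<Rightarrow> 'a vfield" where
  "coord_field U \<phi> b u = (\<lambda>p h. b p * coord_vec A U \<phi> p u h)"

lemma coord_field_in:
  assumes U: "(U, \<phi>) \<in> A" and b: "cutoff U b"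
  shows "coord_field U \<phi> b u \<in> \<V>"
proof (rule vector_fieldI)
  fix p
  show "coord_field U \<phi> b u p \<in> tangent_space A p"
  proof (cases "p \<in> U")
    case True
    have "coord_vec A U \<phi> p u \<in> tangent_space A p"
      unfolding tangent_space_chart[OF U True] by blast
    then show ?thesis unfolding coord_field_def by (rule tangent_scale)
  next
    case False
    then show ?thesis using cutoff_outside[OF b] tangent_zero by (simp add: coord_field_def)
  qed
next
  fix h assume h: "smooth_fun A h"
  have "smooth_on (\<phi> ` U) (\<lambda>x. frechet_derivative (h \<circ> inv_into U \<phi>) (at x) u)"
    by (rule smooth_on_derivative[OF smooth_funD[OF h U]])
  then show "smooth_fun A (\<lambda>p. coord_field U \<phi> b u p h)"
    unfolding coord_field_def
    by (rule smooth_fun_cutoff_mult[OF U b]) (simp add: coord_vec_def h)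
qed

lemma tangent_extend:
  assumes "v \<in> tangent_space A p"
  obtains X where "X \<in> \<V>" "X p = v"
proof -
  obtain U \<phi> where U: "(U, \<phi>) \<in> A" "p \<in> U" by (rule obtain_chart)
  obtain u where v: "v = coord_vec A U \<phi> p u"
    using assms unfolding tangent_space_chart[OF U] by blast
  obtain b where b: "cutoff U b" "b p = 1" by (rule obtain_cutoff[OF U])
  show ?thesis
    by (rule that[OF coord_field_in[OF U(1) b(1)]]) (use b v in \<open>simp add: coord_field_def\<close>)
qed

lemma coordinate_component_smooth:
  assumes U: "(U, \<phi>) \<in> A" and b: "cutoff U b" and X: "X \<in> \<V>"
  shows "smooth_fun A (coordinate_component b \<phi> i X)"
  unfolding coordinate_component_def using cutoff_smooth[OF b] smooth_fun_cutoff_coordinate[OF U b]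
  by (simp add: smooth_fun_diff smooth_fun_mult vector_field_smooth[OF X])

text \<open>The cube collects the square of \<open>b\<close> from
  \<open>coordinate_component\<close> and one more factor from \<open>coord_field\<close>. With it
  the expansion is an identity on the whole manifold, as both sides vanish outside
  \<open>U\<close>.\<close>

lemma coordinate_expansion:
  assumes U: "(U, \<phi>) \<in> A" and b: "cutoff U b" and X: "X \<in> \<V>"
  shows "(b p)^3 * X p h = (\<Sum>i\<in>Basis. coordinate_component b \<phi> i X p * coord_field U \<phi> b i p h)"
proof (cases "p \<in> U")
  case True
  obtain u where u: "X p = coord_vec A U \<phi> p u"
    using vector_field_tangent[OF X, of p] unfolding tangent_space_chart[OF U True] by blast
  have "X p h = (\<Sum>i\<in>Basis. (u \<bullet> i) * coord_vec A U \<phi> p i h)"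
    unfolding u by (subst euclidean_representation[symmetric, of u])
      (simp only: coord_vec_linear[OF U True])
  then show ?thesis
    by (simp add: coordinate_component[where X=X, OF U True b u] coord_field_def sum_distrib_left
        power3_eq_cube power2_eq_square mult_ac)
next
  case False
  then show ?thesis using cutoff_outside[OF b] by (simp add: coord_field_def)
qed

text \<open>Since \<open>b p = 1\<close>, multiplying \<open>X\<close> by the cube of
  \<open>b\<close> does not change \<open>L X\<close>; the result is a combination of global
  coordinate fields with smooth coefficients, on which \<open>L\<close> vanishes.\<close>

lemma function_linear_vanishes:
  fixes L :: "'a vfield \<Rightarrow> real"
  assumes U: "(U, \<phi>) \<in> A" and b: "cutoff U b" "b p = 1"
    and add: "\<And>X Y. X \<in> \<V> \<Longrightarrow> Y \<in> \<V> \<Longrightarrow> L (vadd X Y) = L X + L Y"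
    and scale: "\<And>a X. smooth_fun A a \<Longrightarrow> X \<in> \<V> \<Longrightarrow> L (vscale a X) = a p * L X"
    and frame: "\<And>i. i \<in> Basis \<Longrightarrow> L (coord_field U \<phi> b i) = 0"
    and X: "X \<in> \<V>"
  shows "L X = 0"
proof -
  let ?Y = "\<lambda>i. vscale (coordinate_component b \<phi> i X) (coord_field U \<phi> b i)"
  have Y: "?Y i \<in> \<V>" for i
    by (intro vscale_in coordinate_component_smooth[OF U b(1) X] coord_field_in[OF U b(1)])
  have sum: "L (\<lambda>p h. \<Sum>i\<in>I. Z i p h) = (\<Sum>i\<in>I. L (Z i))" if "\<And>i. Z i \<in> \<V>" "finite I" for Z and I :: "'e set"
    using that(2)
  proof (induction I rule: finite_induct)
    case empty
    have "L (vscale (\<lambda>p. 0) X) = 0" using scale[OF smooth_fun_const X, of 0] by simp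
    then show ?case by (simp add: vscale_def)
  next
    case (insert i I)
    then have "L (\<lambda>p h. \<Sum>i\<in>insert i I. Z i p h) = L (vadd (Z i) (\<lambda>p h. \<Sum>i\<in>I. Z i p h))"
      by (simp add: vadd_def)
    also have "\<dots> = L (Z i) + (\<Sum>i\<in>I. L (Z i))"
      using insert that by (simp add: add vsum_in)
    finally show ?case using insert by simp
  qed
  have "L X = L (vscale (\<lambda>p. b p ^ 3) X)"
    using scale[OF smooth_fun_power[OF cutoff_smooth[OF b(1)]] X] b(2) by simp
  also have "vscale (\<lambda>p. b p ^ 3) X = (\<lambda>p h. \<Sum>i\<in>Basis. ?Y i p h)"
    by (intro vfield_eqI) (simp add: coordinate_expansion[OF U b(1) X])
  also have "L \<dots> = (\<Sum>i\<in>Basis. L (?Y i))"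
    by (rule sum[OF Y finite_Basis])
  also have "\<dots> = 0"
    using scale[OF coordinate_component_smooth[OF U b(1) X] coord_field_in[OF U b(1)]] frame
    by (intro sum.neutral) simp
  finally show ?thesis .
qed

lemma obtain_independent_tangents:
  assumes "DIM('e) \<ge> 2"
  obtains v w where "v \<in> tangent_space A p" "w \<in> tangent_space A p"
    "\<And>c d. (\<And>h. c * v h + d * w h = 0) \<Longrightarrow> c = 0 \<and> d = 0"
proof -
  obtain U \<phi> where U: "(U, \<phi>) \<in> A" "p \<in> U" by (rule obtain_chart)
  have "\<not> is_singleton (Basis :: 'e set)" "(Basis :: 'e set) \<noteq> {}"
    using assms by (auto simp: is_singleton_altdef)
  then obtain i j :: 'e where ij: "i \<in> Basis" "j \<in> Basis" "i \<noteq> j"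
    by (metis is_singletonI' )
  show ?thesis
  proof (rule that)
    show "coord_vec A U \<phi> p i \<in> tangent_space A p" "coord_vec A U \<phi> p j \<in> tangent_space A p"
      unfolding tangent_space_chart[OF U] by auto
    fix c d assume eq: "c * coord_vec A U \<phi> p i h + d * coord_vec A U \<phi> p j h = 0" for h
    \<comment> \<open>Zero is written as \<open>0 *\<^sub>R i\<close> so that the linearity rules
      also evaluate the right-hand side.\<close>
    have "coord_vec A U \<phi> p (c *\<^sub>R i + d *\<^sub>R j) = coord_vec A U \<phi> p (0 *\<^sub>R i)"
      using eq by (simp add: fun_eq_iff coord_vec_linear[OF U] del: scaleR_zero_left)
    then have z: "c *\<^sub>R i + d *\<^sub>R j = 0"
      by (simp add: coord_vec_inject[OF U])
    have "c = (c *\<^sub>R i + d *\<^sub>R j) \<bullet> i" "d = (c *\<^sub>R i + d *\<^sub>R j) \<bullet> j"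
      using ij by (auto simp: inner_add_left inner_Basis)
    then show "c = 0 \<and> d = 0" unfolding z by simp
  qed
qed

text \<open>Coordinate vectors extend to global fields, so all coordinate derivatives of
  \<open>h\<close> vanish. Balls in a chart are convex, which makes \<open>h\<close> locally
  constant; connectedness does the rest.\<close>

lemma derivative_zero_imp_constant:
  assumes "connected (UNIV :: 'a set)" and h: "smooth_fun A h"
    and zero: "\<And>X p. X \<in> \<V> \<Longrightarrow> X p h = 0"
  shows "h p = h q"
proof -
  have "h constant_on UNIV"
  proof (rule locally_constant_imp_constant[OF assms(1)])
    fix p :: 'a
    obtain U \<phi> where U: "(U, \<phi>) \<in> A" "p \<in> U" by (rule obtain_chart)
    obtain r where r: "r > 0" "ball (\<phi> p) r \<subseteq> \<phi> ` U"
      using chart_homeomorphism(2)[OF U(1)] U open_contains_ball by blast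
    have "coord_vec A U \<phi> q u h = 0" if "q \<in> U" for q u
    proof -
      have "coord_vec A U \<phi> q u \<in> tangent_space A q"
        unfolding tangent_space_chart[OF U(1) that] by blast
      then show ?thesis using zero by (metis tangent_extend)
    qed
    then have d: "((h \<circ> inv_into U \<phi>) has_derivative (\<lambda>u. 0)) (at x)" if "x \<in> \<phi> ` U" for x
      using that chart_has_derivative[OF h U(1)] by auto
    define W where "W = U \<inter> \<phi> -` ball (\<phi> p) r"
    have "open W"
      unfolding W_def using chart_continuous[OF U(1)] chart_homeomorphism(1)[OF U(1)]
      by (simp add: continuous_on_open_vimage Int_commute)
    moreover have "h q = h p" if "q \<in> W" for q
    proof -
      have "(h \<circ> inv_into U \<phi>) (\<phi> q) = (h \<circ> inv_into U \<phi>) (\<phi> p)"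
      proof (rule has_derivative_zero_unique[of "ball (\<phi> p) r"])
        show "((h \<circ> inv_into U \<phi>) has_derivative (\<lambda>u. 0)) (at x within ball (\<phi> p) r)"
          if "x \<in> ball (\<phi> p) r" for x
          using d[of x] r(2) that by (blast intro: has_derivative_at_withinI)
      qed (use r that in \<open>auto simp: W_def\<close>)
      then show ?thesis using U that by (simp add: W_def)
    qed
    moreover have "p \<in> W" using U r by (simp add: W_def)
    ultimately show "\<exists>T. openin (top_of_set UNIV) T \<and> p \<in> T \<and> (\<forall>q\<in>T. h q = h p)"
      unfolding subtopology_UNIV open_openin[symmetric] by blast
  qed
  then show ?thesis unfolding constant_on_def by auto
qed

end

section \<open>Koszul formula and tensoriality of the curvature\<close>

text \<open>The warped metric is used through this locale, hence only through bilinearity, symmetry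
  and its connection. Nondegeneracy and smoothness are added for the factors in
  \<open>pseudo_riemannian_levi_civita\<close>.\<close>

locale levi_civita_manifold = smooth_manifold A
  for A :: "('a::{t2_space,second_countable_topology}, 'e::euclidean_space) atlas" +
  fixes g :: "'a metric_tensor" and D :: "'a connection"
  assumes metric_add: "\<And>p u v w. \<lbrakk>u \<in> tangent_space A p; v \<in> tangent_space A p; w \<in> tangent_space A p\<rbrakk>
      \<Longrightarrow> g p (\<lambda>h. u h + v h) w = g p u w + g p v w"
    and metric_scale: "\<And>p c u w. \<lbrakk>u \<in> tangent_space A p; w \<in> tangent_space A p\<rbrakk>
      \<Longrightarrow> g p (\<lambda>h. c * u h) w = c * g p u w"
    and metric_sym: "\<And>p u w. \<lbrakk>u \<in> tangent_space A p; w \<in> tangent_space A p\<rbrakk> \<Longrightarrow> g p u w = g p w u"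
    and levi_civita: "levi_civita A g D"
begin

lemma metric_zero: "w \<in> tangent_space A p \<Longrightarrow> g p (\<lambda>h. 0) w = 0"
  using metric_scale[OF tangent_zero, of w p 0] by simp

lemma metric_diff:
  assumes "u \<in> tangent_space A p" "v \<in> tangent_space A p" "w \<in> tangent_space A p"
  shows "g p (\<lambda>h. u h - v h) w = g p u w - g p v w"
  using metric_add[OF assms(1) tangent_scale[OF assms(2), of "-1"] assms(3)]
    metric_scale[OF assms(2,3), of "-1"] by simp

lemma metric_vadd:
  assumes "X \<in> \<V>" "Y \<in> \<V>" "w \<in> tangent_space A p"
  shows "g p (vadd X Y p) w = g p (X p) w + g p (Y p) w"
    and "g p w (vadd X Y p) = g p w (X p) + g p w (Y p)"
proof -
  note t = vector_field_tangent[OF assms(1), of p] vector_field_tangent[OF assms(2), of p]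
  show eq: "g p (vadd X Y p) w = g p (X p) w + g p (Y p) w"
    using metric_add[OF t assms(3)] by (simp add: vadd_def)
  show "g p w (vadd X Y p) = g p w (X p) + g p w (Y p)"
    using eq metric_sym[OF _ assms(3)] t vector_field_tangent[OF vadd_in[OF assms(1,2)], of p] by simp
qed

lemma metric_vscale:
  assumes "X \<in> \<V>" "smooth_fun A a" "w \<in> tangent_space A p"
  shows "g p (vscale a X p) w = a p * g p (X p) w"
    and "g p w (vscale a X p) = a p * g p w (X p)"
proof -
  note t = vector_field_tangent[OF assms(1), of p]
  show eq: "g p (vscale a X p) w = a p * g p (X p) w"
    using metric_scale[OF t assms(3)] by (simp add: vscale_def)
  show "g p w (vscale a X p) = a p * g p w (X p)"
    using eq metric_sym[OF _ assms(3)] t vector_field_tangent[OF vscale_in[OF assms(2,1)], of p] by simp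
qed

lemma affine: "affine_connection A D"
  using levi_civita by (simp add: levi_civita_def)

lemma D_in: "X \<in> \<V> \<Longrightarrow> Y \<in> \<V> \<Longrightarrow> D X Y \<in> \<V>"
  using affine unfolding affine_connection_def by simp

lemma D_vadd_left: "X \<in> \<V> \<Longrightarrow> Y \<in> \<V> \<Longrightarrow> Z \<in> \<V> \<Longrightarrow> D (vadd X Y) Z = vadd (D X Z) (D Y Z)"
  using affine unfolding affine_connection_def vadd_def by - (intro ext, simp)

lemma D_vscale_left: "X \<in> \<V> \<Longrightarrow> Y \<in> \<V> \<Longrightarrow> smooth_fun A a \<Longrightarrow> D (vscale a X) Y = vscale a (D X Y)"
  using affine unfolding affine_connection_def vscale_def by - (intro ext, simp)

lemma D_vadd_right: "X \<in> \<V> \<Longrightarrow> Y \<in> \<V> \<Longrightarrow> Z \<in> \<V> \<Longrightarrow> D X (vadd Y Z) = vadd (D X Y) (D X Z)"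
  using affine unfolding affine_connection_def vadd_def by - (intro ext, simp)

lemma D_vscale_right:
  "X \<in> \<V> \<Longrightarrow> Y \<in> \<V> \<Longrightarrow> smooth_fun A a \<Longrightarrow>
    D X (vscale a Y) = vadd (vscale (\<lambda>p. X p a) Y) (vscale a (D X Y))"
  using affine unfolding affine_connection_def vscale_def vadd_def by - (intro ext, simp)

lemma torsion_free: "X \<in> \<V> \<Longrightarrow> Y \<in> \<V> \<Longrightarrow> D X Y p h - D Y X p h = lie_bracket A X Y p h"
  using levi_civita unfolding levi_civita_def by simp

lemma metric_compatible:
  "X \<in> \<V> \<Longrightarrow> Y \<in> \<V> \<Longrightarrow> Z \<in> \<V> \<Longrightarrow>
    X p (\<lambda>q. g q (Y q) (Z q)) = g p (D X Y p) (Z p) + g p (Y p) (D X Z p)"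
  using levi_civita unfolding levi_civita_def by simp

text \<open>Vanishing torsion makes the bracket a vector field without any appeal to the symmetry of
  second derivatives.\<close>

lemma bracket_eq:
  "X \<in> \<V> \<Longrightarrow> Y \<in> \<V> \<Longrightarrow> lie_bracket A X Y = (\<lambda>p h. D X Y p h - D Y X p h)"
  by (intro ext) (simp add: torsion_free)

lemma bracket_in:
  assumes "X \<in> \<V>" "Y \<in> \<V>" shows "lie_bracket A X Y \<in> \<V>"
proof -
  have "vadd (D X Y) (vscale (\<lambda>_. - 1) (D Y X)) \<in> \<V>"
    by (intro vadd_in vscale_in D_in smooth_fun_const assms)
  then show ?thesis by (simp add: bracket_eq[OF assms] vadd_def vscale_def)
qed

lemma bracket_vscale:
  assumes X: "X \<in> \<V>" and Y: "Y \<in> \<V>" and a: "smooth_fun A a"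
  shows "lie_bracket A (vscale a X) Y = vadd (vscale a (lie_bracket A X Y)) (vscale (\<lambda>p. - Y p a) X)"
  by (intro vfield_eqI)
    (simp add: bracket_eq X Y a vscale_in D_vscale_left D_vscale_right algebra_simps)

lemma bracket_vadd:
  assumes "X \<in> \<V>" "Y \<in> \<V>" "Z \<in> \<V>"
  shows "lie_bracket A (vadd X Y) Z = vadd (lie_bracket A X Z) (lie_bracket A Y Z)"
  by (intro vfield_eqI) (simp add: bracket_eq assms vadd_in D_vadd_left D_vadd_right)

lemma bracket_antisym:
  assumes "X \<in> \<V>" "Y \<in> \<V>"
  shows "lie_bracket A X Y = vscale (\<lambda>_. - 1) (lie_bracket A Y X)"
  by (intro vfield_eqI) (simp add: bracket_eq assms)

text \<open>Compatibility expands the three derivatives and vanishing torsion the three brackets;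
  what remains are pairings of covariant derivatives, which cancel by symmetry of the
  metric.\<close>

lemma koszul:
  assumes X: "X \<in> \<V>" and Y: "Y \<in> \<V>" and Z: "Z \<in> \<V>"
  shows "2 * g p (D X Y p) (Z p) =
    X p (\<lambda>q. g q (Y q) (Z q)) + Y p (\<lambda>q. g q (X q) (Z q)) - Z p (\<lambda>q. g q (X q) (Y q))
    + g p (lie_bracket A X Y p) (Z p) - g p (lie_bracket A X Z p) (Y p) - g p (lie_bracket A Y Z p) (X p)"
proof -
  note t = vector_field_tangent[where p=p]
  have sym: "g p (V p) (W p) = g p (W p) (V p)" if "V \<in> \<V>" "W \<in> \<V>" for V W
    by (intro metric_sym t that)
  have br: "g p (lie_bracket A V W p) (U p) = g p (D V W p) (U p) - g p (D W V p) (U p)"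
    if "V \<in> \<V>" "W \<in> \<V>" "U \<in> \<V>" for U V W
    unfolding bracket_eq[OF that(1,2)] by (intro metric_diff t D_in that)
  show ?thesis
    unfolding metric_compatible[OF X Y Z] metric_compatible[OF Y X Z] metric_compatible[OF Z X Y]
      br[OF X Y Z] br[OF X Z Y] br[OF Y Z X]
    using sym[OF Y D_in[OF X Z]] sym[OF X D_in[OF Y Z]] sym[OF X D_in[OF Z Y]] by simp
qed

section \<open>Linearity of the curvature over smooth functions\<close>

lemma curvature_in:
  assumes "X \<in> \<V>" "Y \<in> \<V>" "Z \<in> \<V>"
  shows "curvature_op A D X Y Z \<in> \<V>"
proof -
  have "vadd (vadd (D Y (D X Z)) (vscale (\<lambda>_. - 1) (D X (D Y Z)))) (D (lie_bracket A X Y) Z) \<in> \<V>"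
    by (intro vadd_in vscale_in D_in bracket_in smooth_fun_const assms)
  then show ?thesis by (simp add: curvature_op_def vadd_def vscale_def)
qed

lemma curvature_antisym:
  assumes "X \<in> \<V>" "Y \<in> \<V>" "Z \<in> \<V>"
  shows "curvature_op A D X Y Z p h = - curvature_op A D Y X Z p h"
  unfolding curvature_op_def bracket_antisym[OF assms(1,2)]
  by (simp add: D_vscale_left bracket_in assms smooth_fun_const)

lemma curvature_vadd_1:
  assumes "X \<in> \<V>" "X' \<in> \<V>" "Y \<in> \<V>" "Z \<in> \<V>"
  shows "curvature_op A D (vadd X X') Y Z p h = curvature_op A D X Y Z p h + curvature_op A D X' Y Z p h"
  by (simp add: curvature_op_def D_vadd_left D_vadd_right bracket_vadd bracket_in D_in assms)

lemma curvature_vscale_1: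
  assumes "X \<in> \<V>" "smooth_fun A a" "Y \<in> \<V>" "Z \<in> \<V>"
  shows "curvature_op A D (vscale a X) Y Z p h = a p * curvature_op A D X Y Z p h"
  by (simp add: curvature_op_def D_vadd_left D_vscale_left D_vscale_right bracket_vscale bracket_in D_in
      vscale_in smooth_fun_minus vector_field_smooth assms algebra_simps)

lemma curvature_vadd_3:
  assumes "X \<in> \<V>" "Y \<in> \<V>" "Z \<in> \<V>" "Z' \<in> \<V>"
  shows "curvature_op A D X Y (vadd Z Z') p h = curvature_op A D X Y Z p h + curvature_op A D X Y Z' p h"
  by (simp add: curvature_op_def D_vadd_right bracket_in D_in assms)

lemma curvature_vscale_3:
  assumes X: "X \<in> \<V>" and Y: "Y \<in> \<V>" and Z: "Z \<in> \<V>" and a: "smooth_fun A a"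
  shows "curvature_op A D X Y (vscale a Z) p h = a p * curvature_op A D X Y Z p h"
proof -
  \<comment> \<open>The second derivatives of \<open>a\<close> left by the two iterated covariant
    derivatives differ by exactly the term that differentiation along the bracket
    contributes.\<close>
  have "X p (\<lambda>q. Y q a) = lie_bracket A X Y p a + Y p (\<lambda>q. X q a)"
    using a by (simp add: lie_bracket_def)
  then show ?thesis
    by (simp add: curvature_op_def D_vadd_right D_vscale_right bracket_in D_in
        vscale_in vector_field_smooth assms algebra_simps)
qed

text \<open>The deviation from constant curvature \<open>k\<close>. Taking \<open>k\<close> as a
  number allows its value at a point to be frozen there, so that linearity over smooth functions can
  be used at that point even when \<open>k\<close> varies.\<close>

definition curvature_defect :: "real \<Rightarrow> 'a vfield \<Rightarrow> 'a vfield \<Rightarrow> 'a vfield \<Rightarrow> 'a vfield" where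
  "curvature_defect k X Y Z p h =
    curvature_op A D X Y Z p h - k * (g p (X p) (Z p) * Y p h - g p (Y p) (Z p) * X p h)"

lemma curvature_defect_antisym:
  assumes "X \<in> \<V>" "Y \<in> \<V>" "Z \<in> \<V>"
  shows "curvature_defect k X Y Z p h = - curvature_defect k Y X Z p h"
  using curvature_antisym[OF assms] by (simp add: curvature_defect_def algebra_simps)

lemma curvature_defect_1:
  assumes "X \<in> \<V>" "Y \<in> \<V>" "Z \<in> \<V>"
  shows "X' \<in> \<V> \<Longrightarrow> curvature_defect k (vadd X X') Y Z p h = curvature_defect k X Y Z p h + curvature_defect k X' Y Z p h"
    and "smooth_fun A a \<Longrightarrow> curvature_defect k (vscale a X) Y Z p h = a p * curvature_defect k X Y Z p h"
  using assms
  by (simp_all add: curvature_defect_def curvature_vadd_1 curvature_vscale_1 metric_vadd metric_vscale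
      vector_field_tangent algebra_simps)

lemma curvature_defect_2:
  assumes "X \<in> \<V>" "Y \<in> \<V>" "Z \<in> \<V>"
  shows "Y' \<in> \<V> \<Longrightarrow> curvature_defect k X (vadd Y Y') Z p h = curvature_defect k X Y Z p h + curvature_defect k X Y' Z p h"
    and "smooth_fun A a \<Longrightarrow> curvature_defect k X (vscale a Y) Z p h = a p * curvature_defect k X Y Z p h"
  using assms curvature_defect_1
  by (simp_all add: curvature_defect_antisym[of X] vadd_in vscale_in)

lemma curvature_defect_3:
  assumes "X \<in> \<V>" "Y \<in> \<V>" "Z \<in> \<V>"
  shows "Z' \<in> \<V> \<Longrightarrow> curvature_defect k X Y (vadd Z Z') p h = curvature_defect k X Y Z p h + curvature_defect k X Y Z' p h"
    and "smooth_fun A a \<Longrightarrow> curvature_defect k X Y (vscale a Z) p h = a p * curvature_defect k X Y Z p h"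
  using assms
  by (simp_all add: curvature_defect_def curvature_vadd_3 curvature_vscale_3 metric_vadd metric_vscale
      vector_field_tangent algebra_simps)

end

section \<open>Product manifolds\<close>

lemma push_forward_fst [simp]: "push_forward fst v h = v (\<lambda>x. h (fst x))"
  by (simp add: push_forward_def comp_def)

lemma push_forward_snd [simp]: "push_forward snd v h = v (\<lambda>x. h (snd x))"
  by (simp add: push_forward_def comp_def)

lemma inv_into_map_prod:
  assumes "inj_on \<phi> U" "inj_on \<psi> V" "z \<in> \<phi> ` U \<times> \<psi> ` V"
  shows "inv_into (U \<times> V) (map_prod \<phi> \<psi>) z = (inv_into U \<phi> (fst z), inv_into V \<psi> (snd z))"
  using assms by (intro inv_into_f_eq) (auto simp: f_inv_into_f inv_into_into intro!: map_prod_inj_on)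

lemma map_prod_image_times: "map_prod \<phi> \<psi> ` (U \<times> V) = \<phi> ` U \<times> \<psi> ` V"
  by (rule map_prod_surj_on) auto

lemma smooth_on_compose_fst:
  fixes S :: "'e::euclidean_space set" and T :: "'f::euclidean_space set"
  assumes "open S" "open T" "smooth_on S f"
  shows "smooth_on (S \<times> T) (\<lambda>z. f (fst z))"
  by (rule smooth_on_compose[OF open_Times[OF assms(1,2)] assms(1) _
        smooth_on_bounded_linear[OF bounded_linear_fst] assms(3)])
    (auto intro: open_Times assms)

lemma smooth_on_compose_snd:
  fixes S :: "'e::euclidean_space set" and T :: "'f::euclidean_space set"
  assumes "open S" "open T" "smooth_on T f"
  shows "smooth_on (S \<times> T) (\<lambda>z. f (snd z))"
  by (rule smooth_on_compose[OF open_Times[OF assms(1,2)] assms(2) _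
        smooth_on_bounded_linear[OF bounded_linear_snd] assms(3)])
    (auto intro: open_Times assms)

locale smooth_manifold_pair = M1: smooth_manifold A1 + M2: smooth_manifold A2
  for A1 :: "('a::{t2_space,second_countable_topology}, 'e::euclidean_space) atlas"
    and A2 :: "('b::{t2_space,second_countable_topology}, 'f::euclidean_space) atlas"
begin

abbreviation A :: "('a \<times> 'b, 'e \<times> 'f) atlas" where "A \<equiv> prod_atlas A1 A2"

lemma product_inverse:
  assumes "(U, \<phi>) \<in> A1" "(V, \<psi>) \<in> A2" "z \<in> \<phi> ` U \<times> \<psi> ` V"
  shows "inv_into (U \<times> V) (map_prod \<phi> \<psi>) z = (inv_into U \<phi> (fst z), inv_into V \<psi> (snd z))"
  using assms M1.chart_inj M2.chart_inj by (blast intro: inv_into_map_prod)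

lemma product_chart: "(U, \<phi>) \<in> A1 \<Longrightarrow> (V, \<psi>) \<in> A2 \<Longrightarrow> (U \<times> V, map_prod \<phi> \<psi>) \<in> A"
  unfolding prod_atlas_def by blast

lemma product_chartE:
  assumes "(W, \<theta>) \<in> A"
  obtains U \<phi> V \<psi> where "(U, \<phi>) \<in> A1" "(V, \<psi>) \<in> A2" "W = U \<times> V" "\<theta> = map_prod \<phi> \<psi>"
  using assms unfolding prod_atlas_def by blast

lemma product_homeomorphism:
  assumes "(U, \<phi>) \<in> A1" "(V, \<psi>) \<in> A2"
  shows "homeomorphism (U \<times> V) (\<phi> ` U \<times> \<psi> ` V) (map_prod \<phi> \<psi>) (inv_into (U \<times> V) (map_prod \<phi> \<psi>))"
proof (rule homeomorphismI)
  let ?i = "inv_into (U \<times> V) (map_prod \<phi> \<psi>)"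
  note h1 = M1.chart_homeomorphism(3)[OF assms(1)] and h2 = M2.chart_homeomorphism(3)[OF assms(2)]
  have "continuous_on (U \<times> V) (\<lambda>z. (\<phi> (fst z), \<psi> (snd z)))"
    by (intro continuous_on_Pair continuous_on_compose2[OF M1.chart_continuous[OF assms(1)] continuous_on_fst]
        continuous_on_compose2[OF M2.chart_continuous[OF assms(2)] continuous_on_snd] continuous_on_id) auto
  then show "continuous_on (U \<times> V) (map_prod \<phi> \<psi>)"
    by (simp add: map_prod_def case_prod_unfold)
  have "continuous_on (\<phi> ` U \<times> \<psi> ` V) (\<lambda>z. (inv_into U \<phi> (fst z), inv_into V \<psi> (snd z)))"
    by (intro continuous_on_Pair continuous_on_compose2[OF homeomorphism_cont2[OF h1] continuous_on_fst]
        continuous_on_compose2[OF homeomorphism_cont2[OF h2] continuous_on_snd] continuous_on_id) auto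
  then show "continuous_on (\<phi> ` U \<times> \<psi> ` V) ?i"
    by (rule continuous_on_eq) (simp add: product_inverse[OF assms])
  show "map_prod \<phi> \<psi> ` (U \<times> V) \<subseteq> \<phi> ` U \<times> \<psi> ` V" by auto
  show "?i ` (\<phi> ` U \<times> \<psi> ` V) \<subseteq> U \<times> V"
    using assms by (auto simp: product_inverse)
  show "?i (map_prod \<phi> \<psi> z) = z" if "z \<in> U \<times> V" for z
    using that assms by (auto simp: product_inverse)
  show "map_prod \<phi> \<psi> (?i z) = z" if "z \<in> \<phi> ` U \<times> \<psi> ` V" for z
    using that assms by (auto simp: product_inverse)
qed

lemma product_transition:
  assumes U: "(U, \<phi>) \<in> A1" "(V, \<psi>) \<in> A2" and U': "(U', \<phi>') \<in> A1" "(V', \<psi>') \<in> A2"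
  shows "smooth_on (map_prod \<phi> \<psi> ` (U \<times> V \<inter> U' \<times> V')) (map_prod \<phi>' \<psi>' \<circ> inv_into (U \<times> V) (map_prod \<phi> \<psi>))"
proof -
  let ?S = "\<phi> ` (U \<inter> U')" and ?T = "\<psi> ` (V \<inter> V')"
  have o: "open ?S" "open ?T"
    using M1.chart_homeomorphism(1)[OF U(1)] M1.chart_homeomorphism(1)[OF U'(1)]
      M2.chart_homeomorphism(1)[OF U(2)] M2.chart_homeomorphism(1)[OF U'(2)]
    by (auto intro!: M1.chart_open_image[OF U(1)] M2.chart_open_image[OF U(2)])
  have "smooth_on (?S \<times> ?T) (\<lambda>z. ((\<phi>' \<circ> inv_into U \<phi>) (fst z), (\<psi>' \<circ> inv_into V \<psi>) (snd z)))"
    by (rule smooth_on_Pair[OF open_Times[OF o] smooth_on_compose_fst[OF o M1.chart_transition[OF U(1) U'(1)]]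
          smooth_on_compose_snd[OF o M2.chart_transition[OF U(2) U'(2)]]])
  then have "smooth_on (?S \<times> ?T) (map_prod \<phi>' \<psi>' \<circ> inv_into (U \<times> V) (map_prod \<phi> \<psi>))"
    by (rule smooth_on_cong[OF open_Times[OF o], rotated]) (use U in \<open>auto simp: product_inverse\<close>)
  moreover have "U \<times> V \<inter> U' \<times> V' = (U \<inter> U') \<times> (V \<inter> V')" by auto
  ultimately show ?thesis by (simp add: map_prod_image_times)
qed

sublocale P: smooth_manifold A
proof
  have "\<exists>(W, \<theta>)\<in>A. x \<in> W" for x
  proof -
    obtain U \<phi> where "(U, \<phi>) \<in> A1" "fst x \<in> U" by (rule M1.obtain_chart)
    moreover obtain V \<psi> where "(V, \<psi>) \<in> A2" "snd x \<in> V" by (rule M2.obtain_chart)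
    ultimately show ?thesis
      by (intro bexI[OF _ product_chart]) (auto simp: mem_Times_iff)
  qed
  then have 1: "(\<Union>(W, \<theta>)\<in>A. W) = UNIV" by fastforce
  have 2: "open W \<and> open (\<theta> ` W) \<and> homeomorphism W (\<theta> ` W) \<theta> (inv_into W \<theta>)" if "(W, \<theta>) \<in> A" for W \<theta>
  proof -
    from that obtain U \<phi> V \<psi> where c: "(U, \<phi>) \<in> A1" "(V, \<psi>) \<in> A2" "W = U \<times> V" "\<theta> = map_prod \<phi> \<psi>"
      by (rule product_chartE)
    show ?thesis
      unfolding c(3,4) map_prod_image_times
      using product_homeomorphism[OF c(1,2)] M1.chart_homeomorphism[OF c(1)] M2.chart_homeomorphism[OF c(2)]
      by (auto intro: open_Times)
  qed
  have 3: "smooth_on (\<theta> ` (W \<inter> W')) (\<theta>' \<circ> inv_into W \<theta>)" if "(W, \<theta>) \<in> A" "(W', \<theta>') \<in> A" for W \<theta> W' \<theta>'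
    using product_chartE[OF that(1)] product_chartE[OF that(2)] product_transition by metis
  show "smooth_atlas A"
    unfolding smooth_atlas_def using 1 2 3 by blast
qed

section \<open>Smooth functions and tangent vectors on the product\<close>

lemma smooth_fun_fst:
  assumes "smooth_fun A1 h" shows "smooth_fun A (\<lambda>x. h (fst x))"
proof (rule P.smooth_fun_chartI)
  fix W \<theta> assume "(W, \<theta>) \<in> A"
  then obtain U \<phi> V \<psi> where c: "(U, \<phi>) \<in> A1" "(V, \<psi>) \<in> A2" "W = U \<times> V" "\<theta> = map_prod \<phi> \<psi>"
    by (rule product_chartE)
  note o = M1.chart_homeomorphism(2)[OF c(1)] M2.chart_homeomorphism(2)[OF c(2)]
  show "smooth_on (\<theta> ` W) (\<lambda>z. h (fst (inv_into W \<theta> z)))"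
    unfolding c(3,4) map_prod_image_times
    by (rule smooth_on_cong[OF open_Times[OF o] _ smooth_on_compose_fst[OF o M1.smooth_fun_chartD[OF assms c(1)]]])
      (simp add: product_inverse[OF c(1,2)])
qed

lemma smooth_fun_snd:
  assumes "smooth_fun A2 h" shows "smooth_fun A (\<lambda>x. h (snd x))"
proof (rule P.smooth_fun_chartI)
  fix W \<theta> assume "(W, \<theta>) \<in> A"
  then obtain U \<phi> V \<psi> where c: "(U, \<phi>) \<in> A1" "(V, \<psi>) \<in> A2" "W = U \<times> V" "\<theta> = map_prod \<phi> \<psi>"
    by (rule product_chartE)
  note o = M1.chart_homeomorphism(2)[OF c(1)] M2.chart_homeomorphism(2)[OF c(2)]
  show "smooth_on (\<theta> ` W) (\<lambda>z. h (snd (inv_into W \<theta> z)))"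
    unfolding c(3,4) map_prod_image_times
    by (rule smooth_on_cong[OF open_Times[OF o] _ smooth_on_compose_snd[OF o M2.smooth_fun_chartD[OF assms c(2)]]])
      (simp add: product_inverse[OF c(1,2)])
qed

lemma smooth_fun_slice_fst:
  assumes "smooth_fun A h" shows "smooth_fun A1 (\<lambda>p. h (p, q))"
proof (rule M1.smooth_fun_chartI)
  fix U \<phi> assume U: "(U, \<phi>) \<in> A1"
  obtain V \<psi> where V: "(V, \<psi>) \<in> A2" "q \<in> V" by (rule M2.obtain_chart)
  note o = M1.chart_homeomorphism(2)[OF U] M2.chart_homeomorphism(2)[OF V(1)]
  have s: "smooth_on (\<phi> ` U) (\<lambda>x. (x, \<psi> q))"
    by (intro smooth_on_Pair o smooth_on_const smooth_on_bounded_linear bounded_linear_ident)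
  have "smooth_on (\<phi> ` U) (\<lambda>x. h (inv_into (U \<times> V) (map_prod \<phi> \<psi>) (x, \<psi> q)))"
    by (rule smooth_on_compose[OF o(1) open_Times[OF o] _ s
          P.smooth_fun_chartD[OF assms product_chart[OF U V(1)], unfolded map_prod_image_times]])
      (use V in auto)
  then show "smooth_on (\<phi> ` U) (\<lambda>x. h (inv_into U \<phi> x, q))"
    by (rule smooth_on_cong[OF o(1), rotated]) (use U V in \<open>simp add: product_inverse\<close>)
qed

lemma smooth_fun_slice_snd:
  assumes "smooth_fun A h" shows "smooth_fun A2 (\<lambda>q. h (p, q))"
proof (rule M2.smooth_fun_chartI)
  fix V \<psi> assume V: "(V, \<psi>) \<in> A2"
  obtain U \<phi> where U: "(U, \<phi>) \<in> A1" "p \<in> U" by (rule M1.obtain_chart)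
  note o = M1.chart_homeomorphism(2)[OF U(1)] M2.chart_homeomorphism(2)[OF V]
  have s: "smooth_on (\<psi> ` V) (\<lambda>y. (\<phi> p, y))"
    by (intro smooth_on_Pair o smooth_on_const smooth_on_bounded_linear bounded_linear_ident)
  have "smooth_on (\<psi> ` V) (\<lambda>y. h (inv_into (U \<times> V) (map_prod \<phi> \<psi>) (\<phi> p, y)))"
    by (rule smooth_on_compose[OF o(2) open_Times[OF o] _ s
          P.smooth_fun_chartD[OF assms product_chart[OF U(1) V], unfolded map_prod_image_times]])
      (use U in auto)
  then show "smooth_on (\<psi> ` V) (\<lambda>y. h (p, inv_into V \<psi> y))"
    by (rule smooth_on_cong[OF o(2), rotated]) (use U V in \<open>simp add: product_inverse\<close>)
qed

text \<open>Both directions matter because tangent vectors take the value 0 on nonsmooth functions: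
  a pushed-forward vector must take this default exactly where a vector of the factor does.\<close>

lemma smooth_fun_fst_iff: "smooth_fun A (\<lambda>x. h (fst x)) \<longleftrightarrow> smooth_fun A1 h"
  using smooth_fun_slice_fst[of "\<lambda>x. h (fst x)"] smooth_fun_fst by auto

lemma smooth_fun_snd_iff: "smooth_fun A (\<lambda>x. h (snd x)) \<longleftrightarrow> smooth_fun A2 h"
  using smooth_fun_slice_snd[of "\<lambda>x. h (snd x)"] smooth_fun_snd by auto

lemma coord_vec_product:
  assumes U: "(U, \<phi>) \<in> A1" "p \<in> U" and V: "(V, \<psi>) \<in> A2" "q \<in> V" and h: "smooth_fun A h"
  shows "coord_vec A (U \<times> V) (map_prod \<phi> \<psi>) (p, q) (u, 0) h = coord_vec A1 U \<phi> p u (\<lambda>p'. h (p', q))"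
    and "coord_vec A (U \<times> V) (map_prod \<phi> \<psi>) (p, q) (0, v) h = coord_vec A2 V \<psi> q v (\<lambda>q'. h (p, q'))"
proof -
  let ?c = "coord_vec A (U \<times> V) (map_prod \<phi> \<psi>) (p, q)"
  have d: "((h \<circ> inv_into (U \<times> V) (map_prod \<phi> \<psi>)) has_derivative (\<lambda>w. ?c w h)) (at (\<phi> p, \<psi> q))"
    using P.chart_has_derivative[OF h product_chart[OF U(1) V(1)], of "(p, q)"] U V by simp
  have "((\<lambda>x. (h \<circ> inv_into (U \<times> V) (map_prod \<phi> \<psi>)) (x, \<psi> q)) has_derivative (\<lambda>u. ?c (u, 0) h)) (at (\<phi> p))"
    by (rule has_derivative_compose[where f="\<lambda>x. (x, \<psi> q)" and f'="\<lambda>u. (u, 0)", OF _ d])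
      (auto intro!: derivative_eq_intros)
  then show "?c (u, 0) h = coord_vec A1 U \<phi> p u (\<lambda>p'. h (p', q))"
    by (rule M1.coord_vec_eqI[OF smooth_fun_slice_fst[OF h] U _ open_UNIV, symmetric])
      (use U V in \<open>auto simp: product_inverse\<close>)
  have "((\<lambda>y. (h \<circ> inv_into (U \<times> V) (map_prod \<phi> \<psi>)) (\<phi> p, y)) has_derivative (\<lambda>v. ?c (0, v) h)) (at (\<psi> q))"
    by (rule has_derivative_compose[where f="\<lambda>y. (\<phi> p, y)" and f'="\<lambda>v. (0, v)", OF _ d])
      (auto intro!: derivative_eq_intros)
  then show "?c (0, v) h = coord_vec A2 V \<psi> q v (\<lambda>q'. h (p, q'))"
    by (rule M2.coord_vec_eqI[OF smooth_fun_slice_snd[OF h] V _ open_UNIV, symmetric])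
      (use U V in \<open>auto simp: product_inverse\<close>)
qed

lemma push_forward_coord_vec:
  assumes U: "(U, \<phi>) \<in> A1" "p \<in> U" and V: "(V, \<psi>) \<in> A2" "q \<in> V"
  shows "push_forward fst (coord_vec A (U \<times> V) (map_prod \<phi> \<psi>) (p, q) (u, v)) = coord_vec A1 U \<phi> p u"
    and "push_forward snd (coord_vec A (U \<times> V) (map_prod \<phi> \<psi>) (p, q) (u, v)) = coord_vec A2 V \<psi> q v"
proof -
  let ?c = "coord_vec A (U \<times> V) (map_prod \<phi> \<psi>) (p, q)"
  have split: "?c (u, v) h = ?c (u, 0) h + ?c (0, v) h" for h
    using P.coord_vec_linear(1)[OF product_chart[OF U(1) V(1)], of "(p, q)" "(u, 0)" "(0, v)" h] U V by simp
  have T: "coord_vec A1 U \<phi> p u \<in> tangent_space A1 p" "coord_vec A2 V \<psi> q v \<in> tangent_space A2 q"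
    unfolding M1.tangent_space_chart[OF U] M2.tangent_space_chart[OF V] by blast+
  show "push_forward fst (?c (u, v)) = coord_vec A1 U \<phi> p u"
  proof
    fix h show "push_forward fst (?c (u, v)) h = coord_vec A1 U \<phi> p u h"
      using M2.tangent_const[OF T(2)] smooth_fun_fst_iff[of h]
      by (cases "smooth_fun A1 h") (simp_all add: split coord_vec_product[OF U V])
  qed
  show "push_forward snd (?c (u, v)) = coord_vec A2 V \<psi> q v"
  proof
    fix h show "push_forward snd (?c (u, v)) h = coord_vec A2 V \<psi> q v h"
      using M1.tangent_const[OF T(1)] smooth_fun_snd_iff[of h]
      by (cases "smooth_fun A2 h") (simp_all add: split coord_vec_product[OF U V])
  qed
qed

lemma tangent_product_cases:
  assumes "v \<in> tangent_space A x"
  obtains U \<phi> V \<psi> u1 u2 where "(U, \<phi>) \<in> A1" "fst x \<in> U" "(V, \<psi>) \<in> A2" "snd x \<in> V"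
    "v = coord_vec A (U \<times> V) (map_prod \<phi> \<psi>) (fst x, snd x) (u1, u2)"
proof -
  obtain U \<phi> where U: "(U, \<phi>) \<in> A1" "fst x \<in> U" by (rule M1.obtain_chart)
  obtain V \<psi> where V: "(V, \<psi>) \<in> A2" "snd x \<in> V" by (rule M2.obtain_chart)
  have "tangent_space A x = range (coord_vec A (U \<times> V) (map_prod \<phi> \<psi>) x)"
    by (rule P.tangent_space_chart[OF product_chart[OF U(1) V(1)]]) (use U V in \<open>simp add: mem_Times_iff\<close>)
  then obtain w where "v = coord_vec A (U \<times> V) (map_prod \<phi> \<psi>) x w" using assms by auto
  then show ?thesis by (intro that[OF U V, of "fst w" "snd w"]) simp
qed

lemma push_forward_tangent:
  assumes "v \<in> tangent_space A x"
  shows "push_forward fst v \<in> tangent_space A1 (fst x)" "push_forward snd v \<in> tangent_space A2 (snd x)"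
proof -
  obtain U \<phi> V \<psi> u1 u2 where c: "(U, \<phi>) \<in> A1" "fst x \<in> U" "(V, \<psi>) \<in> A2" "snd x \<in> V"
    and v: "v = coord_vec A (U \<times> V) (map_prod \<phi> \<psi>) (fst x, snd x) (u1, u2)"
    using tangent_product_cases[OF assms] by blast
  show "push_forward fst v \<in> tangent_space A1 (fst x)" "push_forward snd v \<in> tangent_space A2 (snd x)"
    unfolding v push_forward_coord_vec[OF c] M1.tangent_space_chart[OF c(1,2)] M2.tangent_space_chart[OF c(3,4)]
    by blast+
qed

lemma tangent_product_eqI:
  assumes "v \<in> tangent_space A x" "w \<in> tangent_space A x"
    and "push_forward fst v = push_forward fst w" "push_forward snd v = push_forward snd w"
  shows "v = w"
proof -
  obtain U \<phi> V \<psi> u1 u2 where c: "(U, \<phi>) \<in> A1" "fst x \<in> U" "(V, \<psi>) \<in> A2" "snd x \<in> V"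
    and v: "v = coord_vec A (U \<times> V) (map_prod \<phi> \<psi>) (fst x, snd x) (u1, u2)"
    using tangent_product_cases[OF assms(1)] by blast
  have "tangent_space A x = range (coord_vec A (U \<times> V) (map_prod \<phi> \<psi>) x)"
    by (rule P.tangent_space_chart[OF product_chart[OF c(1,3)]]) (use c in \<open>simp add: mem_Times_iff\<close>)
  then obtain z where "w = coord_vec A (U \<times> V) (map_prod \<phi> \<psi>) x z" using assms(2) by auto
  then have w: "w = coord_vec A (U \<times> V) (map_prod \<phi> \<psi>) (fst x, snd x) (fst z, snd z)" by simp
  show ?thesis
    using assms(3,4) unfolding v w push_forward_coord_vec[OF c]
    by (simp add: M1.coord_vec_inject[OF c(1,2)] M2.coord_vec_inject[OF c(3,4)])
qed

text \<open>The field that projects to \<open>X\<close> on the first factor and to zero on the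
  second. The explicit case distinction is there because a nonsmooth function can have smooth
  slices.\<close>

definition lift1 :: "'a vfield \<Rightarrow> ('a \<times> 'b) vfield" where
  "lift1 X = (\<lambda>x h. if smooth_fun A h then X (fst x) (\<lambda>p. h (p, snd x)) else 0)"

definition lift2 :: "'b vfield \<Rightarrow> ('a \<times> 'b) vfield" where
  "lift2 X = (\<lambda>x h. if smooth_fun A h then X (snd x) (\<lambda>q. h (fst x, q)) else 0)"

lemma lift1_coord_vec:
  assumes U: "(U, \<phi>) \<in> A1" "fst x \<in> U" and V: "(V, \<psi>) \<in> A2" "snd x \<in> V"
    and X: "X (fst x) = coord_vec A1 U \<phi> (fst x) u"
  shows "lift1 X x = coord_vec A (U \<times> V) (map_prod \<phi> \<psi>) x (u, 0)"
proof
  fix h show "lift1 X x h = coord_vec A (U \<times> V) (map_prod \<phi> \<psi>) x (u, 0) h"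
    using coord_vec_product(1)[OF U V, of h u] X by (cases "smooth_fun A h") (simp_all add: lift1_def)
qed

lemma lift2_coord_vec:
  assumes U: "(U, \<phi>) \<in> A1" "fst x \<in> U" and V: "(V, \<psi>) \<in> A2" "snd x \<in> V"
    and X: "X (snd x) = coord_vec A2 V \<psi> (snd x) u"
  shows "lift2 X x = coord_vec A (U \<times> V) (map_prod \<phi> \<psi>) x (0, u)"
proof
  fix h show "lift2 X x h = coord_vec A (U \<times> V) (map_prod \<phi> \<psi>) x (0, u) h"
    using coord_vec_product(2)[OF U V, of h u] X by (cases "smooth_fun A h") (simp_all add: lift2_def)
qed

lemma cutoff_product:
  assumes "M1.cutoff U b1" "M2.cutoff V b2"
  shows "P.cutoff (U \<times> V) (\<lambda>x. b1 (fst x) * b2 (snd x))"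
proof -
  obtain C1 C2 where C: "closed C1" "C1 \<subseteq> U" "\<And>p. p \<notin> C1 \<Longrightarrow> b1 p = 0"
    "closed C2" "C2 \<subseteq> V" "\<And>p. p \<notin> C2 \<Longrightarrow> b2 p = 0"
    using assms unfolding M1.cutoff_def M2.cutoff_def by metis
  have "smooth_fun A (\<lambda>x. b1 (fst x) * b2 (snd x))"
    using P.smooth_fun_mult[OF smooth_fun_fst smooth_fun_snd] assms M1.cutoff_smooth M2.cutoff_smooth by blast
  moreover have "b1 (fst x) * b2 (snd x) = 0" if "x \<notin> C1 \<times> C2" for x
    using that C by (auto simp: mem_Times_iff)
  ultimately show ?thesis
    unfolding P.cutoff_def using C by (intro conjI exI[of _ "C1 \<times> C2"]) (auto intro: closed_Times)
qed

text \<open>Passes from frames to lifts: coordinate fields of a product chart are smooth multiples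
  of lifted ones, the multiplier being the cutoff of the other factor.\<close>

lemma coord_field_product:
  assumes U: "(U, \<phi>) \<in> A1" and V: "(V, \<psi>) \<in> A2" and b: "M1.cutoff U b1" "M2.cutoff V b2"
  shows "P.coord_field (U \<times> V) (map_prod \<phi> \<psi>) (\<lambda>x. b1 (fst x) * b2 (snd x)) (u, 0) =
      vscale (\<lambda>x. b2 (snd x)) (lift1 (M1.coord_field U \<phi> b1 u))"
    and "P.coord_field (U \<times> V) (map_prod \<phi> \<psi>) (\<lambda>x. b1 (fst x) * b2 (snd x)) (0, v) =
      vscale (\<lambda>x. b1 (fst x)) (lift2 (M2.coord_field V \<psi> b2 v))"
proof -
  have "P.coord_field (U \<times> V) (map_prod \<phi> \<psi>) (\<lambda>x. b1 (fst x) * b2 (snd x)) (u, 0) x h =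
      b2 (snd x) * lift1 (M1.coord_field U \<phi> b1 u) x h \<and>
    P.coord_field (U \<times> V) (map_prod \<phi> \<psi>) (\<lambda>x. b1 (fst x) * b2 (snd x)) (0, v) x h =
      b1 (fst x) * lift2 (M2.coord_field V \<psi> b2 v) x h" for x h
  proof (cases "fst x \<in> U \<and> snd x \<in> V")
    case True
    then show ?thesis
      using coord_vec_product[OF U _ V, of "fst x" "snd x" h]
      by (simp add: lift1_def lift2_def P.coord_field_def M1.coord_field_def M2.coord_field_def)
  next
    case False
    then have "b1 (fst x) = 0 \<or> b2 (snd x) = 0"
      using M1.cutoff_outside[OF b(1)] M2.cutoff_outside[OF b(2)] by blast
    then show ?thesis
      by (auto simp: lift1_def lift2_def P.coord_field_def M1.coord_field_def M2.coord_field_def)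
  qed
  then show "P.coord_field (U \<times> V) (map_prod \<phi> \<psi>) (\<lambda>x. b1 (fst x) * b2 (snd x)) (u, 0) =
      vscale (\<lambda>x. b2 (snd x)) (lift1 (M1.coord_field U \<phi> b1 u))"
    and "P.coord_field (U \<times> V) (map_prod \<phi> \<psi>) (\<lambda>x. b1 (fst x) * b2 (snd x)) (0, v) =
      vscale (\<lambda>x. b1 (fst x)) (lift2 (M2.coord_field V \<psi> b2 v))"
    by (auto intro!: vfield_eqI)
qed

text \<open>Acting slice by slice gives smoothness in the first variable only. Joint smoothness is
  obtained by expanding the lift in coordinate fields of the product, with coefficients pulled back
  from M1.\<close>

lemma lift1_in:
  assumes X: "X \<in> M1.\<V>" shows "lift1 X \<in> P.\<V>"
proof (rule P.vector_fieldI)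
  fix x :: "'a \<times> 'b"
  obtain U \<phi> where U: "(U, \<phi>) \<in> A1" "fst x \<in> U" by (rule M1.obtain_chart)
  obtain V \<psi> where V: "(V, \<psi>) \<in> A2" "snd x \<in> V" by (rule M2.obtain_chart)
  obtain u where u: "X (fst x) = coord_vec A1 U \<phi> (fst x) u"
    using M1.vector_field_tangent[OF X, of "fst x"] unfolding M1.tangent_space_chart[OF U] by blast
  have "x \<in> U \<times> V" using U V by (simp add: mem_Times_iff)
  then show "lift1 X x \<in> tangent_space A x"
    unfolding lift1_coord_vec[where X=X, OF U V u] P.tangent_space_chart[OF product_chart[OF U(1) V(1)] \<open>x \<in> U \<times> V\<close>] by blast
next
  fix h assume h: "smooth_fun A h"
  show "smooth_fun A (\<lambda>x. lift1 X x h)"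
  proof (rule P.smooth_fun_localI)
    fix x0 :: "'a \<times> 'b"
    obtain U \<phi> where U: "(U, \<phi>) \<in> A1" "fst x0 \<in> U" by (rule M1.obtain_chart)
    obtain V \<psi> where V: "(V, \<psi>) \<in> A2" "snd x0 \<in> V" by (rule M2.obtain_chart)
    obtain b1 where b1: "M1.cutoff U b1" "b1 (fst x0) = 1" by (rule M1.obtain_cutoff[OF U])
    obtain b2 where b2: "M2.cutoff V b2" "b2 (snd x0) = 1" by (rule M2.obtain_cutoff[OF V])
    let ?E = "\<lambda>i. P.coord_field (U \<times> V) (map_prod \<phi> \<psi>) (\<lambda>x. b1 (fst x) * b2 (snd x)) (i, 0)"
    have E: "?E i \<in> P.\<V>" for i
      by (rule P.coord_field_in[OF product_chart[OF U(1) V(1)] cutoff_product[OF b1(1) b2(1)]])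
    \<comment> \<open>The cube comes from \<open>coordinate_expansion\<close> on M1, the single
      factor \<open>b2\<close> from the cutoff of the product chart.\<close>
    have "b1 (fst x) ^ 3 * b2 (snd x) * lift1 X x h =
        (\<Sum>i\<in>Basis. M1.coordinate_component b1 \<phi> i X (fst x) * ?E i x h)" for x
    proof -
      have "b1 (fst x) ^ 3 * lift1 X x h =
          (\<Sum>i\<in>Basis. M1.coordinate_component b1 \<phi> i X (fst x) * lift1 (M1.coord_field U \<phi> b1 i) x h)"
        using M1.coordinate_expansion[OF U(1) b1(1) X] h by (simp add: lift1_def)
      then have "b2 (snd x) * (b1 (fst x) ^ 3 * lift1 X x h) =
          (\<Sum>i\<in>Basis. M1.coordinate_component b1 \<phi> i X (fst x) * (b2 (snd x) * lift1 (M1.coord_field U \<phi> b1 i) x h))"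
        by (simp add: sum_distrib_left mult_ac)
      then show ?thesis
        by (simp add: coord_field_product(1)[OF U(1) V(1) b1(1) b2(1)] mult_ac)
    qed
    moreover have "smooth_fun A (\<lambda>x. \<Sum>i\<in>Basis. M1.coordinate_component b1 \<phi> i X (fst x) * ?E i x h)"
      by (rule P.smooth_fun_sum, rule P.smooth_fun_mult[OF smooth_fun_fst[OF
            M1.coordinate_component_smooth[OF U(1) b1(1) X]] P.vector_field_smooth[OF E h]])
    ultimately have "smooth_fun A (\<lambda>x. b1 (fst x) ^ 3 * b2 (snd x) * lift1 X x h)" by simp
    moreover have "smooth_fun A (\<lambda>x. b1 (fst x) ^ 3 * b2 (snd x))"
      by (rule P.smooth_fun_mult[OF P.smooth_fun_power[OF smooth_fun_fst[OF M1.cutoff_smooth[OF b1(1)]]]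
            smooth_fun_snd[OF M2.cutoff_smooth[OF b2(1)]]])
    ultimately show "\<exists>b. smooth_fun A b \<and> b x0 \<noteq> 0 \<and> smooth_fun A (\<lambda>x. b x * lift1 X x h)"
      using b1(2) b2(2) by (intro exI[of _ "\<lambda>x. b1 (fst x) ^ 3 * b2 (snd x)"]) simp
  qed
qed

lemma lift2_in:
  assumes X: "X \<in> M2.\<V>" shows "lift2 X \<in> P.\<V>"
proof (rule P.vector_fieldI)
  fix x :: "'a \<times> 'b"
  obtain U \<phi> where U: "(U, \<phi>) \<in> A1" "fst x \<in> U" by (rule M1.obtain_chart)
  obtain V \<psi> where V: "(V, \<psi>) \<in> A2" "snd x \<in> V" by (rule M2.obtain_chart)
  obtain u where u: "X (snd x) = coord_vec A2 V \<psi> (snd x) u"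
    using M2.vector_field_tangent[OF X, of "snd x"] unfolding M2.tangent_space_chart[OF V] by blast
  have "x \<in> U \<times> V" using U V by (simp add: mem_Times_iff)
  then show "lift2 X x \<in> tangent_space A x"
    unfolding lift2_coord_vec[where X=X, OF U V u] P.tangent_space_chart[OF product_chart[OF U(1) V(1)] \<open>x \<in> U \<times> V\<close>] by blast
next
  fix h assume h: "smooth_fun A h"
  show "smooth_fun A (\<lambda>x. lift2 X x h)"
  proof (rule P.smooth_fun_localI)
    fix x0 :: "'a \<times> 'b"
    obtain U \<phi> where U: "(U, \<phi>) \<in> A1" "fst x0 \<in> U" by (rule M1.obtain_chart)
    obtain V \<psi> where V: "(V, \<psi>) \<in> A2" "snd x0 \<in> V" by (rule M2.obtain_chart)
    obtain b1 where b1: "M1.cutoff U b1" "b1 (fst x0) = 1" by (rule M1.obtain_cutoff[OF U])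
    obtain b2 where b2: "M2.cutoff V b2" "b2 (snd x0) = 1" by (rule M2.obtain_cutoff[OF V])
    let ?E = "\<lambda>i. P.coord_field (U \<times> V) (map_prod \<phi> \<psi>) (\<lambda>x. b1 (fst x) * b2 (snd x)) (0, i)"
    have E: "?E i \<in> P.\<V>" for i
      by (rule P.coord_field_in[OF product_chart[OF U(1) V(1)] cutoff_product[OF b1(1) b2(1)]])
    have "b2 (snd x) ^ 3 * b1 (fst x) * lift2 X x h =
        (\<Sum>i\<in>Basis. M2.coordinate_component b2 \<psi> i X (snd x) * ?E i x h)" for x
    proof -
      have "b2 (snd x) ^ 3 * lift2 X x h =
          (\<Sum>i\<in>Basis. M2.coordinate_component b2 \<psi> i X (snd x) * lift2 (M2.coord_field V \<psi> b2 i) x h)"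
        using M2.coordinate_expansion[OF V(1) b2(1) X] h by (simp add: lift2_def)
      then have "b1 (fst x) * (b2 (snd x) ^ 3 * lift2 X x h) =
          (\<Sum>i\<in>Basis. M2.coordinate_component b2 \<psi> i X (snd x) * (b1 (fst x) * lift2 (M2.coord_field V \<psi> b2 i) x h))"
        by (simp add: sum_distrib_left mult_ac)
      then show ?thesis
        by (simp add: coord_field_product(2)[OF U(1) V(1) b1(1) b2(1)] mult_ac)
    qed
    moreover have "smooth_fun A (\<lambda>x. \<Sum>i\<in>Basis. M2.coordinate_component b2 \<psi> i X (snd x) * ?E i x h)"
      by (rule P.smooth_fun_sum, rule P.smooth_fun_mult[OF smooth_fun_snd[OF
            M2.coordinate_component_smooth[OF V(1) b2(1) X]] P.vector_field_smooth[OF E h]])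
    ultimately have "smooth_fun A (\<lambda>x. b2 (snd x) ^ 3 * b1 (fst x) * lift2 X x h)" by simp
    moreover have "smooth_fun A (\<lambda>x. b2 (snd x) ^ 3 * b1 (fst x))"
      by (rule P.smooth_fun_mult[OF P.smooth_fun_power[OF smooth_fun_snd[OF M2.cutoff_smooth[OF b2(1)]]]
            smooth_fun_fst[OF M1.cutoff_smooth[OF b1(1)]]])
    ultimately show "\<exists>b. smooth_fun A b \<and> b x0 \<noteq> 0 \<and> smooth_fun A (\<lambda>x. b x * lift2 X x h)"
      using b1(2) b2(2) by (intro exI[of _ "\<lambda>x. b2 (snd x) ^ 3 * b1 (fst x)"]) simp
  qed
qed

lemma lift1_fst [simp]: "X \<in> M1.\<V> \<Longrightarrow> lift1 X x (\<lambda>y. h (fst y)) = X (fst x) h"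
  using M1.tangent_nonsmooth[OF M1.vector_field_tangent] by (simp add: lift1_def smooth_fun_fst_iff)

lemma lift1_snd [simp]: "X \<in> M1.\<V> \<Longrightarrow> lift1 X x (\<lambda>y. h (snd y)) = 0"
  using M1.tangent_const[OF M1.vector_field_tangent] by (simp add: lift1_def)

lemma lift2_snd [simp]: "X \<in> M2.\<V> \<Longrightarrow> lift2 X x (\<lambda>y. h (snd y)) = X (snd x) h"
  using M2.tangent_nonsmooth[OF M2.vector_field_tangent] by (simp add: lift2_def smooth_fun_snd_iff)

lemma lift2_fst [simp]: "X \<in> M2.\<V> \<Longrightarrow> lift2 X x (\<lambda>y. h (fst y)) = 0"
  using M2.tangent_const[OF M2.vector_field_tangent] by (simp add: lift2_def)

lemma push_forward_lift [simp]:
  "X \<in> M1.\<V> \<Longrightarrow> push_forward fst (lift1 X x) = X (fst x)"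
  "X \<in> M1.\<V> \<Longrightarrow> push_forward snd (lift1 X x) = (\<lambda>h. 0)"
  "Y \<in> M2.\<V> \<Longrightarrow> push_forward snd (lift2 Y x) = Y (snd x)"
  "Y \<in> M2.\<V> \<Longrightarrow> push_forward fst (lift2 Y x) = (\<lambda>h. 0)"
  by (auto simp: fun_eq_iff)

text \<open>Freezes the point of M2 and keeps the M1 component; this is how a field on M1, in the
  end the gradient, is extracted from the warped connection.\<close>

lemma slice_in:
  assumes X: "X \<in> P.\<V>" shows "(\<lambda>p. push_forward fst (X (p, q))) \<in> M1.\<V>"
proof (rule M1.vector_fieldI)
  show "push_forward fst (X (p, q)) \<in> tangent_space A1 p" for p
    using push_forward_tangent(1)[OF P.vector_field_tangent[OF X, of "(p, q)"]] by simp
  show "smooth_fun A1 (\<lambda>p. push_forward fst (X (p, q)) h)" if "smooth_fun A1 h" for h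
    using smooth_fun_slice_fst[OF P.vector_field_smooth[OF X smooth_fun_fst[OF that]]] by simp
qed

text \<open>A basis vector of the product model space has a zero component, so its coordinate field
  is a smooth multiple of a lift. Lifts themselves are far from being all fields; linearity over
  smooth functions closes the gap.\<close>

lemma function_linear_vanishes_lifts:
  fixes L :: "('a \<times> 'b) vfield \<Rightarrow> real"
  assumes add: "\<And>X Y. X \<in> P.\<V> \<Longrightarrow> Y \<in> P.\<V> \<Longrightarrow> L (vadd X Y) = L X + L Y"
    and scale: "\<And>a X. smooth_fun A a \<Longrightarrow> X \<in> P.\<V> \<Longrightarrow> L (vscale a X) = a x * L X"
    and lift: "\<And>X. X \<in> M1.\<V> \<Longrightarrow> L (lift1 X) = 0" "\<And>Y. Y \<in> M2.\<V> \<Longrightarrow> L (lift2 Y) = 0"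
    and X: "X \<in> P.\<V>"
  shows "L X = 0"
proof -
  obtain U \<phi> where U: "(U, \<phi>) \<in> A1" "fst x \<in> U" by (rule M1.obtain_chart)
  obtain V \<psi> where V: "(V, \<psi>) \<in> A2" "snd x \<in> V" by (rule M2.obtain_chart)
  obtain b1 where b1: "M1.cutoff U b1" "b1 (fst x) = 1" by (rule M1.obtain_cutoff[OF U])
  obtain b2 where b2: "M2.cutoff V b2" "b2 (snd x) = 1" by (rule M2.obtain_cutoff[OF V])
  show ?thesis
  proof (rule P.function_linear_vanishes[where L=L and p=x, OF product_chart[OF U(1) V(1)]
        cutoff_product[OF b1(1) b2(1)] _ add scale _ X])
    show "b1 (fst x) * b2 (snd x) = 1" using b1 b2 by simp
  next
    fix i :: "'e \<times> 'f" assume "i \<in> Basis"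
    then consider u where "i = (u, 0)" | v where "i = (0, v)" by (auto simp: Basis_prod_def)
    then show "L (P.coord_field (U \<times> V) (map_prod \<phi> \<psi>) (\<lambda>x. b1 (fst x) * b2 (snd x)) i) = 0"
    proof cases
      case 1
      note E = M1.coord_field_in[OF U(1) b1(1)]
      show ?thesis unfolding 1 coord_field_product(1)[OF U(1) V(1) b1(1) b2(1)]
        using scale[OF smooth_fun_snd[OF M2.cutoff_smooth[OF b2(1)]] lift1_in[OF E]] lift(1)[OF E] by simp
    next
      case 2
      note E = M2.coord_field_in[OF V(1) b2(1)]
      show ?thesis unfolding 2 coord_field_product(2)[OF U(1) V(1) b1(1) b2(1)]
        using scale[OF smooth_fun_fst[OF M1.cutoff_smooth[OF b1(1)]] lift2_in[OF E]] lift(2)[OF E] by simp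
    qed
  qed
qed

end

section \<open>Warped products\<close>

locale pseudo_riemannian_levi_civita = levi_civita_manifold A g D
  for A :: "('a::{t2_space,second_countable_topology}, 'e::euclidean_space) atlas"
    and g :: "'a metric_tensor" and D :: "'a connection" +
  assumes metric_nondegenerate: "\<And>p u. \<lbrakk>u \<in> tangent_space A p; \<And>w. w \<in> tangent_space A p \<Longrightarrow> g p u w = 0\<rbrakk>
      \<Longrightarrow> u = (\<lambda>h. 0)"
    and metric_smooth: "\<And>X Y. \<lbrakk>X \<in> vector_fields A; Y \<in> vector_fields A\<rbrakk>
      \<Longrightarrow> smooth_fun A (\<lambda>p. g p (X p) (Y p))"
begin

lemma metric_eqI:
  assumes "u \<in> tangent_space A p" "v \<in> tangent_space A p"
    and "\<And>Z. Z \<in> \<V> \<Longrightarrow> g p u (Z p) = g p v (Z p)"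
  shows "u = v"
proof -
  have "(\<lambda>h. u h - v h) = (\<lambda>h. 0)"
  proof (rule metric_nondegenerate)
    show "(\<lambda>h. u h - v h) \<in> tangent_space A p" by (rule tangent_diff[OF assms(1,2)])
    fix w assume w: "w \<in> tangent_space A p"
    then obtain Z where "Z \<in> \<V>" "Z p = w" by (rule tangent_extend)
    then show "g p (\<lambda>h. u h - v h) w = 0"
      using metric_diff[OF assms(1,2) w] assms(3) by auto
  qed
  then show ?thesis by (simp add: fun_eq_iff)
qed

lemma obtain_nonorthogonal:
  obtains X Y where "X \<in> \<V>" "Y \<in> \<V>" "g p (X p) (Y p) \<noteq> 0"
proof -
  obtain U \<phi> where U: "(U, \<phi>) \<in> A" "p \<in> U" by (rule obtain_chart)
  obtain i :: 'e where i: "i \<in> Basis" using nonempty_Basis by blast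
  let ?v = "coord_vec A U \<phi> p i"
  have v: "?v \<in> tangent_space A p" unfolding tangent_space_chart[OF U] by blast
  have "?v \<noteq> coord_vec A U \<phi> p (0 *\<^sub>R i)"
    unfolding coord_vec_inject[OF U] using i nonzero_Basis by auto
  then have "?v \<noteq> (\<lambda>h. 0)"
    by (simp add: fun_eq_iff coord_vec_linear[OF U] del: scaleR_zero_left)
  then obtain w where w: "w \<in> tangent_space A p" "g p ?v w \<noteq> 0"
    using metric_nondegenerate[OF v] by blast
  obtain X Y where "X \<in> \<V>" "X p = ?v" "Y \<in> \<V>" "Y p = w"
    using tangent_extend[OF v] tangent_extend[OF w(1)] by metis
  then show ?thesis using w that by metis
qed

text \<open>For independent \<open>v\<close> and \<open>w\<close> and different constants, the
  coefficient of \<open>w\<close> in the identity forces \<open>v\<close> to be orthogonal to every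
  \<open>z\<close>, against nondegeneracy. The signature of the metric does not matter.\<close>

lemma constant_curvature_unique:
  assumes dim: "DIM('e) \<ge> 2"
    and "\<And>X Y Z h. X \<in> \<V> \<Longrightarrow> Y \<in> \<V> \<Longrightarrow> Z \<in> \<V> \<Longrightarrow>
      c * (g p (X p) (Z p) * Y p h - g p (Y p) (Z p) * X p h) = d * (g p (X p) (Z p) * Y p h - g p (Y p) (Z p) * X p h)"
  shows "c = d"
proof (rule ccontr)
  assume ne: "c \<noteq> d"
  obtain v w where vw: "v \<in> tangent_space A p" "w \<in> tangent_space A p"
    "\<And>c d. (\<And>h. c * v h + d * w h = 0) \<Longrightarrow> c = 0 \<and> d = 0"
    using obtain_independent_tangents[OF dim] by blast
  have "v = (\<lambda>h. 0)"
  proof (rule metric_nondegenerate[OF vw(1)])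
    fix z assume z: "z \<in> tangent_space A p"
    obtain X where X: "X \<in> \<V>" "X p = v" using vw(1) by (rule tangent_extend)
    obtain Y where Y: "Y \<in> \<V>" "Y p = w" using vw(2) by (rule tangent_extend)
    obtain Z where Z: "Z \<in> \<V>" "Z p = z" using z by (rule tangent_extend)
    have "- g p w z * v h + g p v z * w h = 0" for h
      using assms(2)[OF X(1) Y(1) Z(1), of h] ne unfolding X(2) Y(2) Z(2) by auto
    then show "g p v z = 0" using vw(3) by blast
  qed
  then have "1 * v h + 0 * w h = 0" for h by simp
  then show False using vw(3)[of 1 0] by simp
qed

end

locale warped_product = smooth_manifold_pair A1 A2
  + L1: pseudo_riemannian_levi_civita A1 g1 D1 + L2: pseudo_riemannian_levi_civita A2 g2 D2
  for A1 :: "('a::{t2_space,second_countable_topology}, 'e::euclidean_space) atlas"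
    and A2 :: "('b::{t2_space,second_countable_topology}, 'f::euclidean_space) atlas"
    and g1 D1 g2 D2 +
  fixes f :: "'a \<Rightarrow> real" and D :: "('a \<times> 'b) connection"
  assumes f_smooth: "smooth_fun A1 f" and f_pos: "f p > 0"
    and warped_levi_civita: "levi_civita (prod_atlas A1 A2) (warped_metric g1 f g2) D"
begin

abbreviation g :: "('a \<times> 'b) metric_tensor" where "g \<equiv> warped_metric g1 f g2"

lemma f_nonzero [simp]: "f p \<noteq> 0"
  using f_pos[of p] by simp

lemma push_forward_linear:
  "push_forward F (\<lambda>h. u h + v h) = (\<lambda>h. push_forward F u h + push_forward F v h)"
  "push_forward F (\<lambda>h. c * u h) = (\<lambda>h. c * push_forward F u h)"
  by (simp_all add: push_forward_def)

sublocale LP: levi_civita_manifold A g D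
proof
  fix x u v w
  assume T: "u \<in> tangent_space A x" "v \<in> tangent_space A x" "w \<in> tangent_space A x"
  note t = push_forward_tangent[OF T(1)] push_forward_tangent[OF T(2)] push_forward_tangent[OF T(3)]
  show "g x (\<lambda>h. u h + v h) w = g x u w + g x v w"
    unfolding warped_metric_def push_forward_linear L1.metric_add[OF t(1,3,5)] L2.metric_add[OF t(2,4,6)]
    by (simp add: algebra_simps)
next
  fix x c u w
  assume T: "u \<in> tangent_space A x" "w \<in> tangent_space A x"
  note t = push_forward_tangent[OF T(1)] push_forward_tangent[OF T(2)]
  show "g x (\<lambda>h. c * u h) w = c * g x u w"
    unfolding warped_metric_def push_forward_linear L1.metric_scale[OF t(1,3)] L2.metric_scale[OF t(2,4)]
    by (simp add: algebra_simps)
  show "g x u w = g x w u"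
    unfolding warped_metric_def L1.metric_sym[OF t(1,3)] L2.metric_sym[OF t(2,4)] by simp
qed (rule warped_levi_civita)

section \<open>The warped metric on lifts\<close>

lemma metric_lift1:
  assumes "v \<in> tangent_space A x" "Z \<in> M1.\<V>"
  shows "g x v (lift1 Z x) = g1 (fst x) (push_forward fst v) (Z (fst x))"
  using L2.metric_zero[OF push_forward_tangent(2)[OF assms(1)]]
    L2.metric_sym[OF push_forward_tangent(2)[OF assms(1)] M2.tangent_zero] assms
  by (simp add: warped_metric_def del: push_forward_snd push_forward_fst)

lemma metric_lift2:
  assumes "v \<in> tangent_space A x" "W \<in> M2.\<V>"
  shows "g x v (lift2 W x) = (f (fst x))\<^sup>2 * g2 (snd x) (push_forward snd v) (W (snd x))"
  using L1.metric_zero[OF push_forward_tangent(1)[OF assms(1)]]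
    L1.metric_sym[OF push_forward_tangent(1)[OF assms(1)] M1.tangent_zero] assms
  by (simp add: warped_metric_def del: push_forward_snd push_forward_fst)

lemma metric_lifts:
  "X \<in> M1.\<V> \<Longrightarrow> Y \<in> M1.\<V> \<Longrightarrow> g x (lift1 X x) (lift1 Y x) = g1 (fst x) (X (fst x)) (Y (fst x))"
  "X \<in> M1.\<V> \<Longrightarrow> U \<in> M2.\<V> \<Longrightarrow> g x (lift1 X x) (lift2 U x) = 0"
  "X \<in> M1.\<V> \<Longrightarrow> U \<in> M2.\<V> \<Longrightarrow> g x (lift2 U x) (lift1 X x) = 0"
  "U \<in> M2.\<V> \<Longrightarrow> V \<in> M2.\<V> \<Longrightarrow> g x (lift2 U x) (lift2 V x) = (f (fst x))\<^sup>2 * g2 (snd x) (U (snd x)) (V (snd x))"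
  by (simp_all add: metric_lift1 metric_lift2 P.vector_field_tangent lift1_in lift2_in
      L1.metric_zero L2.metric_zero M1.vector_field_tangent M2.vector_field_tangent
      del: push_forward_snd push_forward_fst)

lemma metric_zero_lifts:
  "X \<in> M1.\<V> \<Longrightarrow> g x (\<lambda>h. 0) (lift1 X x) = 0"
  "U \<in> M2.\<V> \<Longrightarrow> g x (\<lambda>h. 0) (lift2 U x) = 0"
  by (simp_all add: LP.metric_zero P.vector_field_tangent lift1_in lift2_in)

text \<open>Stands in for nondegeneracy of the warped metric: pairing with lifts from one factor
  isolates one component, and the factor \<open>f\<close> squared can be cancelled.\<close>

lemma tangent_metric_eqI:
  assumes v: "v \<in> tangent_space A x" and w: "w \<in> tangent_space A x"
    and Z: "\<And>Z. Z \<in> M1.\<V> \<Longrightarrow> g x v (lift1 Z x) = g x w (lift1 Z x)"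
    and W: "\<And>W. W \<in> M2.\<V> \<Longrightarrow> g x v (lift2 W x) = g x w (lift2 W x)"
  shows "v = w"
proof (rule tangent_product_eqI[OF v w])
  show "push_forward fst v = push_forward fst w"
    by (rule L1.metric_eqI[OF push_forward_tangent(1)[OF v] push_forward_tangent(1)[OF w]])
      (use Z metric_lift1[OF v] metric_lift1[OF w] in simp)
  show "push_forward snd v = push_forward snd w"
    by (rule L2.metric_eqI[OF push_forward_tangent(2)[OF v] push_forward_tangent(2)[OF w]])
      (use W metric_lift2[OF v] metric_lift2[OF w] in simp)
qed

text \<open>The last case is the only one among lifts in which a derivative of \<open>f\<close>
  enters the Koszul formula; all warping terms originate there.\<close>

lemma derivative_metric_lift1:
  assumes X: "X \<in> M1.\<V>"
  shows "Y \<in> M1.\<V> \<Longrightarrow> Z \<in> M1.\<V> \<Longrightarrow> lift1 X x (\<lambda>q. g q (lift1 Y q) (lift1 Z q)) = X (fst x) (\<lambda>p. g1 p (Y p) (Z p))"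
    and "Y \<in> M1.\<V> \<Longrightarrow> V \<in> M2.\<V> \<Longrightarrow> lift1 X x (\<lambda>q. g q (lift1 Y q) (lift2 V q)) = 0"
    and "Y \<in> M1.\<V> \<Longrightarrow> V \<in> M2.\<V> \<Longrightarrow> lift1 X x (\<lambda>q. g q (lift2 V q) (lift1 Y q)) = 0"
    and "U \<in> M2.\<V> \<Longrightarrow> V \<in> M2.\<V> \<Longrightarrow> lift1 X x (\<lambda>q. g q (lift2 U q) (lift2 V q)) =
        2 * f (fst x) * X (fst x) f * g2 (snd x) (U (snd x)) (V (snd x))"
proof -
  note T = P.vector_field_tangent[OF lift1_in[OF X]]
  show "lift1 X x (\<lambda>q. g q (lift1 Y q) (lift1 Z q)) = X (fst x) (\<lambda>p. g1 p (Y p) (Z p))"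
    if "Y \<in> M1.\<V>" "Z \<in> M1.\<V>"
    using lift1_fst[OF X, of x "\<lambda>p. g1 p (Y p) (Z p)"] that by (simp add: metric_lifts)
  show "lift1 X x (\<lambda>q. g q (lift1 Y q) (lift2 V q)) = 0" "lift1 X x (\<lambda>q. g q (lift2 V q) (lift1 Y q)) = 0"
    if "Y \<in> M1.\<V>" "V \<in> M2.\<V>"
    using that by (simp_all add: metric_lifts P.tangent_const[OF T])
  show "lift1 X x (\<lambda>q. g q (lift2 U q) (lift2 V q)) = 2 * f (fst x) * X (fst x) f * g2 (snd x) (U (snd x)) (V (snd x))"
    if UV: "U \<in> M2.\<V>" "V \<in> M2.\<V>"
  proof -
    have f2: "X p (\<lambda>q. (f q)\<^sup>2) = 2 * f p * X p f" for p
      using M1.tangent_derivation(2)[OF M1.vector_field_tangent[OF X] f_smooth f_smooth, of p]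
      by (simp add: power2_eq_square)
    show ?thesis
      using P.tangent_derivation(2)[OF T smooth_fun_fst[OF M1.smooth_fun_power[OF f_smooth]]
          smooth_fun_snd[OF L2.metric_smooth[OF UV]], of x 2]
        lift1_fst[OF X, of x "\<lambda>p. (f p)\<^sup>2"] lift1_snd[OF X, of x "\<lambda>q. g2 q (U q) (V q)"] UV
      by (simp add: metric_lifts f2)
  qed
qed

lemma derivative_metric_lift2:
  assumes W: "W \<in> M2.\<V>"
  shows "Y \<in> M1.\<V> \<Longrightarrow> Z \<in> M1.\<V> \<Longrightarrow> lift2 W x (\<lambda>q. g q (lift1 Y q) (lift1 Z q)) = 0"
    and "Y \<in> M1.\<V> \<Longrightarrow> V \<in> M2.\<V> \<Longrightarrow> lift2 W x (\<lambda>q. g q (lift1 Y q) (lift2 V q)) = 0"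
    and "Y \<in> M1.\<V> \<Longrightarrow> V \<in> M2.\<V> \<Longrightarrow> lift2 W x (\<lambda>q. g q (lift2 V q) (lift1 Y q)) = 0"
    and "U \<in> M2.\<V> \<Longrightarrow> V \<in> M2.\<V> \<Longrightarrow> lift2 W x (\<lambda>q. g q (lift2 U q) (lift2 V q)) =
        (f (fst x))\<^sup>2 * W (snd x) (\<lambda>q. g2 q (U q) (V q))"
proof -
  note T = P.vector_field_tangent[OF lift2_in[OF W]]
  show "lift2 W x (\<lambda>q. g q (lift1 Y q) (lift1 Z q)) = 0"
    if "Y \<in> M1.\<V>" "Z \<in> M1.\<V>"
    using lift2_fst[OF W, of x "\<lambda>p. g1 p (Y p) (Z p)"] that by (simp add: metric_lifts)
  show "lift2 W x (\<lambda>q. g q (lift1 Y q) (lift2 V q)) = 0" "lift2 W x (\<lambda>q. g q (lift2 V q) (lift1 Y q)) = 0"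
    if "Y \<in> M1.\<V>" "V \<in> M2.\<V>"
    using that by (simp_all add: metric_lifts P.tangent_const[OF T])
  show "lift2 W x (\<lambda>q. g q (lift2 U q) (lift2 V q)) = (f (fst x))\<^sup>2 * W (snd x) (\<lambda>q. g2 q (U q) (V q))"
    if UV: "U \<in> M2.\<V>" "V \<in> M2.\<V>"
    using P.tangent_derivation(2)[OF T smooth_fun_fst[OF M1.smooth_fun_power[OF f_smooth]]
        smooth_fun_snd[OF L2.metric_smooth[OF UV]], of x 2]
      lift2_fst[OF W, of x "\<lambda>p. (f p)\<^sup>2"] lift2_snd[OF W, of x "\<lambda>q. g2 q (U q) (V q)"] UV
    by (simp add: metric_lifts)
qed

section \<open>Brackets and the warped connection on lifts\<close>

lemma bracket_lift11:
  assumes "X \<in> M1.\<V>" "Y \<in> M1.\<V>"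
  shows "lie_bracket A (lift1 X) (lift1 Y) = lift1 (lie_bracket A1 X Y)"
proof
  fix x
  show "lie_bracket A (lift1 X) (lift1 Y) x = lift1 (lie_bracket A1 X Y) x"
  proof (rule tangent_product_eqI[where x=x])
    show "push_forward fst (lie_bracket A (lift1 X) (lift1 Y) x) = push_forward fst (lift1 (lie_bracket A1 X Y) x)"
      using lift1_fst[OF assms(1), of x "\<lambda>p. Y p h" for h] lift1_fst[OF assms(2), of x "\<lambda>p. X p h" for h] assms L1.bracket_in
      by (intro ext) (simp add: lie_bracket_def smooth_fun_fst_iff)
    show "push_forward snd (lie_bracket A (lift1 X) (lift1 Y) x) = push_forward snd (lift1 (lie_bracket A1 X Y) x)"
      using assms L1.bracket_in P.tangent_const[OF P.vector_field_tangent[OF lift1_in]]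
      by (intro ext) (simp add: lie_bracket_def)
  qed (intro P.vector_field_tangent[where p=x] LP.bracket_in lift1_in L1.bracket_in assms)+
qed

lemma bracket_lift22:
  assumes "X \<in> M2.\<V>" "Y \<in> M2.\<V>"
  shows "lie_bracket A (lift2 X) (lift2 Y) = lift2 (lie_bracket A2 X Y)"
proof
  fix x
  show "lie_bracket A (lift2 X) (lift2 Y) x = lift2 (lie_bracket A2 X Y) x"
  proof (rule tangent_product_eqI[where x=x])
    show "push_forward snd (lie_bracket A (lift2 X) (lift2 Y) x) = push_forward snd (lift2 (lie_bracket A2 X Y) x)"
      using lift2_snd[OF assms(1), of x "\<lambda>p. Y p h" for h] lift2_snd[OF assms(2), of x "\<lambda>p. X p h" for h] assms L2.bracket_in
      by (intro ext) (simp add: lie_bracket_def smooth_fun_snd_iff)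
    show "push_forward fst (lie_bracket A (lift2 X) (lift2 Y) x) = push_forward fst (lift2 (lie_bracket A2 X Y) x)"
      using assms L2.bracket_in P.tangent_const[OF P.vector_field_tangent[OF lift2_in]]
      by (intro ext) (simp add: lie_bracket_def)
  qed (intro P.vector_field_tangent[where p=x] LP.bracket_in lift2_in L2.bracket_in assms)+
qed

lemma bracket_lift12:
  assumes "X \<in> M1.\<V>" "Y \<in> M2.\<V>"
  shows "lie_bracket A (lift1 X) (lift2 Y) = (\<lambda>x h. 0)"
proof
  fix x
  note T = P.tangent_const[OF P.vector_field_tangent[OF lift1_in[OF assms(1)]]]
    P.tangent_const[OF P.vector_field_tangent[OF lift2_in[OF assms(2)]]]
  show "lie_bracket A (lift1 X) (lift2 Y) x = (\<lambda>h. 0)"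
  proof (rule tangent_product_eqI[where x=x])
    show "push_forward fst (lie_bracket A (lift1 X) (lift2 Y) x) = push_forward fst (\<lambda>h. 0)"
      using lift2_fst[OF assms(2), of x "\<lambda>p. X p h" for h] assms T
      by (intro ext) (simp add: lie_bracket_def)
    show "push_forward snd (lie_bracket A (lift1 X) (lift2 Y) x) = push_forward snd (\<lambda>h. 0)"
      using lift1_snd[OF assms(1), of x "\<lambda>p. Y p h" for h] assms T
      by (intro ext) (simp add: lie_bracket_def)
  qed (intro P.tangent_zero P.vector_field_tangent[where p=x] LP.bracket_in lift1_in lift2_in assms)+
qed

lemma bracket_lift21:
  assumes "X \<in> M1.\<V>" "Y \<in> M2.\<V>"
  shows "lie_bracket A (lift2 Y) (lift1 X) = (\<lambda>x h. 0)"
  using LP.bracket_antisym[OF lift2_in[OF assms(2)] lift1_in[OF assms(1)]] bracket_lift12[OF assms]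
  by (simp add: vscale_def)

text \<open>As congruence rules these two keep the simplifier from rewriting the differentiated function
  before a rule for the whole derivative applies.\<close>

lemma lift_weak_cong: "lift1 X x h = lift1 X x h" "lift2 Y x h = lift2 Y x h"
  by (rule refl)+

lemmas koszul_lift_simps = metric_lifts metric_zero_lifts derivative_metric_lift1 derivative_metric_lift2
  bracket_lift11 bracket_lift12 bracket_lift21 bracket_lift22 L1.bracket_in L2.bracket_in

lemma connection_tangent:
  "X \<in> P.\<V> \<Longrightarrow> Y \<in> P.\<V> \<Longrightarrow> D X Y x \<in> tangent_space A x"
  by (intro P.vector_field_tangent[where p=x] LP.D_in)

text \<open>Geometrically, the slices over a fixed point of M2 are totally geodesic: the Koszul
  formula leaves no M2 component.\<close>

lemma connection_lift11:
  assumes X: "X \<in> M1.\<V>" and Y: "Y \<in> M1.\<V>"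
  shows "D (lift1 X) (lift1 Y) = lift1 (D1 X Y)"
proof
  fix x
  show "D (lift1 X) (lift1 Y) x = lift1 (D1 X Y) x"
  proof (rule tangent_metric_eqI[where x=x])
    fix Z assume Z: "Z \<in> M1.\<V>"
    show "g x (D (lift1 X) (lift1 Y) x) (lift1 Z x) = g x (lift1 (D1 X Y) x) (lift1 Z x)"
      using LP.koszul[OF lift1_in[OF X] lift1_in[OF Y] lift1_in[OF Z], of x] L1.koszul[OF X Y Z, of "fst x"] X Y Z
      by (simp add: koszul_lift_simps L1.D_in cong: lift_weak_cong)
  next
    fix W assume W: "W \<in> M2.\<V>"
    show "g x (D (lift1 X) (lift1 Y) x) (lift2 W x) = g x (lift1 (D1 X Y) x) (lift2 W x)"
      using LP.koszul[OF lift1_in[OF X] lift1_in[OF Y] lift2_in[OF W], of x] X Y W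
      by (simp add: koszul_lift_simps L1.D_in cong: lift_weak_cong)
  qed (intro P.vector_field_tangent[where p=x] LP.D_in lift1_in L1.D_in X Y)+
qed

definition dlog :: "'a vfield \<Rightarrow> 'a \<Rightarrow> real" where
  "dlog X p = X p f / f p"

lemma dlog_smooth: "X \<in> M1.\<V> \<Longrightarrow> smooth_fun A1 (dlog X)"
  unfolding dlog_def[abs_def]
  by (rule M1.smooth_fun_divide[OF M1.vector_field_smooth[OF _ f_smooth] f_smooth]) auto

lemma derivative_dlog:
  assumes X: "X \<in> M1.\<V>" and Y: "Y \<in> M1.\<V>"
  shows "Y p (dlog X) = Y p (\<lambda>q. X q f) / f p - X p f * Y p f / (f p)\<^sup>2"
proof -
  note T = M1.vector_field_tangent[OF Y, of p]
  have "dlog X = (\<lambda>q. X q f * inverse (f q))" by (simp add: dlog_def divide_inverse fun_eq_iff)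
  then have "Y p (dlog X) = Y p (\<lambda>q. X q f * inverse (f q))" by simp
  also have "\<dots> = X p f * (- Y p f / (f p)\<^sup>2) + inverse (f p) * Y p (\<lambda>q. X q f)"
    using M1.tangent_derivation(2)[OF T M1.vector_field_smooth[OF X f_smooth] M1.smooth_fun_inverse[OF f_smooth]]
      M1.tangent_inverse[OF T f_smooth] by simp
  finally show ?thesis by (simp add: divide_inverse mult_ac)
qed

lemma lift_dlog:
  assumes "X \<in> M1.\<V>"
  shows "Y \<in> M1.\<V> \<Longrightarrow> lift1 Y x (\<lambda>y. dlog X (fst y)) = Y (fst x) (dlog X)"
    and "V \<in> M2.\<V> \<Longrightarrow> lift2 V x (\<lambda>y. dlog X (fst y)) = 0"
  by simp_all

lemma connection_lift12:
  assumes X: "X \<in> M1.\<V>" and V: "V \<in> M2.\<V>"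
  shows "D (lift1 X) (lift2 V) = vscale (\<lambda>x. dlog X (fst x)) (lift2 V)"
proof
  fix x
  note s = smooth_fun_fst[OF dlog_smooth[OF X]]
  show "D (lift1 X) (lift2 V) x = vscale (\<lambda>x. dlog X (fst x)) (lift2 V) x"
  proof (rule tangent_metric_eqI[where x=x])
    fix Z assume Z: "Z \<in> M1.\<V>"
    show "g x (D (lift1 X) (lift2 V) x) (lift1 Z x) = g x (vscale (\<lambda>x. dlog X (fst x)) (lift2 V) x) (lift1 Z x)"
      unfolding LP.metric_vscale(1)[OF lift2_in[OF V] s P.vector_field_tangent[OF lift1_in[OF Z]]]
      using LP.koszul[OF lift1_in[OF X] lift2_in[OF V] lift1_in[OF Z], of x] X V Z
      by (simp add: koszul_lift_simps cong: lift_weak_cong)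
  next
    fix W assume W: "W \<in> M2.\<V>"
    show "g x (D (lift1 X) (lift2 V) x) (lift2 W x) = g x (vscale (\<lambda>x. dlog X (fst x)) (lift2 V) x) (lift2 W x)"
      unfolding LP.metric_vscale(1)[OF lift2_in[OF V] s P.vector_field_tangent[OF lift2_in[OF W]]]
      using LP.koszul[OF lift1_in[OF X] lift2_in[OF V] lift2_in[OF W], of x] X V W
      by (simp add: koszul_lift_simps dlog_def power2_eq_square cong: lift_weak_cong)
  qed (intro P.vector_field_tangent[where p=x] LP.D_in P.vscale_in lift1_in lift2_in s X V)+
qed

lemma connection_lift21:
  assumes X: "X \<in> M1.\<V>" and V: "V \<in> M2.\<V>"
  shows "D (lift2 V) (lift1 X) = vscale (\<lambda>x. dlog X (fst x)) (lift2 V)"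
  using LP.torsion_free[OF lift2_in[OF V] lift1_in[OF X]] bracket_lift21[OF X V] connection_lift12[OF X V]
  by (intro vfield_eqI) simp

text \<open>Stated through pairings because the gradient is not yet known to be a smooth field; the
  first pairing is what will produce it.\<close>

lemma connection_lift22_metric:
  assumes U: "U \<in> M2.\<V>" and V: "V \<in> M2.\<V>"
  shows "Z \<in> M1.\<V> \<Longrightarrow> g x (D (lift2 U) (lift2 V) x) (lift1 Z x) =
      - f (fst x) * Z (fst x) f * g2 (snd x) (U (snd x)) (V (snd x))"
    and "W \<in> M2.\<V> \<Longrightarrow> g x (D (lift2 U) (lift2 V) x) (lift2 W x) =
      (f (fst x))\<^sup>2 * g2 (snd x) (D2 U V (snd x)) (W (snd x))"
proof -
  show "g x (D (lift2 U) (lift2 V) x) (lift1 Z x) = - f (fst x) * Z (fst x) f * g2 (snd x) (U (snd x)) (V (snd x))"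
    if Z: "Z \<in> M1.\<V>"
    using LP.koszul[OF lift2_in[OF U] lift2_in[OF V] lift1_in[OF Z], of x] U V Z
    by (simp add: koszul_lift_simps cong: lift_weak_cong)
  show "g x (D (lift2 U) (lift2 V) x) (lift2 W x) = (f (fst x))\<^sup>2 * g2 (snd x) (D2 U V (snd x)) (W (snd x))"
    if W: "W \<in> M2.\<V>"
  proof -
    have "2 * g x (D (lift2 U) (lift2 V) x) (lift2 W x) = (f (fst x))\<^sup>2 * (2 * g2 (snd x) (D2 U V (snd x)) (W (snd x)))"
      unfolding LP.koszul[OF lift2_in[OF U] lift2_in[OF V] lift2_in[OF W], of x] L2.koszul[OF U V W, of "snd x"]
      using U V W by (simp add: koszul_lift_simps algebra_simps cong: lift_weak_cong)
    then show ?thesis by simp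
  qed
qed

section \<open>Gradient, Hessian and the connection along the fibres\<close>

abbreviation G :: "'a vfield" where "G \<equiv> gradient A1 g1 f"

text \<open>The gradient is a smooth field because the warped connection itself produces it:
  \<open>D (lift2 U) (lift2 V)\<close> has the first component \<open>- f g2(U,V) grad f\<close>.\<close>

lemma gradient_aux:
  obtains H where "H \<in> M1.\<V>" "\<And>p w. w \<in> tangent_space A1 p \<Longrightarrow> g1 p (H p) w = w f"
proof -
  fix q :: 'b
  obtain U V where U: "U \<in> M2.\<V>" and V: "V \<in> M2.\<V>" and ne: "g2 q (U q) (V q) \<noteq> 0"
    by (rule L2.obtain_nonorthogonal)
  define c where "c = g2 q (U q) (V q)"
  define W where "W = (\<lambda>p. push_forward fst (D (lift2 U) (lift2 V) (p, q)))"
  note DT = connection_tangent[OF lift2_in[OF U] lift2_in[OF V]]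
  have W: "W \<in> M1.\<V>"
    unfolding W_def by (rule slice_in[OF LP.D_in[OF lift2_in[OF U] lift2_in[OF V]]])
  have WZ: "g1 p (W p) (Z p) = - f p * Z p f * c" if "Z \<in> M1.\<V>" for p Z
    using metric_lift1[OF DT[of "(p, q)"] that] connection_lift22_metric(1)[OF U V that, of "(p, q)"]
    by (simp add: W_def c_def)
  \<comment> \<open>By \<open>WZ\<close>, \<open>W\<close> represents the differential of
    \<open>f\<close> up to the factor \<open>- c * f p\<close>; this coefficient removes it, and
    \<open>ne\<close> makes it well defined.\<close>
  have s: "smooth_fun A1 (\<lambda>p. - inverse (c * f p))"
    using ne M1.smooth_fun_minus[OF M1.smooth_fun_inverse[OF M1.smooth_fun_mult[OF M1.smooth_fun_const[of c] f_smooth]]]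
    by (simp add: c_def)
  show ?thesis
  proof (rule that[OF M1.vscale_in[OF s W]])
    fix p w assume w: "w \<in> tangent_space A1 p"
    then obtain Z where Z: "Z \<in> M1.\<V>" "Z p = w" by (rule M1.tangent_extend)
    show "g1 p (vscale (\<lambda>p. - inverse (c * f p)) W p) w = w f"
      unfolding L1.metric_vscale(1)[OF W s w] using WZ[OF Z(1), of p] ne by (simp add: Z(2) c_def field_simps)
  qed
qed

lemma gradient: "G \<in> M1.\<V>" "w \<in> tangent_space A1 p \<Longrightarrow> g1 p (G p) w = w f"
proof -
  obtain H where H: "H \<in> M1.\<V>" "\<And>p w. w \<in> tangent_space A1 p \<Longrightarrow> g1 p (H p) w = w f"
    using gradient_aux by blast
  have "G p = H p" for p
    unfolding gradient_def
  proof (rule the_equality)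
    show "H p \<in> tangent_space A1 p \<and> (\<forall>w\<in>tangent_space A1 p. g1 p (H p) w = w f)"
      using H M1.vector_field_tangent by blast
    fix v assume v: "v \<in> tangent_space A1 p \<and> (\<forall>w\<in>tangent_space A1 p. g1 p v w = w f)"
    then show "v = H p"
      by (intro L1.metric_eqI) (use H M1.vector_field_tangent in auto)
  qed
  then have "G = H" by blast
  then show "G \<in> M1.\<V>" "w \<in> tangent_space A1 p \<Longrightarrow> g1 p (G p) w = w f" using H by auto
qed

lemma metric_gradient: "X \<in> M1.\<V> \<Longrightarrow> g1 p (G p) (X p) = X p f"
  by (rule gradient(2)[OF M1.vector_field_tangent])

lemma hessian_eq:
  assumes X: "X \<in> M1.\<V>" and Y: "Y \<in> M1.\<V>"
  shows "hessian A1 g1 D1 f X Y p = X p (\<lambda>q. Y q f) - D1 X Y p f"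
  using L1.metric_compatible[OF X gradient(1) Y, of p]
  by (simp add: hessian_def metric_gradient Y L1.D_in[OF X Y])

text \<open>Times the lifted gradient, this is the second fundamental form of the copies of M2 in
  the product, that is, the coefficient equals minus the warped metric of the lifts divided by
  \<open>f\<close>.\<close>

definition warp :: "'b vfield \<Rightarrow> 'b vfield \<Rightarrow> 'a \<times> 'b \<Rightarrow> real" where
  "warp U V x = - f (fst x) * g2 (snd x) (U (snd x)) (V (snd x))"

lemma warp_smooth: "U \<in> M2.\<V> \<Longrightarrow> V \<in> M2.\<V> \<Longrightarrow> smooth_fun A (warp U V)"
  unfolding warp_def[abs_def]
  by (rule P.smooth_fun_mult[OF P.smooth_fun_minus[OF smooth_fun_fst[OF f_smooth]] smooth_fun_snd[OF L2.metric_smooth]])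

lemma derivative_warp:
  assumes U: "U \<in> M2.\<V>" and V: "V \<in> M2.\<V>"
  shows "X \<in> M1.\<V> \<Longrightarrow> lift1 X x (warp U V) = - X (fst x) f * g2 (snd x) (U (snd x)) (V (snd x))"
    and "W \<in> M2.\<V> \<Longrightarrow> lift2 W x (warp U V) = - f (fst x) * W (snd x) (\<lambda>q. g2 q (U q) (V q))"
proof -
  have w: "warp U V = (\<lambda>x. - f (fst x) * g2 (snd x) (U (snd x)) (V (snd x)))"
    by (simp add: warp_def fun_eq_iff)
  have d: "v (warp U V) = - f (fst x) * v (\<lambda>x. g2 (snd x) (U (snd x)) (V (snd x)))
      - g2 (snd x) (U (snd x)) (V (snd x)) * v (\<lambda>x. f (fst x))" if T: "v \<in> tangent_space A x" for v
    unfolding w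
    using P.tangent_derivation(2)[OF T P.smooth_fun_minus[OF smooth_fun_fst[OF f_smooth]] smooth_fun_snd[OF L2.metric_smooth[OF U V]]]
      P.tangent_minus[OF T smooth_fun_fst[OF f_smooth]] by simp
  show "lift1 X x (warp U V) = - X (fst x) f * g2 (snd x) (U (snd x)) (V (snd x))" if X: "X \<in> M1.\<V>"
    unfolding d[OF P.vector_field_tangent[OF lift1_in[OF X]]]
    using lift1_snd[OF X, of x "\<lambda>q. g2 q (U q) (V q)"] X by simp
  show "lift2 W x (warp U V) = - f (fst x) * W (snd x) (\<lambda>q. g2 q (U q) (V q))" if W: "W \<in> M2.\<V>"
    unfolding d[OF P.vector_field_tangent[OF lift2_in[OF W]]]
    using lift2_snd[OF W, of x "\<lambda>q. g2 q (U q) (V q)"] W by simp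
qed

lemma connection_lift22:
  assumes U: "U \<in> M2.\<V>" and V: "V \<in> M2.\<V>"
  shows "D (lift2 U) (lift2 V) = vadd (lift2 (D2 U V)) (vscale (warp U V) (lift1 G))"
proof
  fix x
  note s = warp_smooth[OF U V] and G = lift1_in[OF gradient(1)] and DUV = lift2_in[OF L2.D_in[OF U V]]
  note sG = P.vscale_in[OF s G]
  show "D (lift2 U) (lift2 V) x = vadd (lift2 (D2 U V)) (vscale (warp U V) (lift1 G)) x"
  proof (rule tangent_metric_eqI[where x=x])
    fix Z assume Z: "Z \<in> M1.\<V>"
    note T = P.vector_field_tangent[OF lift1_in[OF Z]]
    show "g x (D (lift2 U) (lift2 V) x) (lift1 Z x) =
        g x (vadd (lift2 (D2 U V)) (vscale (warp U V) (lift1 G)) x) (lift1 Z x)"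
      unfolding LP.metric_vadd(1)[OF DUV sG T] LP.metric_vscale(1)[OF G s T] connection_lift22_metric(1)[OF U V Z]
      using Z by (simp add: metric_lifts L2.D_in U V gradient(1) metric_gradient warp_def)
  next
    fix W assume W: "W \<in> M2.\<V>"
    note T = P.vector_field_tangent[OF lift2_in[OF W]]
    show "g x (D (lift2 U) (lift2 V) x) (lift2 W x) =
        g x (vadd (lift2 (D2 U V)) (vscale (warp U V) (lift1 G)) x) (lift2 W x)"
      unfolding LP.metric_vadd(1)[OF DUV sG T] LP.metric_vscale(1)[OF G s T] connection_lift22_metric(2)[OF U V W]
      using W by (simp add: metric_lifts L2.D_in U V gradient(1))
  qed (intro P.vector_field_tangent[where p=x] LP.D_in P.vadd_in DUV sG lift2_in U V)+
qed

section \<open>The curvature of the warped product on lifts\<close>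

lemmas connection_lifts = connection_lift11 connection_lift12 connection_lift21 connection_lift22
lemmas bracket_lifts = bracket_lift11 bracket_lift12 bracket_lift21 bracket_lift22
lemmas lift_smooth = smooth_fun_fst[OF dlog_smooth] warp_smooth

lemma zero_field_left: "Y \<in> P.\<V> \<Longrightarrow> D (\<lambda>x h. 0) Y = (\<lambda>x h. 0)"
  using LP.D_vscale_left[OF P.vzero_in, of Y "\<lambda>_. 0"] P.smooth_fun_const by (simp add: vscale_def)

lemma curvature_lift111:
  assumes "X \<in> M1.\<V>" "Y \<in> M1.\<V>" "Z \<in> M1.\<V>"
  shows "curvature_op A D (lift1 X) (lift1 Y) (lift1 Z) x h = lift1 (curvature_op A1 D1 X Y Z) x h"
  using assms
  by (simp add: curvature_op_def connection_lifts bracket_lifts L1.D_in L1.bracket_in) (simp add: lift1_def)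

text \<open>Covariant differentiation along M1 only rescales a lift from M2, by the differential of
  log \<open>f\<close>. That form is closed, so its antisymmetrised derivative cancels against the
  bracket term.\<close>

lemma curvature_lift112:
  assumes X: "X \<in> M1.\<V>" and Y: "Y \<in> M1.\<V>" and U: "U \<in> M2.\<V>"
  shows "curvature_op A D (lift1 X) (lift1 Y) (lift2 U) x h = 0"
proof -
  have "X (fst x) (\<lambda>p. Y p f) = lie_bracket A1 X Y (fst x) f + Y (fst x) (\<lambda>p. X p f)"
    using f_smooth by (simp add: lie_bracket_def)
  then show ?thesis
    by (simp add: curvature_op_def connection_lifts bracket_lifts L1.bracket_in LP.D_vscale_right lift_smooth
        lift1_in lift2_in lift_dlog derivative_dlog X Y U)
      (simp add: dlog_def diff_divide_distrib add_divide_distrib algebra_simps)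
qed

text \<open>The product \<open>dlog X * dlog Y\<close> cancels the quadratic part of the derivative
  of \<open>dlog Y\<close>. What is left is the Hessian in the form of \<open>hessian_eq\<close>,
  divided by \<open>f\<close>.\<close>

lemma curvature_lift121:
  assumes X: "X \<in> M1.\<V>" and U: "U \<in> M2.\<V>" and Y: "Y \<in> M1.\<V>"
  shows "curvature_op A D (lift1 X) (lift2 U) (lift1 Y) x h =
    - hessian A1 g1 D1 f X Y (fst x) / f (fst x) * lift2 U x h"
  by (simp add: curvature_op_def connection_lifts bracket_lifts zero_field_left L1.D_in LP.D_vscale_right lift_smooth
      lift1_in lift2_in lift_dlog derivative_dlog X Y U)
    (simp add: dlog_def hessian_eq X Y diff_divide_distrib power2_eq_square algebra_simps)

text \<open>The components along M2 cancel. Moreover \<open>dlog X * warp U V\<close> equals the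
  derivative of \<open>warp U V\<close> along the lift of \<open>X\<close>, so only the derivative
  of the gradient itself survives.\<close>

lemma curvature_lift122:
  assumes X: "X \<in> M1.\<V>" and U: "U \<in> M2.\<V>" and V: "V \<in> M2.\<V>"
  shows "curvature_op A D (lift1 X) (lift2 U) (lift2 V) x h =
    f (fst x) * g2 (snd x) (U (snd x)) (V (snd x)) * lift1 (D1 X G) x h"
  by (simp add: curvature_op_def connection_lifts bracket_lifts zero_field_left L1.D_in L2.D_in LP.D_vscale_right LP.D_vadd_right
      lift_smooth P.vscale_in gradient(1)
      lift1_in lift2_in lift_dlog derivative_warp X V U)
    (simp add: dlog_def warp_def algebra_simps)

text \<open>\<open>dlog X\<close> is constant along M2, so the curvature is this factor times the
  torsion of \<open>D\<close> on the two lifts from M2.\<close>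

lemma curvature_lift221:
  assumes X: "X \<in> M1.\<V>" and U: "U \<in> M2.\<V>" and V: "V \<in> M2.\<V>"
  shows "curvature_op A D (lift2 U) (lift2 V) (lift1 X) x h = 0"
proof -
  have "D (lift2 U) (lift2 V) x h - D (lift2 V) (lift2 U) x h = lift2 (lie_bracket A2 U V) x h"
    using LP.torsion_free[OF lift2_in[OF U] lift2_in[OF V]] bracket_lift22[OF U V] by simp
  then show ?thesis
    by (simp add: curvature_op_def connection_lift21 bracket_lift22 L2.bracket_in LP.D_vscale_right lift_smooth
        lift1_in lift2_in lift_dlog X V U flip: right_diff_distrib distrib_left)
qed

text \<open>The Gauss equation for the copies of M2. They are umbilic, so the second fundamental
  form contributes a term of constant-curvature shape, with the squared norm of the gradient as
  coefficient.\<close>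

lemma curvature_lift222:
  assumes U: "U \<in> M2.\<V>" and V: "V \<in> M2.\<V>" and W: "W \<in> M2.\<V>"
  shows "curvature_op A D (lift2 U) (lift2 V) (lift2 W) x h =
    lift2 (curvature_op A2 D2 U V W) x h - g1 (fst x) (G (fst x)) (G (fst x)) *
      (g2 (snd x) (U (snd x)) (W (snd x)) * lift2 V x h - g2 (snd x) (V (snd x)) (W (snd x)) * lift2 U x h)"
proof -
  let ?q = "snd x"
  note t = M2.vector_field_tangent[where p="?q"]
  have GG: "dlog G (fst x) * f (fst x) = g1 (fst x) (G (fst x)) (G (fst x))"
    by (simp add: dlog_def metric_gradient gradient(1))
  have R2: "lift2 (curvature_op A2 D2 U V W) x h = lift2 (D2 V (D2 U W)) x h - lift2 (D2 U (D2 V W)) x h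
      + lift2 (D2 (lie_bracket A2 U V) W) x h"
    by (simp add: lift2_def curvature_op_def)
  have b: "g2 ?q (lie_bracket A2 U V ?q) (W ?q) = g2 ?q (D2 U V ?q) (W ?q) - g2 ?q (D2 V U ?q) (W ?q)"
    unfolding L2.bracket_eq[OF U V] by (rule L2.metric_diff[OF t t t]) (intro L2.D_in U V W)+
  \<comment> \<open>The Codazzi part, along the gradient: it vanishes because \<open>D2\<close> is
    compatible with \<open>g2\<close> and torsion-free.\<close>
  have z: "warp V (D2 U W) x + lift2 V x (warp U W) - warp U (D2 V W) x - lift2 U x (warp V W)
      + warp (lie_bracket A2 U V) W x = 0"
    by (simp add: derivative_warp U V W warp_def L2.metric_compatible b algebra_simps)
  have "curvature_op A D (lift2 U) (lift2 V) (lift2 W) x h =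
    lift2 (curvature_op A2 D2 U V W) x h
    + (warp V (D2 U W) x + lift2 V x (warp U W) - warp U (D2 V W) x - lift2 U x (warp V W)
      + warp (lie_bracket A2 U V) W x) * lift1 G x h
    + dlog G (fst x) * (warp U W x * lift2 V x h - warp V W x * lift2 U x h)"
    unfolding R2
    by (simp add: curvature_op_def connection_lift22 connection_lift21 bracket_lift22 L2.bracket_in LP.D_vscale_right LP.D_vadd_right
        lift_smooth P.vscale_in gradient(1) L2.D_in lift1_in lift2_in U V W algebra_simps)
  also have "\<dots> = lift2 (curvature_op A2 D2 U V W) x h - (dlog G (fst x) * f (fst x)) *
      (g2 ?q (U ?q) (W ?q) * lift2 V x h - g2 ?q (V ?q) (W ?q) * lift2 U x h)"
    unfolding z by (simp add: warp_def algebra_simps)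
  finally show ?thesis unfolding GG .
qed

text \<open>Antisymmetry reduces the eight combinations of lifts to six. The three arguments are
  then freed from being lifts one at a time, the last slot first, since the vanishing criterion
  treats a single slot.\<close>

lemma curvature_defect_lifts:
  assumes L: "\<And>X Y Z. X \<in> M1.\<V> \<Longrightarrow> Y \<in> M1.\<V> \<Longrightarrow> Z \<in> M1.\<V> \<Longrightarrow> LP.curvature_defect k (lift1 X) (lift1 Y) (lift1 Z) x h = 0"
    "\<And>X Y U. X \<in> M1.\<V> \<Longrightarrow> Y \<in> M1.\<V> \<Longrightarrow> U \<in> M2.\<V> \<Longrightarrow> LP.curvature_defect k (lift1 X) (lift1 Y) (lift2 U) x h = 0"
    "\<And>X U Y. X \<in> M1.\<V> \<Longrightarrow> U \<in> M2.\<V> \<Longrightarrow> Y \<in> M1.\<V> \<Longrightarrow> LP.curvature_defect k (lift1 X) (lift2 U) (lift1 Y) x h = 0"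
    "\<And>X U V. X \<in> M1.\<V> \<Longrightarrow> U \<in> M2.\<V> \<Longrightarrow> V \<in> M2.\<V> \<Longrightarrow> LP.curvature_defect k (lift1 X) (lift2 U) (lift2 V) x h = 0"
    "\<And>U V X. U \<in> M2.\<V> \<Longrightarrow> V \<in> M2.\<V> \<Longrightarrow> X \<in> M1.\<V> \<Longrightarrow> LP.curvature_defect k (lift2 U) (lift2 V) (lift1 X) x h = 0"
    "\<And>U V W. U \<in> M2.\<V> \<Longrightarrow> V \<in> M2.\<V> \<Longrightarrow> W \<in> M2.\<V> \<Longrightarrow> LP.curvature_defect k (lift2 U) (lift2 V) (lift2 W) x h = 0"
    and XYZ: "X \<in> P.\<V>" "Y \<in> P.\<V>" "Z \<in> P.\<V>"
  shows "LP.curvature_defect k X Y Z x h = 0"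
proof -
  let ?T = "\<lambda>X Y Z. LP.curvature_defect k X Y Z x h"
  define Lift where "Lift = lift1 ` M1.\<V> \<union> lift2 ` M2.\<V>"
  have Lift: "Lift \<subseteq> P.\<V>" using lift1_in lift2_in by (auto simp: Lift_def)
  have anti: "?T X Y Z = - ?T Y X Z" if "X \<in> Lift" "Y \<in> Lift" "Z \<in> Lift" for X Y Z
    using LP.curvature_defect_antisym that Lift by blast
  have 0: "?T X Y Z = 0" if Lifts: "X \<in> Lift" "Y \<in> Lift" "Z \<in> Lift" for X Y Z
  proof -
    consider "X \<in> lift1 ` M1.\<V>" | "Y \<in> lift1 ` M1.\<V>" | "X \<in> lift2 ` M2.\<V>" "Y \<in> lift2 ` M2.\<V>"
      using Lifts by (auto simp: Lift_def)
    then show ?thesis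
    proof cases
      case 1
      then show ?thesis using Lifts L(1-4) by (auto simp: Lift_def)
    next
      case 2
      then show ?thesis using anti[OF Lifts] Lifts L(1-4) by (auto simp: Lift_def)
    next
      case 3
      then show ?thesis using Lifts L(5,6) by (auto simp: Lift_def)
    qed
  qed
  have 1: "?T X Y Z = 0" if Z: "Z \<in> P.\<V>" and XY: "X \<in> Lift" "Y \<in> Lift" for X Y Z
  proof (rule function_linear_vanishes_lifts[where L="?T X Y" and x=x])
    have "X \<in> P.\<V>" "Y \<in> P.\<V>" using XY Lift by auto
    then show "?T X Y (vadd Z Z') = ?T X Y Z + ?T X Y Z'" "smooth_fun A a \<Longrightarrow> ?T X Y (vscale a Z) = a x * ?T X Y Z"
      if "Z \<in> P.\<V>" "Z' \<in> P.\<V>" for Z Z' a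
      using LP.curvature_defect_3 that by blast+
  qed (use 0 XY Z in \<open>auto simp: Lift_def\<close>)
  have 2: "?T X Y Z = 0" if Y: "Y \<in> P.\<V>" and X: "X \<in> Lift" and Z: "Z \<in> P.\<V>" for X Y Z
  proof (rule function_linear_vanishes_lifts[where L="\<lambda>Y. ?T X Y Z" and x=x])
    have "X \<in> P.\<V>" using X Lift by auto
    then show "?T X (vadd Y Y') Z = ?T X Y Z + ?T X Y' Z" "smooth_fun A a \<Longrightarrow> ?T X (vscale a Y) Z = a x * ?T X Y Z"
      if "Y \<in> P.\<V>" "Y' \<in> P.\<V>" for Y Y' a
      using LP.curvature_defect_2 that Z by blast+
  qed (use 1 X Y Z in \<open>auto simp: Lift_def\<close>)
  show ?thesis
  proof (rule function_linear_vanishes_lifts[where L="\<lambda>X. ?T X Y Z" and x=x])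
    show "?T (vadd X X') Y Z = ?T X Y Z + ?T X' Y Z" "smooth_fun A a \<Longrightarrow> ?T (vscale a X) Y Z = a x * ?T X Y Z"
      if "X \<in> P.\<V>" "X' \<in> P.\<V>" for X X' a
      using LP.curvature_defect_1 that XYZ by blast+
  qed (use 2 XYZ in \<open>auto simp: Lift_def\<close>)
qed

text \<open>Nondegeneracy of \<open>g1\<close> strips the second argument off the Hessian equation.
  The component with one lift from M1 and two from M2 needs it in this vector form.\<close>

lemma connection_gradient:
  assumes H: "\<And>X Y p. X \<in> M1.\<V> \<Longrightarrow> Y \<in> M1.\<V> \<Longrightarrow> 1 / f p * hessian A1 g1 D1 f X Y p + \<kappa> * g1 p (X p) (Y p) = 0"
    and X: "X \<in> M1.\<V>"
  shows "D1 X G = vscale (\<lambda>p. - \<kappa> * f p) X"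
proof
  fix p
  have s: "smooth_fun A1 (\<lambda>p. - \<kappa> * f p)"
    by (rule M1.smooth_fun_mult[OF M1.smooth_fun_const f_smooth])
  show "D1 X G p = vscale (\<lambda>p. - \<kappa> * f p) X p"
  proof (rule L1.metric_eqI)
    show "D1 X G p \<in> tangent_space A1 p" "vscale (\<lambda>p. - \<kappa> * f p) X p \<in> tangent_space A1 p"
      by (rule M1.vector_field_tangent[OF L1.D_in[OF X gradient(1)]]
          M1.vector_field_tangent[OF M1.vscale_in[OF s X]])+
    fix Z assume Z: "Z \<in> M1.\<V>"
    have "hessian A1 g1 D1 f X Z p = - \<kappa> * f p * g1 p (X p) (Z p)"
      using H[OF X Z, of p] by (simp add: field_simps)
    then show "g1 p (D1 X G p) (Z p) = g1 p (vscale (\<lambda>p. - \<kappa> * f p) X p) (Z p)"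
      unfolding L1.metric_vscale(1)[OF X s M1.vector_field_tangent[OF Z]] hessian_def .
  qed
qed

text \<open>\<open>c1\<close> settles the component within M1, \<open>c2\<close> with
  \<open>k2\<close> the one within M2, and \<open>H\<close> the two mixed ones. In the remaining
  cases curvature and metric terms vanish separately.\<close>

lemma curvature_defect_zero:
  assumes c1: "constant_curvature A1 g1 D1 \<kappa>" and c2: "constant_curvature A2 g2 D2 \<kappa>2"
    and H: "\<And>X Y p. X \<in> M1.\<V> \<Longrightarrow> Y \<in> M1.\<V> \<Longrightarrow> 1 / f p * hessian A1 g1 D1 f X Y p + \<kappa> * g1 p (X p) (Y p) = 0"
    and k2: "\<And>p. \<kappa>2 = \<kappa> * (f p)\<^sup>2 + g1 p (G p) (G p)"
    and XYZ: "X \<in> P.\<V>" "Y \<in> P.\<V>" "Z \<in> P.\<V>"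
  shows "LP.curvature_defect \<kappa> X Y Z x h = 0"
proof (rule curvature_defect_lifts[OF _ _ _ _ _ _ XYZ])
  fix X Y Z assume XYZ: "X \<in> M1.\<V>" "Y \<in> M1.\<V>" "Z \<in> M1.\<V>"
  have "lift1 (curvature_op A1 D1 X Y Z) x h =
      \<kappa> * (g1 (fst x) (X (fst x)) (Z (fst x)) * lift1 Y x h - g1 (fst x) (Y (fst x)) (Z (fst x)) * lift1 X x h)"
    using c1 XYZ by (simp add: lift1_def constant_curvature_def)
  then show "LP.curvature_defect \<kappa> (lift1 X) (lift1 Y) (lift1 Z) x h = 0"
    using XYZ by (simp add: LP.curvature_defect_def curvature_lift111 metric_lifts)
next
  fix X Y U assume XYZ: "X \<in> M1.\<V>" "Y \<in> M1.\<V>" "U \<in> M2.\<V>"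
  then show "LP.curvature_defect \<kappa> (lift1 X) (lift1 Y) (lift2 U) x h = 0"
    by (simp add: LP.curvature_defect_def curvature_lift112 metric_lifts)
next
  fix X U Y assume XYZ: "X \<in> M1.\<V>" "U \<in> M2.\<V>" "Y \<in> M1.\<V>"
  have "hessian A1 g1 D1 f X Y (fst x) / f (fst x) = - \<kappa> * g1 (fst x) (X (fst x)) (Y (fst x))"
    using H[OF XYZ(1,3), of "fst x"] by (simp add: field_simps)
  then show "LP.curvature_defect \<kappa> (lift1 X) (lift2 U) (lift1 Y) x h = 0"
    using XYZ by (simp add: LP.curvature_defect_def curvature_lift121 metric_lifts)
next
  fix X U V assume XYZ: "X \<in> M1.\<V>" "U \<in> M2.\<V>" "V \<in> M2.\<V>"
  have "lift1 (D1 X G) x h = - \<kappa> * f (fst x) * lift1 X x h"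
    by (simp add: connection_gradient[OF H XYZ(1)] lift1_def)
  then show "LP.curvature_defect \<kappa> (lift1 X) (lift2 U) (lift2 V) x h = 0"
    using XYZ by (simp add: LP.curvature_defect_def curvature_lift122 metric_lifts power2_eq_square)
next
  fix U V X assume XYZ: "U \<in> M2.\<V>" "V \<in> M2.\<V>" "X \<in> M1.\<V>"
  then show "LP.curvature_defect \<kappa> (lift2 U) (lift2 V) (lift1 X) x h = 0"
    by (simp add: LP.curvature_defect_def curvature_lift221 metric_lifts)
next
  fix U V W assume XYZ: "U \<in> M2.\<V>" "V \<in> M2.\<V>" "W \<in> M2.\<V>"
  have "lift2 (curvature_op A2 D2 U V W) x h =
      \<kappa>2 * (g2 (snd x) (U (snd x)) (W (snd x)) * lift2 V x h - g2 (snd x) (V (snd x)) (W (snd x)) * lift2 U x h)"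
    using c2 XYZ by (simp add: lift2_def constant_curvature_def)
  then show "LP.curvature_defect \<kappa> (lift2 U) (lift2 V) (lift2 W) x h = 0"
    using XYZ by (simp add: LP.curvature_defect_def curvature_lift222 metric_lifts k2[of "fst x"] algebra_simps)
qed

lemma curvature_defect_zero_imp:
  assumes conn: "connected (UNIV :: 'a set)" and dim: "DIM('f) \<ge> 2"
    and zero: "\<And>X Y Z x h. X \<in> P.\<V> \<Longrightarrow> Y \<in> P.\<V> \<Longrightarrow> Z \<in> P.\<V> \<Longrightarrow> LP.curvature_defect (k x) X Y Z x h = 0"
  obtains \<kappa> \<kappa>2 where "\<And>x. k x = \<kappa>" "constant_curvature A1 g1 D1 \<kappa>" "constant_curvature A2 g2 D2 \<kappa>2"
    "\<And>X Y p. X \<in> M1.\<V> \<Longrightarrow> Y \<in> M1.\<V> \<Longrightarrow> 1 / f p * hessian A1 g1 D1 f X Y p + \<kappa> * g1 p (X p) (Y p) = 0"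
    "\<And>p. \<kappa>2 = \<kappa> * (f p)\<^sup>2 + g1 p (G p) (G p)"
proof -
  fix p0 :: 'a and q0 :: 'b
  have hess: "hessian A1 g1 D1 f X Y p = - k (p, q) * f p * g1 p (X p) (Y p)"
    if X: "X \<in> M1.\<V>" and Y: "Y \<in> M1.\<V>" for X Y p q
  proof -
    obtain U V where U: "U \<in> M2.\<V>" and V: "V \<in> M2.\<V>" "g2 q (U q) (V q) \<noteq> 0"
      by (rule L2.obtain_nonorthogonal)
    then have "U q \<noteq> (\<lambda>h. 0)"
      using L2.metric_zero[OF M2.vector_field_tangent[OF V(1)]] by metis
    \<comment> \<open>A function on M2 not annihilated by \<open>U q\<close> turns the identity
      between multiples of the lift of \<open>U\<close> into a scalar one.\<close>
    then obtain c where "U q c \<noteq> 0" by blast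
    have "U q c * (hessian A1 g1 D1 f X Y p + k (p, q) * f p * g1 p (X p) (Y p)) = 0"
      using zero[OF lift1_in[OF X] lift2_in[OF U] lift1_in[OF Y], of "(p, q)" "\<lambda>x. c (snd x)"] X Y U
      by (simp add: LP.curvature_defect_def curvature_lift121 metric_lifts field_simps)
    then show ?thesis using \<open>U q c \<noteq> 0\<close> by simp
  qed
  \<comment> \<open>In \<open>hess\<close> the Hessian does not see the point of M2. Testing with a
    pair that is not orthogonal shows that neither does \<open>k\<close>, so any fixed
    \<open>q0\<close> represents it.\<close>
  define K where "K p = k (p, q0)" for p
  have K: "k (p, q) = K p" for p q
  proof -
    obtain X Y where XY: "X \<in> M1.\<V>" "Y \<in> M1.\<V>" "g1 p (X p) (Y p) \<noteq> 0"
      by (rule L1.obtain_nonorthogonal)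
    have "- k (p, q) * f p * g1 p (X p) (Y p) = - k (p, q0) * f p * g1 p (X p) (Y p)"
      unfolding hess[OF XY(1,2), of p q, symmetric] by (rule hess[OF XY(1,2)])
    then show ?thesis using XY(3) by (simp add: K_def)
  qed
  have curv2: "curvature_op A2 D2 U V W q h =
      (K p * (f p)\<^sup>2 + g1 p (G p) (G p)) * (g2 q (U q) (W q) * V q h - g2 q (V q) (W q) * U q h)"
    if UVW: "U \<in> M2.\<V>" "V \<in> M2.\<V>" "W \<in> M2.\<V>" for U V W p q h
    using zero[OF lift2_in[OF UVW(1)] lift2_in[OF UVW(2)] lift2_in[OF UVW(3)], of "(p, q)" "\<lambda>x. h (snd x)"]
      UVW L2.curvature_in[OF UVW]
    by (simp add: LP.curvature_defect_def curvature_lift222 metric_lifts K algebra_simps)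
  define \<kappa>2 where "\<kappa>2 = K p0 * (f p0)\<^sup>2 + g1 p0 (G p0) (G p0)"
  \<comment> \<open>By \<open>curv2\<close> the curvature of M2 at the single point
    \<open>q0\<close> is given by the constants for \<open>p\<close> and for \<open>p0\<close>
    alike, so these coincide.\<close>
  have \<kappa>2: "\<kappa>2 = K p * (f p)\<^sup>2 + g1 p (G p) (G p)" for p
    unfolding \<kappa>2_def
    by (rule L2.constant_curvature_unique[where p=q0, OF dim]) (metis curv2)
  have GG: "smooth_fun A1 (\<lambda>p. g1 p (G p) (G p))"
    by (rule L1.metric_smooth[OF gradient(1) gradient(1)])
  \<comment> \<open>\<open>k\<close> is an arbitrary function here, so smoothness of
    \<open>K\<close> has to be earned: solving the previous relation for it exhibits
    \<open>K\<close> as a quotient of smooth functions.\<close>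
  have "K = (\<lambda>p. (\<kappa>2 - g1 p (G p) (G p)) / (f p)\<^sup>2)"
  proof
    show "K p = (\<kappa>2 - g1 p (G p) (G p)) / (f p)\<^sup>2" for p
      unfolding \<kappa>2[of p] by simp
  qed
  then have K_smooth: "smooth_fun A1 K"
    using M1.smooth_fun_divide[OF M1.smooth_fun_diff[OF M1.smooth_fun_const[of \<kappa>2] GG] M1.smooth_fun_power[OF f_smooth]]
    by simp
  have "Y p K = 0" if Y: "Y \<in> M1.\<V>" for Y p
  proof -
    note T = M1.vector_field_tangent[OF Y, of p]
    have f2: "Y p (\<lambda>q. (f q)\<^sup>2) = 2 * f p * Y p f"
      using M1.tangent_derivation(2)[OF T f_smooth f_smooth] by (simp add: power2_eq_square)
    have "g1 p (G p) (D1 Y G p) = g1 p (D1 Y G p) (G p)"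
      by (rule L1.metric_sym[OF M1.vector_field_tangent[OF gradient(1)] M1.vector_field_tangent[OF L1.D_in[OF Y gradient(1)]]])
    then have "Y p (\<lambda>p. g1 p (G p) (G p)) = 2 * hessian A1 g1 D1 f Y G p"
      using L1.metric_compatible[OF Y gradient(1) gradient(1), of p] by (simp add: hessian_def)
    also have "\<dots> = - 2 * K p * f p * Y p f"
      using hess[OF Y gradient(1), of p q0] L1.metric_sym[OF T M1.vector_field_tangent[OF gradient(1)]]
      by (simp add: K metric_gradient[OF Y])
    finally have GG': "Y p (\<lambda>p. g1 p (G p) (G p)) = - 2 * K p * f p * Y p f" .
    have "0 = Y p (\<lambda>p. K p * (f p)\<^sup>2 + g1 p (G p) (G p))"
      using M1.tangent_const[OF T, of \<kappa>2] \<kappa>2 by simp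
    also have "\<dots> = Y p (\<lambda>p. K p * (f p)\<^sup>2) + Y p (\<lambda>p. g1 p (G p) (G p))"
      by (rule M1.tangent_derivation(1)[OF T M1.smooth_fun_mult[OF K_smooth M1.smooth_fun_power[OF f_smooth]] GG])
    \<comment> \<open>Differentiating \<open>f\<close> squared gives
      \<open>2 * K p * f p * Y p f\<close>, which \<open>GG'\<close> cancels; the derivative of
      \<open>K\<close> remains.\<close>
    also have "\<dots> = (f p)\<^sup>2 * Y p K"
      unfolding M1.tangent_derivation(2)[OF T K_smooth M1.smooth_fun_power[OF f_smooth]] f2 GG' by simp
    finally show ?thesis by simp
  qed
  then have K_const: "K p = K p0" for p
    by (rule M1.derivative_zero_imp_constant[OF conn K_smooth])
  show ?thesis
  proof (rule that[of "K p0" \<kappa>2])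
    show k: "k x = K p0" for x
      using K[of "fst x" "snd x"] K_const[of "fst x"] by simp
    show "constant_curvature A1 g1 D1 (K p0)"
      unfolding constant_curvature_def
    proof (intro ballI allI)
      fix X Y Z p h assume XYZ: "X \<in> M1.\<V>" "Y \<in> M1.\<V>" "Z \<in> M1.\<V>"
      show "curvature_op A1 D1 X Y Z p h = K p0 * (g1 p (X p) (Z p) * Y p h - g1 p (Y p) (Z p) * X p h)"
        using zero[OF lift1_in[OF XYZ(1)] lift1_in[OF XYZ(2)] lift1_in[OF XYZ(3)], of "(p, q0)" "\<lambda>x. h (fst x)"]
          XYZ L1.curvature_in[OF XYZ]
        by (simp add: LP.curvature_defect_def curvature_lift111 metric_lifts k)
    qed
    show "constant_curvature A2 g2 D2 \<kappa>2"
      unfolding constant_curvature_def \<kappa>2_def using curv2 by blast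
    show "1 / f p * hessian A1 g1 D1 f X Y p + K p0 * g1 p (X p) (Y p) = 0"
      if "X \<in> M1.\<V>" "Y \<in> M1.\<V>" for X Y p
      using hess[OF that, of p q0] by (simp add: k)
    show "\<kappa>2 = K p0 * (f p)\<^sup>2 + g1 p (G p) (G p)" for p
      using \<kappa>2[of p] K_const[of p] by simp
  qed
qed

lemma concircularly_flat_iff:
  "concircularly_flat A g D \<longleftrightarrow>
    (\<forall>X\<in>P.\<V>. \<forall>Y\<in>P.\<V>. \<forall>Z\<in>P.\<V>. \<forall>x h.
      LP.curvature_defect (scalar_curvature A g D x / (real DIM('e \<times> 'f) * (real DIM('e \<times> 'f) - 1))) X Y Z x h = 0)"
  by (simp only: concircularly_flat_def concircular_curvature_def LP.curvature_defect_def)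

end

section \<open>Assembly of the equivalence\<close>

lemma pseudo_riemannian_levi_civitaI:
  assumes M: "pseudo_riemannian_manifold A g" and D: "levi_civita A g D"
  shows "pseudo_riemannian_levi_civita A g D"
proof -
  have atlas: "smooth_atlas A" and g: "pseudo_riemannian_metric A g"
    using M by (simp_all add: pseudo_riemannian_manifold_def)
  show ?thesis
  proof
    show "smooth_atlas A" "levi_civita A g D" by (rule atlas D)+
  qed (use g in \<open>unfold pseudo_riemannian_metric_def, simp_all\<close>)
qed

theorem theorem3:
  fixes A1 :: "('a::{t2_space,second_countable_topology}, 'e::euclidean_space) atlas"
    and A2 :: "('b::{t2_space,second_countable_topology}, 'f::euclidean_space) atlas"
    and A :: "('a \<times> 'b, 'e \<times> 'f) atlas"
    and g1 :: "'a metric_tensor" and g2 :: "'b metric_tensor" and g :: "('a \<times> 'b) metric_tensor"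
    and D1 :: "'a connection" and D2 :: "'b connection" and D :: "('a \<times> 'b) connection"
    and f :: "'a \<Rightarrow> real" and \<tau> :: "'a \<times> 'b \<Rightarrow> real" and n1 n2 n :: nat
  assumes M1: "pseudo_riemannian_manifold A1 g1" and "connected (UNIV :: 'a set)"
    and M2: "pseudo_riemannian_manifold A2 g2"
    and "n1 = DIM('e)" and "n1 \<ge> 2" and "n2 = DIM('f)" and "n2 \<ge> 2" and "n = n1 + n2"
    and "smooth_fun A1 f" and "\<And>p. f p > 0"
    and "A = prod_atlas A1 A2" and "g = warped_metric g1 f g2"
    and "levi_civita A1 g1 D1" and "levi_civita A2 g2 D2" and "levi_civita A g D"
    and "\<tau> = scalar_curvature A g D"
  shows "concircularly_flat A g D \<longleftrightarrow>
    (\<exists>\<kappa> \<kappa>1 \<kappa>2 :: real.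
      (constant_curvature A1 g1 D1 \<kappa>1 \<and> \<kappa>1 = \<kappa> \<and> (\<forall>x. \<kappa> = \<tau> x / (real n * (real n - 1)))) \<and>
      (\<forall>Y\<in>vector_fields A1. \<forall>Z\<in>vector_fields A1. \<forall>p q.
        1 / f p * hessian A1 g1 D1 f Y Z p
          + \<tau> (p, q) / (real n * (real n - 1)) * g1 p (Y p) (Z p) = 0) \<and>
      (constant_curvature A2 g2 D2 \<kappa>2 \<and>
        (\<forall>p q. \<kappa>2 = g1 p (gradient A1 g1 f p) (gradient A1 g1 f p)
                     + \<tau> (p, q) * (f p)\<^sup>2 / (real n * (real n - 1))) \<and>
        (\<forall>p. \<kappa>2 = \<kappa> * (f p)\<^sup>2 + g1 p (gradient A1 g1 f p) (gradient A1 g1 f p))))"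
    (is "_ \<longleftrightarrow> ?conditions")
proof -
  interpret L1: pseudo_riemannian_levi_civita A1 g1 D1
    by (rule pseudo_riemannian_levi_civitaI) fact+
  interpret L2: pseudo_riemannian_levi_civita A2 g2 D2
    by (rule pseudo_riemannian_levi_civitaI) fact+
  interpret W: warped_product A1 A2 g1 D1 g2 D2 f D
    using assms by unfold_locales auto
  define k where "k x = \<tau> x / (real n * (real n - 1))" for x
  have flat: "concircularly_flat A g D \<longleftrightarrow>
    (\<forall>X\<in>W.P.\<V>. \<forall>Y\<in>W.P.\<V>. \<forall>Z\<in>W.P.\<V>. \<forall>x h. W.LP.curvature_defect (k x) X Y Z x h = 0)"
    using assms W.concircularly_flat_iff by (simp add: k_def)
  have \<tau>: "\<tau> x * c / (real n * (real n - 1)) = k x * c" for x c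
    by (simp add: k_def)
  show ?thesis
  proof
    assume "concircularly_flat A g D"
    then have zero: "W.LP.curvature_defect (k x) X Y Z x h = 0"
      if "X \<in> W.P.\<V>" "Y \<in> W.P.\<V>" "Z \<in> W.P.\<V>" for X Y Z x h
      \<comment> \<open>The simplifier splits quantifiers over pairs, so the point has to be
        presented as a pair too.\<close>
      unfolding flat using that by (cases x) simp
    have dim: "DIM('f) \<ge> 2" using assms by simp
    show ?conditions
    proof (rule W.curvature_defect_zero_imp[OF \<open>connected UNIV\<close> dim zero])
      fix \<kappa> \<kappa>2
      assume c: "\<And>x. k x = \<kappa>" "constant_curvature A1 g1 D1 \<kappa>" "constant_curvature A2 g2 D2 \<kappa>2"
        "\<And>X Y p. X \<in> vector_fields A1 \<Longrightarrow> Y \<in> vector_fields A1 \<Longrightarrow>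
          1 / f p * hessian A1 g1 D1 f X Y p + \<kappa> * g1 p (X p) (Y p) = 0"
        "\<And>p. \<kappa>2 = \<kappa> * (f p)\<^sup>2 + g1 p (gradient A1 g1 f p) (gradient A1 g1 f p)"
      have "\<kappa>2 = g1 p (gradient A1 g1 f p) (gradient A1 g1 f p) + \<kappa> * (f p)\<^sup>2" for p
        by (subst c(5)[of p]) (rule add.commute)
      then show ?conditions
        unfolding \<tau> k_def[symmetric] c(1) using c(2-5) by blast
    qed
  next
    assume ?conditions
    then obtain \<kappa> \<kappa>2 where c1: "constant_curvature A1 g1 D1 \<kappa>" and k: "\<And>x. k x = \<kappa>"
      and H: "\<And>X Y p. X \<in> vector_fields A1 \<Longrightarrow> Y \<in> vector_fields A1 \<Longrightarrow>
        1 / f p * hessian A1 g1 D1 f X Y p + \<kappa> * g1 p (X p) (Y p) = 0"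
      and c2: "constant_curvature A2 g2 D2 \<kappa>2"
      and k2: "\<And>p. \<kappa>2 = \<kappa> * (f p)\<^sup>2 + g1 p (gradient A1 g1 f p) (gradient A1 g1 f p)"
      unfolding k_def by metis
    show "concircularly_flat A g D"
      unfolding flat k using W.curvature_defect_zero[OF c1 c2 H k2] by blast
  qed
qed

end
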